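(* Let $N\ge1$ be an integer and let $g\in S_0(\mathbb{R})\setminus\{0\}$. The space $\mathbf{V}_g(S_N)\subset L^2(\mathbb{T}_N^2)$ is a reproducing kernel Hilbert space and its kernel is given by $$\begin{aligned}K_g\big((x',\xi'),(x,\xi)\big)&=\frac{1}{N\|g\|_2^2}\sum_{n=0}^{N-1}e^{2\pi i(\xi-\xi')\frac nN}\,\overline{\mathbf{Z}\overline g\left(\frac nN-x,\xi\right)}\,\mathbf{Z}\overline g\left(\frac nN-x',\xi'\right)\\&=\frac{N}{\|g\|_2^2}\left\langle\mathbf{\Sigma}_N\big(\pi(x,\xi)g\big),\mathbf{\Sigma}_N\big(\pi(x',\xi')g\big)\right\rangle_{S_N}\\&=\frac{1}{\|g\|_2^2}\sum_{k_1,k_2\in\mathbb{Z}}e^{-2\pi ik_1\xi}\left\langle\pi(x+k_1,\xi+Nk_2)g,\pi(x',\xi')g\right\rangle_{L^2}.\end{aligned}$$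
   Context: For $x,\xi\in\mathbb{R}$ let $\mathbf{T}_x f(t)=f(t-x)$, $\mathbf{M}_\xi f(t)=e^{2\pi i\xi t}f(t)$ and $\pi(x,\xi)=\mathbf{M}_\xi\mathbf{T}_x$. For $f,g\in L^2(\mathbb{R})$ the short-time Fourier transform (STFT) is $\mathbf{V}_g f(x,\xi)=\langle f,\pi(x,\xi)g\rangle$. With $h_0(t)=e^{-\pi t^2}$, the Feichtinger algebra is $S_0(\mathbb{R})=\{f\in L^2(\mathbb{R}):\mathbf{V}_{h_0}f\in L^1(\mathbb{R}^2)\}$ with norm $\|f\|_{S_0}=\|\mathbf{V}_{h_0}f\|_{L^1(\mathbb{R}^2)}$; its dual is $S_0'(\mathbb{R})$. The duality pairing $\langle\cdot,\cdot\rangle_{S_0'\times S_0}$ is linear in the first and antilinear in the second argument (so $\langle\delta_t,g\rangle=\overline{g(t)}$). For $\varphi\in S_0'(\mathbb{R})$ and $g\in S_0(\mathbb{R})$, the STFT is $\mathbf{V}_g\varphi(x,\xi)=\langle\varphi,\pi(x,\xi)g\rangle_{S_0'\times S_0}$. $S_N\subset S_0'(\mathbb{R})$ is the linear span of the delta trains $\epsilon_n=\sum_{k\in\mathbb{Z}}\delta_{\frac nN+k}$, $n=0,\dots,N-1$, which form a basis of $S_N$. For $\varphi=\sum_{n=0}^{N-1}a_n\epsilon_n$ and $\psi=\sum_{n=0}^{N-1}b_n\epsilon_n$ one sets $\langle\varphi,\psi\rangle_{S_N}=\sum_{n=0}^{N-1}a_n\overline{b_n}$. The double periodization operator is $\mathbf{\Sigma}_N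 f=\sum_{k_1,k_2\in\mathbb{Z}}\mathbf{M}_{Nk_2}\mathbf{T}_{k_1}f$ for $f\in S_0(\mathbb{R})$ (unconditional weak-$*$ convergence in $S_0'(\mathbb{R})$); it maps $S_0(\mathbb{R})$ into $S_N$. The Zak transform is $\mathbf{Z}f(x,\xi)=\sum_{k\in\mathbb{Z}}f(x-k)e^{2\pi ik\xi}$, and $\overline g$ is the complex conjugate of $g$. $\mathbb{T}_N^2=\mathbb{R}^2/(\mathbb{Z}\times N\mathbb{Z})$, represented by $[0,1]\times[0,N]$ with Lebesgue measure; $\mathbf{V}_g(S_N)$ carries the $L^2(\mathbb{T}_N^2)$ inner product. The kernel convention is $F(x',\xi')=\int_{\mathbb{T}_N^2}F(x,\xi)\,K_g\big((x',\xi'),(x,\xi)\big)\,dx\,d\xi$ for all $F\in\mathbf{V}_g(S_N)$. *)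

theory Defs
  imports "HOL-Analysis.Analysis"
begin

section \<open>Square-integrable functions\<close>

definition square_integrable :: "'a measure \<Rightarrow> ('a \<Rightarrow> complex) set" where
  "square_integrable M =
     {f. f \<in> borel_measurable M \<and> integrable M (\<lambda>x. (norm (f x))\<^sup>2)}"

definition inner_L2 :: "'a measure \<Rightarrow> ('a \<Rightarrow> complex) \<Rightarrow> ('a \<Rightarrow> complex) \<Rightarrow> complex" where
  "inner_L2 M f g = (LINT x|M. f x * cnj (g x))"

definition norm_L2 :: "'a measure \<Rightarrow> ('a \<Rightarrow> complex) \<Rightarrow> real" where
  "norm_L2 M f = sqrt (LINT x|M. (norm (f x))\<^sup>2)"


section \<open>Reproducing kernel Hilbert spaces of functions\<close>

definition complex_linear_space :: "('a \<Rightarrow> complex) set \<Rightarrow> bool" where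
  "complex_linear_space H \<longleftrightarrow>
     (\<lambda>_. 0) \<in> H \<and>
     (\<forall>F\<in>H. \<forall>G\<in>H. (\<lambda>z. F z + G z) \<in> H) \<and>
     (\<forall>c. \<forall>F\<in>H. (\<lambda>z. c * F z) \<in> H)"

definition inner_product_on ::
  "('a \<Rightarrow> complex) set \<Rightarrow> (('a \<Rightarrow> complex) \<Rightarrow> ('a \<Rightarrow> complex) \<Rightarrow> complex) \<Rightarrow> bool" where
  "inner_product_on H ip \<longleftrightarrow>
     (\<forall>F\<in>H. \<forall>G\<in>H. \<forall>E\<in>H. ip (\<lambda>z. F z + G z) E = ip F E + ip G E) \<and>
     (\<forall>c. \<forall>F\<in>H. \<forall>E\<in>H. ip (\<lambda>z. c * F z) E = c * ip F E) \<and>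
     (\<forall>F\<in>H. \<forall>G\<in>H. ip G F = cnj (ip F G)) \<and>
     (\<forall>F\<in>H. 0 \<le> Re (ip F F)) \<and>
     (\<forall>F\<in>H. ip F F = 0 \<longrightarrow> F = (\<lambda>_. 0))"

definition ip_norm ::
  "(('a \<Rightarrow> complex) \<Rightarrow> ('a \<Rightarrow> complex) \<Rightarrow> complex) \<Rightarrow> ('a \<Rightarrow> complex) \<Rightarrow> real" where
  "ip_norm ip F = sqrt (Re (ip F F))"

definition complete_on ::
  "('a \<Rightarrow> complex) set \<Rightarrow> (('a \<Rightarrow> complex) \<Rightarrow> ('a \<Rightarrow> complex) \<Rightarrow> complex) \<Rightarrow> bool" where
  "complete_on H ip \<longleftrightarrow>
     (\<forall>F :: nat \<Rightarrow> 'a \<Rightarrow> complex.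
        (\<forall>n. F n \<in> H) \<and>
        (\<forall>e>0. \<exists>n0. \<forall>m\<ge>n0. \<forall>n\<ge>n0. ip_norm ip (\<lambda>z. F m z - F n z) < e) \<longrightarrow>
        (\<exists>G\<in>H. (\<lambda>n. ip_norm ip (\<lambda>z. F n z - G z)) \<longlonglongrightarrow> 0))"

definition rkhs ::
  "('a \<Rightarrow> complex) set \<Rightarrow> (('a \<Rightarrow> complex) \<Rightarrow> ('a \<Rightarrow> complex) \<Rightarrow> complex) \<Rightarrow> bool" where
  "rkhs H ip \<longleftrightarrow>
     complex_linear_space H \<and> inner_product_on H ip \<and> complete_on H ip \<and>
     (\<forall>z. \<exists>C. \<forall>F\<in>H. norm (F z) \<le> C * ip_norm ip F)"

text \<open>
  The evaluation point is the first argument of the kernel. Since \<open>ip\<close> is antilinear in its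
  second argument, the representer of the evaluation at \<open>z'\<close> is the conjugate of \<open>K z'\<close>; for
  \<open>ip = inner_L2 M\<close> the second conjunct says that \<open>F z'\<close> is the integral of \<open>F z * K z' z\<close>
  with respect to \<open>z\<close>.
\<close>
definition is_reproducing_kernel ::
  "('a \<Rightarrow> complex) set \<Rightarrow> (('a \<Rightarrow> complex) \<Rightarrow> ('a \<Rightarrow> complex) \<Rightarrow> complex) \<Rightarrow>
   ('a \<Rightarrow> 'a \<Rightarrow> complex) \<Rightarrow> bool" where
  "is_reproducing_kernel H ip K \<longleftrightarrow>
     (\<forall>z'. (\<lambda>z. cnj (K z' z)) \<in> H) \<and>
     (\<forall>F\<in>H. \<forall>z'. F z' = ip F (\<lambda>z. cnj (K z' z)))"


section \<open>Time-frequency shifts and the Feichtinger algebra\<close>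

definition translation :: "real \<Rightarrow> (real \<Rightarrow> complex) \<Rightarrow> real \<Rightarrow> complex" where
  "translation x f = (\<lambda>t. f (t - x))"

definition modulation :: "real \<Rightarrow> (real \<Rightarrow> complex) \<Rightarrow> real \<Rightarrow> complex" where
  "modulation \<xi> f = (\<lambda>t. cis (2 * pi * \<xi> * t) * f t)"

definition tf_shift :: "real \<Rightarrow> real \<Rightarrow> (real \<Rightarrow> complex) \<Rightarrow> real \<Rightarrow> complex" where
  "tf_shift x \<xi> f = modulation \<xi> (translation x f)"

definition stft :: "(real \<Rightarrow> complex) \<Rightarrow> (real \<Rightarrow> complex) \<Rightarrow> real \<times> real \<Rightarrow> complex" where
  "stft g f = (\<lambda>(x, \<xi>). inner_L2 lborel f (tf_shift x \<xi> g))"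

definition gaussian :: "real \<Rightarrow> complex" where
  "gaussian t = complex_of_real (exp (- pi * t\<^sup>2))"

text \<open>
  Every class in $L^2$ whose STFT with Gaussian window is integrable has exactly one continuous
  representative; \<open>S0\<close> consists of these representatives, so that point values are meaningful.
\<close>
definition S0 :: "(real \<Rightarrow> complex) set" where
  "S0 = {f \<in> square_integrable lborel.
           continuous_on UNIV f \<and> integrable lborel (stft gaussian f)}"

definition S0_norm :: "(real \<Rightarrow> complex) \<Rightarrow> real" where
  "S0_norm f = (LINT z|lborel. norm (stft gaussian f z))"


section \<open>The dual of the Feichtinger algebra\<close>

text \<open>
  The pairing of \<open>\<phi>\<close> with \<open>f\<close> is the value \<open>\<phi> f\<close>. As the pairing is antilinear in \<open>f\<close>, elements
  of the dual are bounded antilinear functionals. They are functions on the whole type and take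
  the value 0 off \<open>S0\<close>, which makes equality of functionals coincide with equality on \<open>S0\<close>.
\<close>
type_synonym functional = "(real \<Rightarrow> complex) \<Rightarrow> complex"

definition S0_dual :: "functional set" where
  "S0_dual = {\<phi>.
     (\<forall>f\<in>S0. \<forall>h\<in>S0. \<phi> (\<lambda>t. f t + h t) = \<phi> f + \<phi> h) \<and>
     (\<forall>c. \<forall>f\<in>S0. \<phi> (\<lambda>t. c * f t) = cnj c * \<phi> f) \<and>
     (\<exists>C. \<forall>f\<in>S0. norm (\<phi> f) \<le> C * S0_norm f) \<and>
     (\<forall>f. f \<notin> S0 \<longrightarrow> \<phi> f = 0)}"

definition stft_dual :: "(real \<Rightarrow> complex) \<Rightarrow> functional \<Rightarrow> real \<times> real \<Rightarrow> complex" where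
  "stft_dual g \<phi> = (\<lambda>(x, \<xi>). \<phi> (tf_shift x \<xi> g))"

definition dual_of :: "(real \<Rightarrow> complex) \<Rightarrow> functional" where
  "dual_of f = (\<lambda>h. if h \<in> S0 then inner_L2 lborel f h else 0)"

definition delta :: "real \<Rightarrow> functional" where
  "delta t = (\<lambda>h. if h \<in> S0 then cnj (h t) else 0)"

text \<open>Sum of an unconditionally weak-* convergent family.\<close>
definition weak_star_sum :: "('i \<Rightarrow> functional) \<Rightarrow> functional" where
  "weak_star_sum u =
     (THE \<phi>. \<phi> \<in> S0_dual \<and> (\<forall>h\<in>S0. ((\<lambda>i. u i h) has_sum \<phi> h) UNIV))"


section \<open>Delta trains, double periodization, Zak transform\<close>

definition delta_train :: "nat \<Rightarrow> nat \<Rightarrow> functional" where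
  "delta_train N n = weak_star_sum (\<lambda>k::int. delta (real n / real N + of_int k))"

definition delta_comb :: "nat \<Rightarrow> (nat \<Rightarrow> complex) \<Rightarrow> functional" where
  "delta_comb N a = (\<lambda>h. \<Sum>n<N. a n * delta_train N n h)"

definition SN :: "nat \<Rightarrow> functional set" where
  "SN N = range (delta_comb N)"

text \<open>
  The value described by \<open>THE\<close> is unique for \<open>\<phi>\<close> and \<open>\<psi>\<close> in \<open>SN N\<close>, because the delta trains are
  linearly independent and only the coefficients with index below \<open>N\<close> enter.
\<close>
definition inner_SN :: "nat \<Rightarrow> functional \<Rightarrow> functional \<Rightarrow> complex" where
  "inner_SN N \<phi> \<psi> =
     (THE c. \<exists>a b. \<phi> = delta_comb N a \<and> \<psi> = delta_comb N b \<and> c = (\<Sum>n<N. a n * cnj (b n)))"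

definition double_periodization :: "nat \<Rightarrow> (real \<Rightarrow> complex) \<Rightarrow> functional" where
  "double_periodization N f =
     weak_star_sum (\<lambda>(k1::int, k2::int).
       dual_of (modulation (real N * of_int k2) (translation (of_int k1) f)))"

definition zak :: "(real \<Rightarrow> complex) \<Rightarrow> real \<Rightarrow> real \<Rightarrow> complex" where
  "zak f x \<xi> = (\<Sum>\<^sub>\<infinity>k::int. f (x - of_int k) * cis (2 * pi * of_int k * \<xi>))"

text \<open>
  Lebesgue measure on the fundamental domain of the torus. The functions \<open>stft_dual g \<phi>\<close> with
  \<open>\<phi>\<close> in \<open>SN N\<close> are only quasi-periodic in the first variable, but they are determined on all of
  the plane by their restriction to this rectangle, so \<open>stft_space\<close> keeps them as functions on
  the plane and measures them on the rectangle.
\<close>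
definition torus :: "nat \<Rightarrow> (real \<times> real) measure" where
  "torus N = restrict_space lborel ({0..1} \<times> {0..real N})"

definition stft_space :: "nat \<Rightarrow> (real \<Rightarrow> complex) \<Rightarrow> (real \<times> real \<Rightarrow> complex) set" where
  "stft_space N g = stft_dual g ` SN N"

end

theory Submission
  imports Defs "HOL-Probability.Probability" "HOL-Real_Asymp.Real_Asymp"
begin

text \<open>
  The STFT \<open>E n\<close> of the delta train through \<open>n / N\<close> is, up to a phase, a Zak transform of \<open>cnj \<circ> g\<close>. As a
  function of the frequency it is a series of exponentials whose frequencies lie in the residue
  class of \<open>n\<close> modulo \<open>N\<close>, divided by \<open>N\<close>. Exponentials with different frequencies are orthogonal
  over an interval of length \<open>N\<close>, and the time integrals of the diagonal terms tile the line; hence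
  \<open>E 0, ..., E (N - 1)\<close> are orthogonal on the torus, all with squared norm \<open>N * (norm_L2 lborel g)\<^sup>2\<close>
  (\<open>stft_delta_train_orthogonal\<close>). The space \<open>stft_space N g\<close> is their span, so it is a reproducing
  kernel Hilbert space whose kernel is the normalized sum of \<open>E n z' * cnj (E n z)\<close> (locale
  \<open>finite_orthogonal_family\<close>). With the Zak transforms inserted this is the first formula.
  Orthogonality also yields the linear independence of the delta trains, so the inner product on
  their span is the expected one.

  The other two formulas come from the double periodization: for \<open>f\<close> in \<open>S0\<close> it is the combination
  of delta trains with coefficients \<open>1 / N\<close> times the integer periodization of \<open>f\<close> at \<open>n / N\<close>
  (\<open>double_periodization_eq\<close>). For a time-frequency shift of \<open>g\<close> by \<open>z\<close> these coefficients are
  \<open>cnj (E n z) / N\<close>. Their inner product gives the second formula, and applying the functional to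
  a second time-frequency shift of \<open>g\<close> gives the third one.

  That combination is found by Poisson summation in the modulation index. What makes it
  legitimate is that the pairings of the shifted \<open>f\<close> with \<open>h\<close> are absolutely summable over the
  lattice for all \<open>f\<close> and \<open>h\<close> in \<open>S0\<close> (\<open>S0_product_transform_summable\<close>). The tool for this is the
  \<open>L\<^sup>1\<close> norm of the Fourier transform, which is submultiplicative. The Feichtinger norm
  integrates this norm of \<open>f\<close> times a Gaussian window over all window positions. By Fourier
  inversion it dominates the sum of the local suprema of \<open>f\<close> (\<open>S0_local_bound\<close>), which gives the
  convergence of all sums of samples; and writing a product through a continuous Gaussian
  partition of unity reduces the lattice sums to integrals of these local norms.
\<close>

section \<open>Interchanging infinite sums and integrals\<close>

abbreviation counting :: "int measure" where
  "counting \<equiv> count_space UNIV"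

lemma summable_norm_iff_nn_integral:
  fixes f :: "'i \<Rightarrow> 'b::{banach,second_countable_topology}"
  shows "(\<lambda>i. norm (f i)) summable_on A \<longleftrightarrow> (\<integral>\<^sup>+i. ennreal (norm (f i)) \<partial>count_space A) < \<infinity>"
  unfolding abs_summable_equivalent abs_summable_on_def
  by (simp add: integrable_iff_bounded)

lemma infsum_eq_integral_count_space:
  fixes f :: "'i \<Rightarrow> complex"
  assumes "(\<lambda>i. norm (f i)) summable_on A"
  shows "infsum f A = (LINT i|count_space A. f i)"
  using infsetsum_infsum[of f A] assms
  by (simp add: abs_summable_equivalent infsetsum_def)

text \<open>
  Fubini's theorem for the product of a measure with a counting measure, in the form needed
  for unordered sums. Absolute convergence at every point, not only almost everywhere, makes
  the pointwise sum agree with the integral over the counting measure without exceptional sets.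
\<close>
lemma has_sum_integral:
  fixes f :: "'i::countable \<Rightarrow> 'a \<Rightarrow> complex"
  assumes M: "sigma_finite_measure M"
    and [measurable]: "\<And>i. f i \<in> borel_measurable M"
    and pt: "\<And>x. x \<in> space M \<Longrightarrow> (\<lambda>i. norm (f i x)) summable_on UNIV"
    and fin: "(\<integral>\<^sup>+x. \<integral>\<^sup>+i. norm (f i x) \<partial>count_space UNIV \<partial>M) < \<infinity>"
  shows "integrable M (\<lambda>x. \<Sum>\<^sub>\<infinity>i. f i x)"
    and "((\<lambda>i. LINT x|M. f i x) has_sum (LINT x|M. (\<Sum>\<^sub>\<infinity>i. f i x))) UNIV"
    and "\<And>i. integrable M (f i)"
    and "(\<lambda>i. norm (LINT x|M. f i x)) summable_on UNIV"
proof -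
  interpret M: sigma_finite_measure M by fact
  interpret C: sigma_finite_measure "count_space (UNIV::'i set)"
    by (rule sigma_finite_measure_count_space)
  interpret P: pair_sigma_finite M "count_space (UNIV::'i set)" ..
  have [measurable]: "(\<lambda>(x,i). f i x) \<in> borel_measurable (M \<Otimes>\<^sub>M count_space UNIV)"
    unfolding case_prod_beta
    by (rule measurable_compose_countable'[where I=UNIV and f="\<lambda>i z. f i (fst z)" and g=snd]) auto
  have int: "integrable (M \<Otimes>\<^sub>M count_space UNIV) (\<lambda>(x,i). f i x)"
  proof (rule integrableI_bounded)
    show "(\<lambda>(x,i). f i x) \<in> borel_measurable (M \<Otimes>\<^sub>M count_space UNIV)" by measurable
    show "(\<integral>\<^sup>+ z. ennreal (norm (case z of (x, i) \<Rightarrow> f i x)) \<partial>(M \<Otimes>\<^sub>M count_space UNIV)) < \<infinity>"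
      using fin by (subst C.nn_integral_fst[symmetric]) (auto simp: split_beta')
  qed
  have eq: "(LINT i|count_space UNIV. f i x) = (\<Sum>\<^sub>\<infinity>i. f i x)" if "x \<in> space M" for x
    using infsum_eq_integral_count_space[OF pt[OF that]] by simp
  have "integrable M (\<lambda>x. LINT i|count_space UNIV. f i x)"
    using P.integrable_fst[OF int] by simp
  then show 1: "integrable M (\<lambda>x. \<Sum>\<^sub>\<infinity>i. f i x)"
    by (rule Bochner_Integration.integrable_cong[THEN iffD1, rotated -1]) (auto simp: eq)
  show ii: "integrable M (f i)" for i
  proof (rule integrableI_bounded)
    have "(\<integral>\<^sup>+x. norm (f i x) \<partial>M) \<le> (\<integral>\<^sup>+x. \<integral>\<^sup>+i. norm (f i x) \<partial>count_space UNIV \<partial>M)"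
      by (intro nn_integral_mono) (rule nn_integral_ge_point[where A=UNIV and x=i and p="\<lambda>i. ennreal (norm (f i _))", simplified])
    then show "(\<integral>\<^sup>+x. norm (f i x) \<partial>M) < \<infinity>" using fin by (auto intro: le_less_trans)
  qed simp
  have i2: "integrable (count_space UNIV) (\<lambda>i. LINT x|M. f i x)"
    using P.integrable_snd[of "\<lambda>x i. f i x"] int by simp
  show sm: "(\<lambda>i. norm (LINT x|M. f i x)) summable_on UNIV"
    using i2 unfolding summable_norm_iff_nn_integral by (simp add: integrable_iff_bounded)
  have "(\<Sum>\<^sub>\<infinity>i. LINT x|M. f i x) = (LINT i|count_space UNIV. LINT x|M. f i x)"
    by (rule infsum_eq_integral_count_space[OF sm])
  also have "\<dots> = (LINT x|M. LINT i|count_space UNIV. f i x)"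
    using P.Fubini_integral[of "\<lambda>x i. f i x"] int by simp
  also have "\<dots> = (LINT x|M. (\<Sum>\<^sub>\<infinity>i. f i x))"
    by (intro Bochner_Integration.integral_cong) (auto simp: eq)
  finally show "((\<lambda>i. LINT x|M. f i x) has_sum (LINT x|M. (\<Sum>\<^sub>\<infinity>i. f i x))) UNIV"
    using has_sum_infsum[OF abs_summable_summable[OF sm]] by metis
qed

lemma (in pair_sigma_finite) integrable_product_mult:
  fixes f :: "'a \<Rightarrow> complex" and g :: "'b \<Rightarrow> complex"
  assumes [measurable]: "integrable M1 f" "integrable M2 g"
  shows "integrable (M1 \<Otimes>\<^sub>M M2) (\<lambda>z. f (fst z) * g (snd z))"
  by (rule Fubini_integrable) (use assms in \<open>auto simp: norm_mult\<close>)

text \<open>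
  The translates of a half-open unit interval partition the line, so integrals over the line
  are sums over the cells; this is how periodization enters below.
\<close>
lemma tile_single:
  fixes a t :: real
  shows "(t - of_int m \<in> {a..<a+1}) \<longleftrightarrow> m = \<lfloor>t - a\<rfloor>"
  by (auto simp: floor_eq_iff) linarith+

lemma nn_integral_tiling:
  fixes F :: "real \<Rightarrow> ennreal"
  assumes [measurable]: "F \<in> borel_measurable borel"
  shows "(\<integral>\<^sup>+t. F t \<partial>lborel) = (\<integral>\<^sup>+m. \<integral>\<^sup>+t. F (t + of_int m) * indicator {a..<a+1} t \<partial>lborel \<partial>counting)"
proof -
  have "(\<integral>\<^sup>+m. F t * indicator {a..<a+1} (t - of_int m) \<partial>counting) = F t" for t
  proof -
    have "(\<integral>\<^sup>+m. F t * indicator {a..<a+1} (t - of_int m) \<partial>counting)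
       = (\<integral>\<^sup>+m. F t * indicator {\<lfloor>t - a\<rfloor>} m \<partial>counting)"
      by (intro nn_integral_cong) (auto simp: indicator_def tile_single simp del: atLeastLessThan_iff)
    then show ?thesis by (simp add: one_ennreal_def[symmetric])
  qed
  then have "(\<integral>\<^sup>+t. F t \<partial>lborel) = (\<integral>\<^sup>+t. \<integral>\<^sup>+m. F t * indicator {a..<a+1} (t - of_int m) \<partial>counting \<partial>lborel)"
    by simp
  also have "\<dots> = (\<integral>\<^sup>+m. \<integral>\<^sup>+t. F t * indicator {a..<a+1} (t - of_int m) \<partial>lborel \<partial>counting)"
    by (rule nn_integral_count_space_nn_integral) auto
  also have "\<dots> = (\<integral>\<^sup>+m. \<integral>\<^sup>+t. F (t + of_int m) * indicator {a..<a+1} t \<partial>lborel \<partial>counting)"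
  proof (rule nn_integral_cong)
    fix m :: int
    show "(\<integral>\<^sup>+t. F t * indicator {a..<a+1} (t - of_int m) \<partial>lborel)
      = (\<integral>\<^sup>+t. F (t + of_int m) * indicator {a..<a+1} t \<partial>lborel)"
      by (subst nn_integral_real_affine[where c=1 and t="of_int m"]) (auto simp: add.commute)
  qed
  finally show ?thesis .
qed

lemma has_sum_integral_tiling:
  fixes F :: "real \<Rightarrow> complex"
  assumes F: "integrable lborel F"
  shows "((\<lambda>m::int. LINT t|lborel. F (t + of_int m) * indicator {a..<a+1} t) has_sum (LINT t|lborel. F t)) UNIV"
proof -
  have [measurable]: "F \<in> borel_measurable borel" using F by auto
  define G where "G = (\<lambda>(m::int) t. F t * indicator {a..<a+1} (t - of_int m))"
  have G: "G m t = (if m \<in> {\<lfloor>t - a\<rfloor>} then F t else 0)" for m t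
    by (auto simp: G_def indicator_def tile_single simp del: atLeastLessThan_iff)
  have s: "(\<lambda>m. norm (G m t)) summable_on UNIV" for t
  proof -
    have "(\<lambda>m. norm (G m t)) summable_on UNIV \<longleftrightarrow> (\<lambda>m. norm (G m t)) summable_on {\<lfloor>t - a\<rfloor>}"
      by (rule summable_on_cong_neutral) (auto simp: G)
    then show ?thesis by simp
  qed
  have i: "(\<Sum>\<^sub>\<infinity>m. G m t) = F t" for t
  proof -
    have "(\<Sum>\<^sub>\<infinity>m. G m t) = (\<Sum>\<^sub>\<infinity>m\<in>{\<lfloor>t - a\<rfloor>}. G m t)"
      by (rule infsum_cong_neutral) (auto simp: G)
    then show ?thesis by (simp add: G)
  qed
  have n: "(\<integral>\<^sup>+m. ennreal (norm (G m t)) \<partial>count_space UNIV) = norm (F t)" for t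
  proof -
    have "(\<integral>\<^sup>+m. ennreal (norm (G m t)) \<partial>count_space UNIV)
       = (\<integral>\<^sup>+m. ennreal (norm (F t)) * indicator {\<lfloor>t - a\<rfloor>} m \<partial>counting)"
      by (intro nn_integral_cong) (auto simp: G)
    then show ?thesis by (simp add: one_ennreal_def[symmetric])
  qed
  have "((\<lambda>m. LINT t|lborel. G m t) has_sum (LINT t|lborel. (\<Sum>\<^sub>\<infinity>m. G m t))) UNIV"
  proof (rule has_sum_integral(2)[OF sigma_finite_lborel _ s])
    show "G m \<in> borel_measurable lborel" for m unfolding G_def by simp
  qed (use F in \<open>auto simp: n integrable_iff_bounded\<close>)
  moreover have "(LINT t|lborel. G m t) = (LINT t|lborel. F (t + of_int m) * indicator {a..<a+1} t)" for m
    by (subst lborel_integral_real_affine[where c=1 and t="of_int m"]) (auto simp: G_def add.commute)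
  ultimately show ?thesis by (simp add: i)
qed

section \<open>Fourier inversion\<close>

text \<open>
  The kernels only have to concentrate at the origin: their mass near it tends to 1 and they
  tend to 0 uniformly away from it. The uniform decay, rather than decay of the mass alone,
  allows integrable test functions that are continuous at one point but possibly unbounded.
  The lemma is used with Gaussians for Fourier inversion and with Poisson kernels for Poisson
  summation.
\<close>
lemma approximate_identity:
  fixes p :: "real \<Rightarrow> complex" and k :: "nat \<Rightarrow> real \<Rightarrow> real"
  assumes p: "integrable lborel p" and cont: "isCont p 0"
    and k: "\<And>n. integrable lborel (k n)" "\<And>n s. 0 \<le> k n s" 
    and pk: "\<And>n. integrable lborel (\<lambda>s. p s * k n s)"
    and near: "\<And>\<delta>. 0 < \<delta> \<Longrightarrow> (\<lambda>n. LINT s|lborel. k n s * indicator {-\<delta><..<\<delta>} s) \<longlonglongrightarrow> 1"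
    and far: "\<And>\<delta>. 0 < \<delta> \<Longrightarrow> \<exists>c. c \<longlonglongrightarrow> 0 \<and> (\<forall>n s. \<delta> \<le> \<bar>s\<bar> \<longrightarrow> k n s \<le> c n)"
  shows "(\<lambda>n. LINT s|lborel. p s * k n s) \<longlonglongrightarrow> p 0"
proof (rule LIMSEQ_I)
  fix e :: real assume e: "0 < e"
  have [measurable]: "p \<in> borel_measurable borel" "\<And>n. k n \<in> borel_measurable borel" using p k by auto
  from cont e obtain \<delta> where \<delta>: "\<delta> > 0" "\<And>s. \<bar>s\<bar> < \<delta> \<Longrightarrow> norm (p s - p 0) < e/2"
    unfolding isCont_def LIM_def dist_norm by (metis diff_zero half_gt_zero norm_zero real_norm_def diff_self)
  obtain c where c: "c \<longlonglongrightarrow> 0" "\<And>n s. \<delta> \<le> \<bar>s\<bar> \<Longrightarrow> k n s \<le> c n" using far[OF \<delta>(1)] by auto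
  define I where "I n = (LINT s|lborel. k n s * indicator {-\<delta><..<\<delta>} s)" for n
  define P where "P = (LINT s|lborel. norm (p s))"
  have I: "I \<longlonglongrightarrow> 1" unfolding I_def[abs_def] by (rule near[OF \<delta>(1)])
  have "(\<lambda>n. e/2 * I n + norm (p 0) * \<bar>I n - 1\<bar> + c n * P) \<longlonglongrightarrow> e/2 * 1 + norm (p 0) * \<bar>1 - 1\<bar> + 0 * P"
    by (intro tendsto_intros I c)
  then have "eventually (\<lambda>n. e/2 * I n + norm (p 0) * \<bar>I n - 1\<bar> + c n * P < e) sequentially"
    by (rule order_tendstoD(2)) (use e in auto)
  then obtain n0 where n0: "\<And>n. n \<ge> n0 \<Longrightarrow> e/2 * I n + norm (p 0) * \<bar>I n - 1\<bar> + c n * P < e"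
    unfolding eventually_sequentially by auto
  have "norm ((LINT s|lborel. p s * k n s) - p 0) \<le> e/2 * I n + norm (p 0) * \<bar>I n - 1\<bar> + c n * P" for n
  proof -
    let ?i = "\<lambda>s. indicator {-\<delta><..<\<delta>} s :: real"
    have ki: "integrable lborel (\<lambda>s. k n s * ?i s)"
      by (rule Bochner_Integration.integrable_bound[OF k(1)[of n]]) (auto simp: indicator_def)
    have kic: "integrable lborel (\<lambda>s. p 0 * complex_of_real (k n s * ?i s))"
      by (intro integrable_mult_right integrable_of_real ki)
    have pki: "integrable lborel (\<lambda>s. p s * k n s * ?i s)"
      by (rule Bochner_Integration.integrable_bound[OF pk[of n]]) (auto simp: indicator_def)
    have i1: "integrable lborel (\<lambda>s. (p s - p 0) * complex_of_real (k n s * ?i s))"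
      using Bochner_Integration.integrable_diff[OF pki kic] by (simp add: algebra_simps)
    have i2: "integrable lborel (\<lambda>s. p s * k n s * (1 - ?i s))"
      using Bochner_Integration.integrable_diff[OF pk[of n] pki] by (simp add: algebra_simps)
    have "(LINT s|lborel. p s * k n s) = (LINT s|lborel. (p s - p 0) * complex_of_real (k n s * ?i s) + p 0 * complex_of_real (k n s * ?i s) + p s * k n s * (1 - ?i s))"
      by (rule Bochner_Integration.integral_cong) (auto simp: algebra_simps)
    also have "\<dots> = (LINT s|lborel. (p s - p 0) * complex_of_real (k n s * ?i s)) + p 0 * I n + (LINT s|lborel. p s * k n s * (1 - ?i s))"
      using i1 kic i2 by (simp add: I_def del: of_real_mult)
    finally have split: "(LINT s|lborel. p s * k n s) - p 0 = (LINT s|lborel. (p s - p 0) * complex_of_real (k n s * ?i s)) + p 0 * (I n - 1) + (LINT s|lborel. p s * k n s * (1 - ?i s))"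
      by (simp add: algebra_simps)
    have "norm (LINT s|lborel. (p s - p 0) * complex_of_real (k n s * ?i s)) \<le> (LINT s|lborel. e/2 * (k n s * ?i s))"
    proof (rule Bochner_Integration.integral_norm_bound_integral[OF i1])
      show "integrable lborel (\<lambda>s. e/2 * (k n s * ?i s))" using ki by simp
      show "norm ((p s - p 0) * complex_of_real (k n s * ?i s)) \<le> e/2 * (k n s * ?i s)" for s
      proof (cases "\<bar>s\<bar> < \<delta>")
        case True
        then have "norm (p s - p 0) * k n s \<le> e/2 * k n s"
          using \<delta>(2)[of s] k(2)[of n s] by (intro mult_right_mono) auto
        then show ?thesis using True k(2)[of n s] by (simp add: norm_mult indicator_def)
      qed (auto simp: indicator_def)
    qed
    then have n1: "norm (LINT s|lborel. (p s - p 0) * complex_of_real (k n s * ?i s)) \<le> e/2 * I n" by (simp add: I_def)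
    have n2: "norm (p 0 * (I n - 1)) = norm (p 0) * \<bar>I n - 1\<bar>"
      unfolding norm_mult by (metis norm_of_real of_real_1 of_real_diff real_norm_def)
    have "norm (LINT s|lborel. p s * k n s * (1 - ?i s)) \<le> (LINT s|lborel. c n * norm (p s))"
    proof (rule Bochner_Integration.integral_norm_bound_integral[OF i2])
      show "integrable lborel (\<lambda>s. c n * norm (p s))" using p by simp
      have c0: "0 \<le> c n" using c(2)[of \<delta> n] k(2)[of n \<delta>] \<delta>(1) by auto
      show "norm (p s * k n s * (1 - ?i s)) \<le> c n * norm (p s)" for s
      proof (cases "\<bar>s\<bar> < \<delta>")
        case True
        then show ?thesis using c0 by (auto simp: indicator_def)
      next
        case False
        then show ?thesis using c(2)[of s n] k(2)[of n s]
          by (auto simp: indicator_def norm_mult mult.commute[of "norm (p s)"] intro!: mult_right_mono)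
      qed
    qed
    then have n3: "norm (LINT s|lborel. p s * k n s * (1 - ?i s)) \<le> c n * P" by (simp add: P_def)
    show ?thesis unfolding split
      using norm_triangle_mono[OF norm_triangle_mono[OF n1 eq_refl[OF n2]] n3] .
  qed
  then show "\<exists>n0. \<forall>n\<ge>n0. norm ((LINT s|lborel. p s * k n s) - p 0) < e"
    using n0 le_less_trans by blast
qed

definition fourier :: "(real \<Rightarrow> complex) \<Rightarrow> real \<Rightarrow> complex" where
  "fourier u \<xi> = (LINT t|lborel. u t * cis (- 2 * pi * \<xi> * t))"

lemma cis_measurable[measurable]: "cis \<in> borel_measurable borel"
  by (intro borel_measurable_continuous_onI continuous_intros)

lemma integrable_cis_mult:
  fixes u :: "'a \<Rightarrow> complex"
  assumes "integrable M u" "(\<lambda>t. cis (f t)) \<in> borel_measurable M"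
  shows "integrable M (\<lambda>t. u t * cis (f t))"
  by (rule Bochner_Integration.integrable_bound[OF assms(1)])
     (use assms in \<open>auto simp: norm_mult intro!: borel_measurable_times\<close>)

lemma borel_measurable_fourier [measurable]:
  assumes [measurable]: "u \<in> borel_measurable borel"
  shows "fourier u \<in> borel_measurable borel"
  unfolding fourier_def[abs_def] by measurable

lemma gaussian_measurable[measurable]: "gaussian \<in> borel_measurable borel"
  unfolding gaussian_def[abs_def] by measurable

lemma norm_gaussian: "norm (gaussian t) = exp (- pi * t\<^sup>2)"
  by (simp add: gaussian_def)

text \<open>
  The Gaussian is its own Fourier transform; after rescaling this is the formula for the
  characteristic function of the standard normal distribution.
\<close>
lemma gaussian_scaled_transform:
  assumes a: "a > 0"
  shows "integrable lborel (\<lambda>t. gaussian (a * t))"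
    and "(LINT t|lborel. gaussian (a * t) * cis (2 * pi * \<xi> * t)) = gaussian (\<xi> / a) / a"
proof -
  define s where "s = a * sqrt (2 * pi)"
  have s: "s > 0" "s \<noteq> 0" using a by (auto simp: s_def)
  have e: "complex_of_real (std_normal_density (s * t)) = gaussian (a * t) / sqrt (2 * pi)" for t
  proof -
    have "- (s * t)\<^sup>2 / 2 = - pi * (a * t)\<^sup>2"
      by (simp add: s_def power_mult_distrib)
    then show ?thesis by (simp add: std_normal_density_def gaussian_def)
  qed
  have "integrable lborel std_normal_density" by simp
  then have "integrable lborel (\<lambda>t. complex_of_real (std_normal_density (0 + s * t)))"
    by (intro integrable_of_real lborel_integrable_real_affine s)
  then have "integrable lborel (\<lambda>t. complex_of_real (sqrt (2*pi)) * complex_of_real (std_normal_density (s * t)))"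
    by simp
  then show "integrable lborel (\<lambda>t. gaussian (a * t))"
    unfolding e by (simp add: )
  have "complex_of_real (exp (- (2 * pi * \<xi> / s)\<^sup>2 / 2)) = char std_normal_distribution (2 * pi * \<xi> / s)"
    using char_std_normal_distribution by simp
  also have "\<dots> = (LINT x|lborel. std_normal_density x *\<^sub>R cis (2 * pi * \<xi> / s * x))"
    unfolding char_def by (subst integral_density) (auto simp: cis_conv_exp mult_ac)
  also have "\<dots> = s *\<^sub>R (LINT t|lborel. std_normal_density (0 + s * t) *\<^sub>R cis (2 * pi * \<xi> / s * (0 + s * t)))"
    using s by (subst lborel_integral_real_affine[where c=s and t=0]) auto
  also have "(\<lambda>t. std_normal_density (0 + s * t) *\<^sub>R cis (2 * pi * \<xi> / s * (0 + s * t)))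
     = (\<lambda>t. gaussian (a * t) * cis (2 * pi * \<xi> * t) / complex_of_real (sqrt (2 * pi)))"
    using s by (auto simp: scaleR_conv_of_real e mult.assoc)
  also have "s *\<^sub>R (LINT t|lborel. gaussian (a * t) * cis (2 * pi * \<xi> * t) / complex_of_real (sqrt (2 * pi)))
     = a * (LINT t|lborel. gaussian (a * t) * cis (2 * pi * \<xi> * t))"
    by (simp add: s_def scaleR_conv_of_real)
  also have "- (2 * pi * \<xi> / s)\<^sup>2 / 2 = - pi * (\<xi> / a)\<^sup>2"
    using a by (simp add: s_def power_divide power_mult_distrib field_simps power2_eq_square)
  finally show "(LINT t|lborel. gaussian (a * t) * cis (2 * pi * \<xi> * t)) = gaussian (\<xi> / a) / a"
    using a by (simp add: gaussian_def field_simps)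
qed

lemma integral_gaussian: "(LINT s|lborel. exp (- pi * s\<^sup>2)) = 1"
proof -
  have "complex_of_real (LINT s|lborel. exp (- pi * s\<^sup>2)) = (LINT s|lborel. gaussian (1 * s) * cis (2 * pi * 0 * s))"
    by (subst integral_complex_of_real[symmetric]) (simp add: gaussian_def)
  also have "\<dots> = 1" by (subst gaussian_scaled_transform(2)) (auto simp: gaussian_def)
  finally show ?thesis by (metis of_real_eq_1_iff)
qed

text \<open>
  Damping the inverse transform by a wide Gaussian turns it, by Fubini and the self-duality of
  the Gaussian, into the average of the function against a narrow Gaussian. As the damping is
  removed, dominated convergence gives the inverse transform and the averages converge to the
  value of the function.
\<close>
lemma fourier_inversion:
  assumes u: "integrable lborel u" and cont: "isCont u t" and Fu: "integrable lborel (fourier u)"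
  shows "u t = (LINT \<xi>|lborel. fourier u \<xi> * cis (2 * pi * \<xi> * t))"
proof -
  have [measurable]: "u \<in> borel_measurable borel" using u by auto
  define K where "K n s = (real n + 1) * exp (- pi * ((real n + 1) * s)\<^sup>2)" for n :: nat and s
  have K: "complex_of_real (K n s) = (real n + 1) * gaussian ((real n + 1) * s)" for n s
    by (simp add: K_def gaussian_def)
  have pos: "real n + 1 > 0" for n by simp
  have Kint: "integrable lborel (K n)" for n
  proof -
    have "integrable lborel (\<lambda>s. complex_of_real (K n s))"
      unfolding K by (intro integrable_mult_right gaussian_scaled_transform(1)) simp
    then show ?thesis by (simp only: complex_of_real_integrable_eq)
  qed
  \<comment> \<open>Fubini, and the transform of a wide Gaussian is a narrow one\<close>
  have means: "(LINT \<xi>|lborel. fourier u \<xi> * cis (2 * pi * \<xi> * t) * gaussian (\<xi> / (real n + 1)))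
      = (LINT s|lborel. u (t - s) * K n s)" for n
  proof -
    define a where "a = 1 / (real n + 1)"
    have a: "a > 0" by (simp add: a_def)
    have int: "integrable (lborel \<Otimes>\<^sub>M lborel) (\<lambda>(\<xi>, s). gaussian (a * \<xi>) * u s * cis (2 * pi * \<xi> * (t - s)))"
    proof -
      have "integrable (lborel \<Otimes>\<^sub>M lborel) (\<lambda>z. gaussian (a * fst z) * u (snd z))"
        by (rule lborel_pair.integrable_product_mult[OF gaussian_scaled_transform(1)[OF a] u])
      then show ?thesis unfolding case_prod_beta by (rule integrable_cis_mult) measurable
    qed
    have "(LINT \<xi>|lborel. fourier u \<xi> * cis (2 * pi * \<xi> * t) * gaussian (a * \<xi>))
       = (LINT \<xi>|lborel. LINT s|lborel. gaussian (a * \<xi>) * u s * cis (2 * pi * \<xi> * (t - s)))"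
    proof (rule Bochner_Integration.integral_cong)
      fix \<xi> :: real
      have "fourier u \<xi> * cis (2 * pi * \<xi> * t) * gaussian (a * \<xi>)
         = (LINT s|lborel. (u s * cis (- 2 * pi * \<xi> * s)) * (cis (2 * pi * \<xi> * t) * gaussian (a * \<xi>)))"
        unfolding fourier_def integral_mult_left_zero by (simp only: mult.assoc)
      also have "\<dots> = (LINT s|lborel. gaussian (a * \<xi>) * u s * cis (2 * pi * \<xi> * (t - s)))"
        by (intro Bochner_Integration.integral_cong) (auto simp: cis_mult mult_ac right_diff_distrib)
      finally show "fourier u \<xi> * cis (2 * pi * \<xi> * t) * gaussian (a * \<xi>) = \<dots>" .
    qed simp
    also have "\<dots> = (LINT s|lborel. LINT \<xi>|lborel. gaussian (a * \<xi>) * u s * cis (2 * pi * \<xi> * (t - s)))"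
      using lborel_pair.Fubini_integral[of "\<lambda>\<xi> s. gaussian (a * \<xi>) * u s * cis (2 * pi * \<xi> * (t - s))"] int by simp
    also have "\<dots> = (LINT s|lborel. u s * K n (t - s))"
    proof (rule Bochner_Integration.integral_cong)
      fix s :: real
      have "(LINT \<xi>|lborel. gaussian (a * \<xi>) * u s * cis (2 * pi * \<xi> * (t - s)))
         = (LINT \<xi>|lborel. u s * (gaussian (a * \<xi>) * cis (2 * pi * (t - s) * \<xi>)))"
        by (intro Bochner_Integration.integral_cong) (auto simp: mult_ac)
      also have "\<dots> = u s * (LINT \<xi>|lborel. gaussian (a * \<xi>) * cis (2 * pi * (t - s) * \<xi>))"
        by simp
      also have "\<dots> = u s * K n (t - s)"
        unfolding gaussian_scaled_transform(2)[OF a] K by (simp add: a_def mult.commute)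
      finally show "(LINT \<xi>|lborel. gaussian (a * \<xi>) * u s * cis (2 * pi * \<xi> * (t - s))) = u s * K n (t - s)" .
    qed simp
    also have "\<dots> = (LINT s|lborel. u (t - s) * K n s)"
      by (subst lborel_integral_real_affine[where c="-1" and t=t]) auto
    finally show ?thesis by (simp add: a_def)
  qed
  have "(\<lambda>n. LINT s|lborel. u (t - s) * K n s) \<longlonglongrightarrow> u (t - 0)"
  proof (rule approximate_identity)
    show i: "integrable lborel (\<lambda>s. u (t - s))"
      using lborel_integrable_real_affine[OF u, of "-1" t] by simp
    show "isCont (\<lambda>s. u (t - s)) 0" by (rule isCont_o2[of 0 "\<lambda>s. t - s" u]) (use cont in simp_all)
    show "integrable lborel (K n)" for n by (rule Kint)
    show "0 \<le> K n s" for n s by (simp add: K_def)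
    show "integrable lborel (\<lambda>s. u (t - s) * complex_of_real (K n s))" for n
    proof (rule Bochner_Integration.integrable_bound[OF integrable_mult_left[OF i, of "complex_of_real (real n + 1)"]])
      have "(real n + 1) * exp (- pi * ((real n + 1) * s)\<^sup>2) \<le> (real n + 1) * 1" for s
        by (intro mult_left_mono) auto
      then have "norm (complex_of_real (K n s)) \<le> norm (complex_of_real (real n + 1))" for s
        unfolding norm_of_real by (auto simp: K_def)
      then show "AE s in lborel. norm (u (t - s) * complex_of_real (K n s)) \<le> norm (u (t - s) * complex_of_real (real n + 1))"
        by (auto simp: norm_mult simp del: norm_of_real of_real_add intro!: mult_left_mono)
      show "(\<lambda>s. u (t - s) * complex_of_real (K n s)) \<in> borel_measurable lborel"
        unfolding K_def by measurable
    qed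
    fix \<delta> :: real assume \<delta>: "\<delta> > 0"
    show "(\<lambda>n. LINT s|lborel. K n s * indicator {- \<delta><..<\<delta>} s) \<longlonglongrightarrow> 1"
    proof -
      have "(LINT s|lborel. K n s * indicator {- \<delta><..<\<delta>} s)
          = (LINT s|lborel. exp (- pi * s\<^sup>2) * indicator {- \<delta><..<\<delta>} (s / (real n + 1)))" for n
        by (subst lborel_integral_real_affine[where c="1 / (real n + 1)" and t=0])
           (auto simp: K_def mult_ac)
      moreover have "(\<lambda>n. LINT s|lborel. exp (- pi * s\<^sup>2) * indicator {- \<delta><..<\<delta>} (s / (real n + 1))) \<longlonglongrightarrow> (LINT s|lborel. exp (- pi * s\<^sup>2))"
      proof (rule integral_dominated_convergence)
        show "integrable lborel (\<lambda>s. exp (- pi * s\<^sup>2))" using Kint[of 0] by (simp add: K_def[abs_def])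
        show "AE s in lborel. (\<lambda>n. exp (- pi * s\<^sup>2) * indicator {- \<delta><..<\<delta>} (s / (real n + 1))) \<longlonglongrightarrow> exp (- pi * s\<^sup>2)"
        proof (intro AE_I2 tendsto_eventually)
          fix s :: real
          have "(\<lambda>n. s / (real n + 1)) \<longlonglongrightarrow> 0" by real_asymp
          then have "eventually (\<lambda>n. s / (real n + 1) < \<delta>) sequentially" "eventually (\<lambda>n. - \<delta> < s / (real n + 1)) sequentially"
            using \<delta> by (auto intro: order_tendstoD)
          then show "eventually (\<lambda>n. exp (- pi * s\<^sup>2) * indicator {- \<delta><..<\<delta>} (s / (real n + 1)) = exp (- pi * s\<^sup>2)) sequentially"
            by eventually_elim auto
        qed
      qed (auto simp: indicator_def)
      ultimately show ?thesis unfolding integral_gaussian by simp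
    qed
    show "\<exists>c. c \<longlonglongrightarrow> 0 \<and> (\<forall>n s. \<delta> \<le> \<bar>s\<bar> \<longrightarrow> K n s \<le> c n)"
    proof (intro exI conjI allI impI)
      show "(\<lambda>n. K n \<delta>) \<longlonglongrightarrow> 0" unfolding K_def using \<delta> by real_asymp
      show "K n s \<le> K n \<delta>" if "\<delta> \<le> \<bar>s\<bar>" for n s
      proof -
        have "\<delta>\<^sup>2 \<le> s\<^sup>2" using power_mono[OF that, of 2] \<delta> by simp
        then show ?thesis by (auto simp: K_def power_mult_distrib intro!: mult_left_mono)
      qed
    qed
  qed
  moreover have "(\<lambda>n. LINT \<xi>|lborel. fourier u \<xi> * cis (2 * pi * \<xi> * t) * gaussian (\<xi> / (real n + 1)))
     \<longlonglongrightarrow> (LINT \<xi>|lborel. fourier u \<xi> * cis (2 * pi * \<xi> * t))"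
  proof (rule integral_dominated_convergence)
    show "integrable lborel (\<lambda>\<xi>. norm (fourier u \<xi>))" using Fu by simp
    show "AE \<xi> in lborel. (\<lambda>n. fourier u \<xi> * cis (2 * pi * \<xi> * t) * gaussian (\<xi> / (real n + 1))) \<longlonglongrightarrow> fourier u \<xi> * cis (2 * pi * \<xi> * t)"
    proof (intro AE_I2)
      fix \<xi> :: real
      have "(\<lambda>n. \<xi> / (real n + 1)) \<longlonglongrightarrow> 0" by real_asymp
      then have "(\<lambda>n. exp (- pi * (\<xi> / (real n + 1))\<^sup>2)) \<longlonglongrightarrow> exp (- pi * 0\<^sup>2)"
        by (intro tendsto_intros)
      then have "(\<lambda>n. exp (- pi * (\<xi> / (real n + 1))\<^sup>2)) \<longlonglongrightarrow> 1" by simp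
      then have "(\<lambda>n. fourier u \<xi> * cis (2 * pi * \<xi> * t) * complex_of_real (exp (- pi * (\<xi> / (real n + 1))\<^sup>2))) \<longlonglongrightarrow> fourier u \<xi> * cis (2 * pi * \<xi> * t) * complex_of_real 1"
        by (intro tendsto_intros)
      then show "(\<lambda>n. fourier u \<xi> * cis (2 * pi * \<xi> * t) * gaussian (\<xi> / (real n + 1))) \<longlonglongrightarrow> fourier u \<xi> * cis (2 * pi * \<xi> * t)"
        by (simp add: gaussian_def)
    qed
  qed (auto simp: norm_mult norm_gaussian intro!: mult_left_le)
  ultimately show ?thesis unfolding means by (simp add: LIMSEQ_unique)
qed

lemma nn_integral_gaussian: "(\<integral>\<^sup>+t. ennreal (norm (gaussian t)) \<partial>lborel) = 1"
proof -
  have i: "integrable lborel (\<lambda>t. norm (gaussian t))" using gaussian_scaled_transform(1)[of 1] by simp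
  have "(LINT t|lborel. norm (gaussian t)) = 1" unfolding norm_gaussian by (rule integral_gaussian)
  then show ?thesis using nn_integral_eq_integral[OF i] by simp
qed

section \<open>The Fourier algebra norm\<close>

text \<open>
  The norm of the Fourier algebra (the functions whose transform is integrable). For an
  integrable function outside the algebra it is \<open>\<infinity>\<close>, so that estimates need no case distinction.
\<close>
definition fourier_norm :: "(real \<Rightarrow> complex) \<Rightarrow> ennreal" where
  "fourier_norm u = (\<integral>\<^sup>+\<xi>. norm (fourier u \<xi>) \<partial>lborel)"

lemma integrable_fourier:
  assumes "u \<in> borel_measurable borel" "fourier_norm u < \<infinity>"
  shows "integrable lborel (fourier u)"
  using assms by (auto simp: integrable_iff_bounded fourier_norm_def)

lemma nn_integral_translate:
  fixes F :: "real \<Rightarrow> ennreal"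
  assumes [measurable]: "F \<in> borel_measurable borel"
  shows "(\<integral>\<^sup>+t. F (t - a) \<partial>lborel) = (\<integral>\<^sup>+t. F t \<partial>lborel)"
  using nn_integral_real_affine[of F 1 "-a"] by simp

lemma nn_integral_reflect:
  fixes F :: "real \<Rightarrow> ennreal"
  assumes [measurable]: "F \<in> borel_measurable borel"
  shows "(\<integral>\<^sup>+t. F (a - t) \<partial>lborel) = (\<integral>\<^sup>+t. F t \<partial>lborel)"
  using nn_integral_real_affine[of F "-1" "a"] by simp

text \<open>
  The transform of a product is the convolution of the transforms: insert the inversion formula
  for one factor and exchange the integrals. Inversion is needed for \<open>p\<close> only, so the bound holds
  even if the transform of \<open>v\<close> is not integrable.
\<close>
lemma fourier_mult_bound:
  assumes p: "integrable lborel p" "\<And>t. isCont p t" "fourier_norm p < \<infinity>"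
    and v: "integrable lborel v"
  shows "ennreal (norm (fourier (\<lambda>t. p t * v t) \<xi>))
    \<le> (\<integral>\<^sup>+\<eta>. ennreal (norm (fourier p \<eta>)) * ennreal (norm (fourier v (\<xi> - \<eta>))) \<partial>lborel)"
proof -
  have [measurable]: "p \<in> borel_measurable borel" "v \<in> borel_measurable borel" using p v by auto
  have Fp: "integrable lborel (fourier p)" by (rule integrable_fourier) (use p in auto)
  have int: "integrable (lborel \<Otimes>\<^sub>M lborel) (\<lambda>(\<eta>, t). fourier p \<eta> * v t * cis (2 * pi * (\<eta> - \<xi>) * t))"
    using lborel_pair.integrable_product_mult[OF Fp v] unfolding case_prod_beta by (rule integrable_cis_mult) measurable
  have "fourier (\<lambda>t. p t * v t) \<xi> = (LINT t|lborel. (LINT \<eta>|lborel. fourier p \<eta> * v t * cis (2 * pi * (\<eta> - \<xi>) * t)))"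
    unfolding fourier_def[of "\<lambda>t. p t * v t"]
  proof (rule Bochner_Integration.integral_cong)
    fix t :: real
    have "p t * v t * cis (- 2 * pi * \<xi> * t) = (LINT \<eta>|lborel. fourier p \<eta> * cis (2 * pi * \<eta> * t)) * (v t * cis (- 2 * pi * \<xi> * t))"
      using fourier_inversion[OF p(1) p(2)[of t] Fp] by (simp add: mult.assoc)
    also have "\<dots> = (LINT \<eta>|lborel. (fourier p \<eta> * cis (2 * pi * \<eta> * t)) * (v t * cis (- 2 * pi * \<xi> * t)))"
      by (rule integral_mult_left_zero[symmetric])
    also have "\<dots> = (LINT \<eta>|lborel. fourier p \<eta> * v t * cis (2 * pi * (\<eta> - \<xi>) * t))"
    proof (rule Bochner_Integration.integral_cong)
      fix \<eta> :: real
      have "cis (2 * pi * (\<eta> - \<xi>) * t) = cis (2 * pi * \<eta> * t) * cis (- 2 * pi * \<xi> * t)"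
        by (simp add: cis_mult algebra_simps)
      then show "(fourier p \<eta> * cis (2 * pi * \<eta> * t)) * (v t * cis (- 2 * pi * \<xi> * t)) = fourier p \<eta> * v t * cis (2 * pi * (\<eta> - \<xi>) * t)"
        by (simp only: mult_ac)
    qed simp
    finally show "p t * v t * cis (- 2 * pi * \<xi> * t) = \<dots>" .
  qed simp
  also have "\<dots> = (LINT \<eta>|lborel. LINT t|lborel. fourier p \<eta> * v t * cis (2 * pi * (\<eta> - \<xi>) * t))"
    using lborel_pair.Fubini_integral[of "\<lambda>\<eta> t. fourier p \<eta> * v t * cis (2 * pi * (\<eta> - \<xi>) * t)"] int by simp
  also have "\<dots> = (LINT \<eta>|lborel. fourier p \<eta> * fourier v (\<xi> - \<eta>))"
  proof (rule Bochner_Integration.integral_cong)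
    fix \<eta> :: real
    have "2 * pi * (\<eta> - \<xi>) * t = - 2 * pi * (\<xi> - \<eta>) * t" for t by (simp add: algebra_simps)
    then show "(LINT t|lborel. fourier p \<eta> * v t * cis (2 * pi * (\<eta> - \<xi>) * t)) = fourier p \<eta> * fourier v (\<xi> - \<eta>)"
      unfolding fourier_def[of v] by (simp only: mult.assoc integral_mult_right_zero)
  qed simp
  finally have eq: "fourier (\<lambda>t. p t * v t) \<xi> = (LINT \<eta>|lborel. fourier p \<eta> * fourier v (\<xi> - \<eta>))" .
  have "integrable lborel (\<lambda>\<eta>. LINT t|lborel. fourier p \<eta> * v t * cis (2 * pi * (\<eta> - \<xi>) * t))"
    using lborel_pair.integrable_fst[of "\<lambda>\<eta> t. fourier p \<eta> * v t * cis (2 * pi * (\<eta> - \<xi>) * t)"] int by simp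
  also have "(\<lambda>\<eta>. LINT t|lborel. fourier p \<eta> * v t * cis (2 * pi * (\<eta> - \<xi>) * t)) = (\<lambda>\<eta>. fourier p \<eta> * fourier v (\<xi> - \<eta>))"
  proof
    fix \<eta> :: real
    have "2 * pi * (\<eta> - \<xi>) * t = - 2 * pi * (\<xi> - \<eta>) * t" for t by (simp add: algebra_simps)
    then show "(LINT t|lborel. fourier p \<eta> * v t * cis (2 * pi * (\<eta> - \<xi>) * t)) = fourier p \<eta> * fourier v (\<xi> - \<eta>)"
      unfolding fourier_def[of v] by (simp only: mult.assoc integral_mult_right_zero)
  qed
  finally have "ennreal (norm (fourier (\<lambda>t. p t * v t) \<xi>)) \<le> (\<integral>\<^sup>+\<eta>. norm (fourier p \<eta> * fourier v (\<xi> - \<eta>)) \<partial>lborel)"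
    unfolding eq by (rule integral_norm_bound_ennreal)
  then show ?thesis by (simp add: norm_mult ennreal_mult)
qed

text \<open>
  Integrate the convolution bound; the inner integral does not see the translation.
\<close>
lemma fourier_norm_mult:
  assumes p: "integrable lborel p" "\<And>t. isCont p t" "fourier_norm p < \<infinity>"
    and v: "integrable lborel v"
  shows "fourier_norm (\<lambda>t. p t * v t) \<le> fourier_norm p * fourier_norm v"
proof -
  have [measurable]: "p \<in> borel_measurable borel" "v \<in> borel_measurable borel" using p v by auto
  have "fourier_norm (\<lambda>t. p t * v t) \<le> (\<integral>\<^sup>+\<xi>. \<integral>\<^sup>+\<eta>. ennreal (norm (fourier p \<eta>)) * ennreal (norm (fourier v (\<xi> - \<eta>))) \<partial>lborel \<partial>lborel)"
    unfolding fourier_norm_def[of "\<lambda>t. p t * v t"] by (intro nn_integral_mono fourier_mult_bound p v)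
  also have "\<dots> = (\<integral>\<^sup>+\<eta>. \<integral>\<^sup>+\<xi>. ennreal (norm (fourier p \<eta>)) * ennreal (norm (fourier v (\<xi> - \<eta>))) \<partial>lborel \<partial>lborel)"
    by (rule lborel_pair.Fubini') measurable
  also have "\<dots> = (\<integral>\<^sup>+\<eta>. ennreal (norm (fourier p \<eta>)) * fourier_norm v \<partial>lborel)"
    unfolding fourier_norm_def[of v]
    by (subst nn_integral_cmult) (simp_all add: nn_integral_translate[where F="\<lambda>x. ennreal (norm (fourier v x))"])
  also have "\<dots> = fourier_norm p * fourier_norm v"
    by (simp add: nn_integral_multc fourier_norm_def[of p])
  finally show ?thesis .
qed

lemma norm_fourier_gaussian_shift:
  "norm (fourier (\<lambda>t. gaussian (t - x)) \<xi>) = norm (gaussian \<xi>)"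
proof -
  have "fourier (\<lambda>t. gaussian (t - x)) \<xi> = (LINT t|lborel. gaussian t * cis (- 2 * pi * \<xi> * (t + x)))"
    unfolding fourier_def by (subst lborel_integral_real_affine[where c=1 and t=x]) (auto simp: add.commute)
  also have "\<dots> = (LINT t|lborel. cis (- 2 * pi * \<xi> * x) * (gaussian (1 * t) * cis (2 * pi * (- \<xi>) * t)))"
  proof (rule Bochner_Integration.integral_cong)
    fix t :: real
    have "cis (- 2 * pi * \<xi> * (t + x)) = cis (- 2 * pi * \<xi> * x) * cis (2 * pi * (- \<xi>) * t)"
      by (simp add: cis_mult algebra_simps)
    then show "gaussian t * cis (- 2 * pi * \<xi> * (t + x)) = cis (- 2 * pi * \<xi> * x) * (gaussian (1 * t) * cis (2 * pi * (- \<xi>) * t))"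
      by (simp only: mult_ac mult_1)
  qed simp
  also have "\<dots> = cis (- 2 * pi * \<xi> * x) * gaussian \<xi>"
    unfolding integral_mult_right_zero by (subst gaussian_scaled_transform(2)) (auto simp: gaussian_def)
  finally show ?thesis by (simp add: norm_mult)
qed

lemma fourier_norm_gaussian_shift: "fourier_norm (\<lambda>t. gaussian (t - x)) = 1"
  by (simp add: fourier_norm_def norm_fourier_gaussian_shift nn_integral_gaussian)

lemma integrable_gaussian_shift: "integrable lborel (\<lambda>t. gaussian (t - x))"
  using lborel_integrable_real_affine[OF gaussian_scaled_transform(1)[of 1], of 1 "-x"] by simp

lemma isCont_gaussian: "isCont (\<lambda>t. gaussian (t - x)) t"
  unfolding gaussian_def by (intro continuous_intros)

lemma norm_gaussian_le_1: "norm (gaussian t) \<le> 1"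
  by (simp add: norm_gaussian)

section \<open>The Feichtinger algebra through windowed Fourier norms\<close>

lemma integrable_mult_square_integrable:
  assumes "f \<in> square_integrable M" "h \<in> square_integrable M"
  shows "integrable M (\<lambda>t. f t * h t)"
proof (rule Bochner_Integration.integrable_bound)
  show "integrable M (\<lambda>t. (norm (f t))\<^sup>2 + (norm (h t))\<^sup>2)"
    using assms by (auto simp: square_integrable_def)
  have "norm (f t * h t) \<le> norm ((norm (f t))\<^sup>2 + (norm (h t))\<^sup>2)" for t
  proof -
    have "2 * (norm (f t) * norm (h t)) \<le> (norm (f t))\<^sup>2 + (norm (h t))\<^sup>2"
      using sum_squares_bound[of "norm (f t)" "norm (h t)"] by simp
    moreover have "0 \<le> norm (f t) * norm (h t)" by simp
    ultimately have "norm (f t) * norm (h t) \<le> (norm (f t))\<^sup>2 + (norm (h t))\<^sup>2" by linarith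
    then show ?thesis by (simp add: norm_mult)
  qed
  then show "AE t in M. norm (f t * h t) \<le> norm ((norm (f t))\<^sup>2 + (norm (h t))\<^sup>2)" by simp
qed (use assms in \<open>auto simp: square_integrable_def\<close>)

lemma square_integrable_add:
  assumes "f \<in> square_integrable M" "h \<in> square_integrable M"
  shows "(\<lambda>t. f t + h t) \<in> square_integrable M"
proof -
  have [measurable]: "f \<in> borel_measurable M" "h \<in> borel_measurable M"
    using assms by (auto simp: square_integrable_def)
  have "integrable M (\<lambda>t. (norm (f t + h t))\<^sup>2)"
  proof (rule Bochner_Integration.integrable_bound)
    show "integrable M (\<lambda>t. 2 * ((norm (f t))\<^sup>2 + (norm (h t))\<^sup>2))"
      using assms by (auto simp: square_integrable_def)
    have "norm ((norm (f t + h t))\<^sup>2) \<le> norm (2 * ((norm (f t))\<^sup>2 + (norm (h t))\<^sup>2))" for t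
    proof -
      have "(norm (f t + h t))\<^sup>2 \<le> (norm (f t) + norm (h t))\<^sup>2"
        by (intro power_mono norm_triangle_ineq) auto
      also have "\<dots> \<le> 2 * ((norm (f t))\<^sup>2 + (norm (h t))\<^sup>2)"
        using sum_squares_bound[of "norm (f t)" "norm (h t)"] by (simp add: power2_sum)
      finally show ?thesis by simp
    qed
    then show "AE t in M. norm ((norm (f t + h t))\<^sup>2) \<le> norm (2 * ((norm (f t))\<^sup>2 + (norm (h t))\<^sup>2))" by simp
  qed measurable
  then show ?thesis by (simp add: square_integrable_def)
qed

lemma square_integrable_cmult:
  assumes "f \<in> square_integrable M"
  shows "(\<lambda>t. c * f t) \<in> square_integrable M"
  using assms by (auto simp: square_integrable_def norm_mult power_mult_distrib)

lemma square_integrable_gaussian_shift: "(\<lambda>t. gaussian (t - x)) \<in> square_integrable lborel"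
proof -
  have "integrable lborel (\<lambda>t. (norm (gaussian (t - x)))\<^sup>2)"
  proof (rule Bochner_Integration.integrable_bound[OF integrable_gaussian_shift])
    show "AE t in lborel. norm ((norm (gaussian (t - x)))\<^sup>2) \<le> norm (gaussian (t - x))"
      using norm_gaussian_le_1 by (auto simp: power2_eq_square intro!: mult_left_le)
  qed measurable
  then show ?thesis by (simp add: square_integrable_def)
qed

text \<open>
  The \<open>L\<^sup>1\<close> norm in frequency of the Gaussian STFT at time \<open>x\<close>. The Feichtinger norm is its integral
  over \<open>x\<close>, and all further properties of \<open>S0\<close> are read off from this density.
\<close>
definition local_fourier_norm :: "(real \<Rightarrow> complex) \<Rightarrow> real \<Rightarrow> ennreal" where
  "local_fourier_norm f x = fourier_norm (\<lambda>t. f t * gaussian (t - x))"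

lemma local_fourier_norm_measurable [measurable]:
  assumes [measurable]: "f \<in> borel_measurable borel"
  shows "local_fourier_norm f \<in> borel_measurable borel"
  unfolding local_fourier_norm_def[abs_def] fourier_norm_def fourier_def by measurable

lemma stft_gaussian:
  "stft gaussian f (x, \<xi>) = fourier (\<lambda>t. f t * gaussian (t - x)) \<xi>"
proof -
  have "cnj (gaussian t) = gaussian t" for t by (simp add: gaussian_def)
  then show ?thesis
    by (simp add: stft_def inner_L2_def tf_shift_def modulation_def translation_def fourier_def cis_cnj mult_ac)
qed

lemma stft_gaussian_measurable [measurable]:
  assumes [measurable]: "f \<in> borel_measurable borel"
  shows "stft gaussian f \<in> borel_measurable borel"
proof -
  have "(\<lambda>z. stft gaussian f (fst z, snd z)) \<in> borel_measurable (borel \<Otimes>\<^sub>M borel)"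
    unfolding stft_gaussian fourier_def by measurable
  then show ?thesis by (simp add: borel_prod)
qed

lemma nn_integral_stft_gaussian:
  assumes [measurable]: "f \<in> borel_measurable borel"
  shows "(\<integral>\<^sup>+z. norm (stft gaussian f z) \<partial>lborel) = (\<integral>\<^sup>+x. local_fourier_norm f x \<partial>lborel)"
proof -
  have "(\<integral>\<^sup>+z. norm (stft gaussian f z) \<partial>lborel) = (\<integral>\<^sup>+z. norm (stft gaussian f z) \<partial>(lborel \<Otimes>\<^sub>M lborel))"
    by (simp add: lborel_prod)
  also have "\<dots> = (\<integral>\<^sup>+x. \<integral>\<^sup>+\<xi>. norm (stft gaussian f (x, \<xi>)) \<partial>lborel \<partial>lborel)"
  proof (rule lborel.nn_integral_fst[symmetric])
    have "(\<lambda>z. ennreal (norm (stft gaussian f z))) \<in> borel_measurable borel" by measurable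
    then show "(\<lambda>z. ennreal (norm (stft gaussian f z))) \<in> borel_measurable (lborel \<Otimes>\<^sub>M lborel)"
      by (simp add: lborel_prod)
  qed
  finally show ?thesis by (simp add: stft_gaussian local_fourier_norm_def fourier_norm_def)
qed

lemma S0_iff:
  "f \<in> S0 \<longleftrightarrow> f \<in> square_integrable lborel \<and> continuous_on UNIV f \<and> (\<integral>\<^sup>+x. local_fourier_norm f x \<partial>lborel) < \<infinity>"
proof (cases "f \<in> square_integrable lborel")
  case True
  then have [measurable]: "f \<in> borel_measurable borel" by (simp add: square_integrable_def)
  show ?thesis by (simp add: S0_def integrable_iff_bounded nn_integral_stft_gaussian)
qed (simp add: S0_def)

lemma S0D:
  assumes "f \<in> S0"
  shows "f \<in> square_integrable lborel" "continuous_on UNIV f" "(\<integral>\<^sup>+x. local_fourier_norm f x \<partial>lborel) < \<infinity>"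
    "f \<in> borel_measurable borel" "isCont f t"
  using assms by (auto simp: S0_iff square_integrable_def continuous_on_eq_continuous_at)

lemma nn_integral_local_fourier_norm:
  assumes "f \<in> S0"
  shows "(\<integral>\<^sup>+x. local_fourier_norm f x \<partial>lborel) = ennreal (S0_norm f)"
proof -
  have "integrable lborel (stft gaussian f)" using assms by (simp add: S0_def)
  then show ?thesis
    unfolding nn_integral_stft_gaussian[OF S0D(4)[OF assms], symmetric] S0_norm_def
    by (intro nn_integral_eq_integral) auto
qed

lemma S0_norm_nonneg: "0 \<le> S0_norm f"
  by (simp add: S0_norm_def)

lemma S0_windowed:
  assumes "f \<in> S0"
  shows "integrable lborel (\<lambda>t. f t * gaussian (t - x))" "isCont (\<lambda>t. f t * gaussian (t - x)) t"
  using assms S0D[OF assms]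
  by (auto intro!: integrable_mult_square_integrable square_integrable_gaussian_shift isCont_gaussian continuous_intros)

text \<open>
  Fourier inversion for the windowed function bounds its values by the \<open>L\<^sup>1\<close> norm of its transform.
\<close>
lemma S0_pointwise_bound:
  assumes f: "f \<in> S0"
  shows "ennreal (norm (f t) * norm (gaussian (t - x))) \<le> local_fourier_norm f x"
proof (cases "local_fourier_norm f x = \<infinity>")
  case False
  define u where "u = (\<lambda>t. f t * gaussian (t - x))"
  have u: "integrable lborel u" "isCont u t" unfolding u_def using S0_windowed[OF f] by auto
  have fin: "fourier_norm u < \<infinity>" using False by (simp add: u_def local_fourier_norm_def less_top)
  have Fu: "integrable lborel (fourier u)" by (rule integrable_fourier) (use u fin in auto)
  have "ennreal (norm (u t)) = ennreal (norm (LINT \<xi>|lborel. fourier u \<xi> * cis (2 * pi * \<xi> * t)))"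
    using fourier_inversion[OF u Fu] by simp
  also have "\<dots> \<le> (\<integral>\<^sup>+\<xi>. norm (fourier u \<xi> * cis (2 * pi * \<xi> * t)) \<partial>lborel)"
    by (intro integral_norm_bound_ennreal integrable_cis_mult Fu) measurable
  also have "\<dots> = fourier_norm u" by (simp add: norm_mult fourier_norm_def)
  finally show ?thesis by (simp add: u_def norm_mult local_fourier_norm_def)
qed simp

text \<open>
  Averaging the pointwise bound over the unit cell of window positions near a point, where the
  Gaussian is bounded below by \<open>exp (- 4 * pi)\<close>, shows that local suprema of a function in \<open>S0\<close>
  are summable over the integers, with total at most a constant times the Feichtinger norm.
\<close>
lemma S0_local_bound:
  assumes f: "f \<in> S0"
  obtains M :: "int \<Rightarrow> real" where "\<And>m. 0 \<le> M m" "M summable_on UNIV" "infsum M UNIV \<le> exp (4 * pi) * S0_norm f"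
    "\<And>m t. \<bar>t - y\<bar> \<le> 1 \<Longrightarrow> norm (f (t + of_int m)) \<le> M m"
proof -
  have [measurable]: "f \<in> borel_measurable borel" using S0D(4)[OF f] .
  define I where "I m = (\<integral>\<^sup>+s. local_fourier_norm f (s + of_int m) * indicator {y..<y+1} s \<partial>lborel)" for m :: int
  have sumI: "(\<integral>\<^sup>+m. I m \<partial>count_space UNIV) = ennreal (S0_norm f)"
    unfolding I_def nn_integral_local_fourier_norm[OF f, symmetric] by (rule nn_integral_tiling[symmetric]) measurable
  have Ifin: "I m < \<infinity>" for m
  proof -
    have "I m \<le> (\<integral>\<^sup>+m. I m \<partial>count_space UNIV)" by (rule nn_integral_ge_point) simp
    then show ?thesis unfolding sumI by (auto intro: le_less_trans)
  qed
  define M where "M m = exp (4 * pi) * enn2real (I m)" for m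
  have M0: "0 \<le> M m" for m by (simp add: M_def)
  have eM: "ennreal (M m) = ennreal (exp (4 * pi)) * I m" for m
    using Ifin[of m] by (simp add: M_def ennreal_mult less_top)
  have nM: "(\<integral>\<^sup>+m. ennreal (M m) \<partial>count_space UNIV) = ennreal (exp (4 * pi) * S0_norm f)"
    unfolding eM by (simp add: nn_integral_cmult sumI ennreal_mult S0_norm_nonneg)
  have sM: "M summable_on UNIV"
    using summable_norm_iff_nn_integral[of M UNIV] M0 nM by simp
  have "ennreal (infsum M UNIV) = (\<integral>\<^sup>+m. ennreal (M m) \<partial>count_space UNIV)"
  proof -
    have abs: "(\<lambda>m. norm (M m)) summable_on UNIV" using sM M0 by simp
    show ?thesis
      using nn_integral_conv_infsetsum[OF abs_summable_equivalent[THEN iffD1, OF abs] M0]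
        infsetsum_infsum[OF abs_summable_equivalent[THEN iffD1, OF abs]] by simp
  qed
  then have iM: "infsum M UNIV \<le> exp (4 * pi) * S0_norm f"
    unfolding nM using S0_norm_nonneg[of f] by (simp add: infsum_nonneg M0)
  have "norm (f (t + of_int m)) \<le> M m" if t: "\<bar>t - y\<bar> \<le> 1" for m t
  proof -
    have "ennreal (norm (f (t + of_int m))) = (\<integral>\<^sup>+s. ennreal (norm (f (t + of_int m))) * indicator {y..<y+1} s \<partial>lborel)"
      by (simp add: nn_integral_cmult)
    also have "\<dots> \<le> (\<integral>\<^sup>+s. ennreal (exp (4 * pi)) * (local_fourier_norm f (s + of_int m) * indicator {y..<y+1} s) \<partial>lborel)"
    proof (rule nn_integral_mono)
      fix s :: real
      show "ennreal (norm (f (t + of_int m))) * indicator {y..<y+1} s \<le> ennreal (exp (4 * pi)) * (local_fourier_norm f (s + of_int m) * indicator {y..<y+1} s)"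
      proof (cases "s \<in> {y..<y+1}")
        case True
        \<comment> \<open>t is within distance 1 of y, and s lies in the unit cell that starts at y\<close>
        then have "\<bar>t - s\<bar> \<le> 2" using t by auto
        then have "(t - s)\<^sup>2 \<le> 2\<^sup>2" by (metis abs_le_square_iff abs_numeral)
        then have "1 \<le> exp (4 * pi) * norm (gaussian ((t + of_int m) - (s + of_int m)))"
          by (simp add: norm_gaussian exp_add[symmetric])
        then have "norm (f (t + of_int m)) * 1 \<le> norm (f (t + of_int m)) * (exp (4 * pi) * norm (gaussian ((t + of_int m) - (s + of_int m))))"
          by (intro mult_left_mono) auto
        then have "ennreal (norm (f (t + of_int m))) \<le> ennreal (exp (4 * pi)) * ennreal (norm (f (t + of_int m)) * norm (gaussian ((t + of_int m) - (s + of_int m))))"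
          by (simp add: ennreal_mult[symmetric] mult_ac)
        also have "\<dots> \<le> ennreal (exp (4 * pi)) * local_fourier_norm f (s + of_int m)"
          by (intro mult_left_mono S0_pointwise_bound f) auto
        finally show ?thesis using True by simp
      qed simp
    qed
    also have "\<dots> = ennreal (M m)" unfolding eM I_def by (rule nn_integral_cmult) measurable
    finally show ?thesis using M0 by simp
  qed
  with M0 sM iM that show thesis by blast
qed

text \<open>
  This makes the local Fourier norms, and with them \<open>S0\<close>, covariant under time-frequency shifts.
\<close>
lemma norm_fourier_tf_shift:
  "norm (fourier (\<lambda>t. cis (2 * pi * \<xi> * t) * u (t - x)) \<eta>) = norm (fourier u (\<eta> - \<xi>))"
proof -
  have "fourier (\<lambda>t. cis (2 * pi * \<xi> * t) * u (t - x)) \<eta>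
      = (LINT t|lborel. cis (2 * pi * \<xi> * (x + t)) * u t * cis (- 2 * pi * \<eta> * (x + t)))"
    unfolding fourier_def by (subst lborel_integral_real_affine[where c=1 and t=x]) auto
  also have "\<dots> = (LINT t|lborel. cis (- 2 * pi * (\<eta> - \<xi>) * x) * (u t * cis (- 2 * pi * (\<eta> - \<xi>) * t)))"
  proof (rule Bochner_Integration.integral_cong)
    fix t :: real
    have "cis (2 * pi * \<xi> * (x + t)) * cis (- 2 * pi * \<eta> * (x + t)) = cis (- 2 * pi * (\<eta> - \<xi>) * x) * cis (- 2 * pi * (\<eta> - \<xi>) * t)"
      by (simp add: cis_mult algebra_simps)
    then have "u t * (cis (2 * pi * \<xi> * (x + t)) * cis (- 2 * pi * \<eta> * (x + t))) = u t * (cis (- 2 * pi * (\<eta> - \<xi>) * x) * cis (- 2 * pi * (\<eta> - \<xi>) * t))"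
      by (rule arg_cong)
    then show "cis (2 * pi * \<xi> * (x + t)) * u t * cis (- 2 * pi * \<eta> * (x + t)) = cis (- 2 * pi * (\<eta> - \<xi>) * x) * (u t * cis (- 2 * pi * (\<eta> - \<xi>) * t))"
      by (simp only: mult_ac)
  qed simp
  also have "\<dots> = cis (- 2 * pi * (\<eta> - \<xi>) * x) * fourier u (\<eta> - \<xi>)"
    unfolding fourier_def by (rule integral_mult_right_zero)
  finally show ?thesis by (simp add: norm_mult)
qed

lemma fourier_norm_tf_shift:
  assumes [measurable]: "u \<in> borel_measurable borel"
  shows "fourier_norm (\<lambda>t. cis (2 * pi * \<xi> * t) * u (t - x)) = fourier_norm u"
  unfolding fourier_norm_def norm_fourier_tf_shift
  by (rule nn_integral_translate[where F="\<lambda>\<eta>. ennreal (norm (fourier u \<eta>))"]) measurable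

lemma tf_shift_eq: "tf_shift x \<xi> f = (\<lambda>t. cis (2 * pi * \<xi> * t) * f (t - x))"
  by (simp add: tf_shift_def modulation_def translation_def)

lemma S0_tf_shift:
  assumes f: "f \<in> S0"
  shows "tf_shift x \<xi> f \<in> S0"
proof -
  have [measurable]: "f \<in> borel_measurable borel" using S0D(4)[OF f] .
  have "local_fourier_norm (tf_shift x \<xi> f) y = local_fourier_norm f (y - x)" for y
  proof -
    have "(\<lambda>t. tf_shift x \<xi> f t * gaussian (t - y)) = (\<lambda>t. cis (2 * pi * \<xi> * t) * (\<lambda>t. f t * gaussian (t - (y - x))) (t - x))"
      by (simp add: tf_shift_eq mult.assoc)
    then show ?thesis
      unfolding local_fourier_norm_def by (simp only:) (rule fourier_norm_tf_shift, measurable)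
  qed
  then have "(\<integral>\<^sup>+y. local_fourier_norm (tf_shift x \<xi> f) y \<partial>lborel) < \<infinity>"
    using S0D(3)[OF f] nn_integral_translate[of "local_fourier_norm f" x] by simp
  moreover have "continuous_on UNIV (tf_shift x \<xi> f)"
    unfolding tf_shift_eq using S0D(2)[OF f]
    by (intro continuous_intros continuous_on_compose2[OF S0D(2)[OF f]]) auto
  moreover have "tf_shift x \<xi> f \<in> square_integrable lborel"
  proof -
    have "integrable lborel (\<lambda>t. (norm (f (- x + 1 * t)))\<^sup>2)"
      using S0D(1)[OF f] by (intro lborel_integrable_real_affine) (auto simp: square_integrable_def)
    then show ?thesis by (auto simp: square_integrable_def tf_shift_eq norm_mult)
  qed
  ultimately show ?thesis by (simp add: S0_iff)
qed

lemma fourier_add: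
  assumes "integrable lborel u" "integrable lborel v"
  shows "fourier (\<lambda>t. u t + v t) \<xi> = fourier u \<xi> + fourier v \<xi>"
  unfolding fourier_def distrib_right
  by (intro Bochner_Integration.integral_add integrable_cis_mult assms) measurable

lemma S0_add:
  assumes f: "f \<in> S0" and h: "h \<in> S0"
  shows "(\<lambda>t. f t + h t) \<in> S0"
proof -
  have [measurable]: "f \<in> borel_measurable borel" "h \<in> borel_measurable borel" using S0D(4) f h by auto
  have "local_fourier_norm (\<lambda>t. f t + h t) x \<le> local_fourier_norm f x + local_fourier_norm h x" for x
  proof -
    have "local_fourier_norm (\<lambda>t. f t + h t) x = (\<integral>\<^sup>+\<xi>. norm (fourier (\<lambda>t. f t * gaussian (t - x)) \<xi> + fourier (\<lambda>t. h t * gaussian (t - x)) \<xi>) \<partial>lborel)"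
      unfolding local_fourier_norm_def fourier_norm_def distrib_right
      by (simp add: fourier_add S0_windowed f h)
    also have "\<dots> \<le> (\<integral>\<^sup>+\<xi>. ennreal (norm (fourier (\<lambda>t. f t * gaussian (t - x)) \<xi>)) + ennreal (norm (fourier (\<lambda>t. h t * gaussian (t - x)) \<xi>)) \<partial>lborel)"
      by (intro nn_integral_mono) (simp add: norm_triangle_ineq flip: ennreal_plus)
    also have "\<dots> = local_fourier_norm f x + local_fourier_norm h x"
      unfolding local_fourier_norm_def fourier_norm_def by (rule nn_integral_add) measurable
    finally show ?thesis .
  qed
  then have "(\<integral>\<^sup>+x. local_fourier_norm (\<lambda>t. f t + h t) x \<partial>lborel) \<le> (\<integral>\<^sup>+x. local_fourier_norm f x + local_fourier_norm h x \<partial>lborel)"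
    by (intro nn_integral_mono)
  also have "\<dots> = (\<integral>\<^sup>+x. local_fourier_norm f x \<partial>lborel) + (\<integral>\<^sup>+x. local_fourier_norm h x \<partial>lborel)"
    by (rule nn_integral_add) measurable
  also have "\<dots> < \<infinity>" using S0D(3) f h by auto
  finally show ?thesis
    using S0D f h by (auto simp: S0_iff intro!: square_integrable_add continuous_intros)
qed

lemma S0_cmult:
  assumes f: "f \<in> S0"
  shows "(\<lambda>t. c * f t) \<in> S0"
proof -
  have [measurable]: "f \<in> borel_measurable borel" using S0D(4) f by auto
  have "fourier (\<lambda>t. c * f t * gaussian (t - x)) \<xi> = c * fourier (\<lambda>t. f t * gaussian (t - x)) \<xi>" for x \<xi>
    unfolding fourier_def mult.assoc by (rule integral_mult_right_zero)
  then have "local_fourier_norm (\<lambda>t. c * f t) x = ennreal (norm c) * local_fourier_norm f x" for x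
    unfolding local_fourier_norm_def fourier_norm_def
    by (simp add: norm_mult ennreal_mult nn_integral_cmult)
  then have "(\<integral>\<^sup>+x. local_fourier_norm (\<lambda>t. c * f t) x \<partial>lborel) = ennreal (norm c) * (\<integral>\<^sup>+x. local_fourier_norm f x \<partial>lborel)"
    by (simp add: nn_integral_cmult)
  also have "\<dots> < \<infinity>" using S0D(3)[OF f] by (simp add: ennreal_mult_less_top)
  finally show ?thesis
    using S0D f by (auto simp: S0_iff intro!: square_integrable_cmult continuous_intros)
qed

lemma S0_cnj:
  assumes f: "f \<in> S0"
  shows "(\<lambda>t. cnj (f t)) \<in> S0"
proof -
  have [measurable]: "f \<in> borel_measurable borel" using S0D(4) f by auto
  have "norm (fourier (\<lambda>t. cnj (f t) * gaussian (t - x)) \<xi>) = norm (fourier (\<lambda>t. f t * gaussian (t - x)) (0 - \<xi>))" for x \<xi>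
  proof -
    have "cnj (gaussian t) = gaussian t" for t by (simp add: gaussian_def)
    then have "cnj (fourier (\<lambda>t. f t * gaussian (t - x)) (0 - \<xi>)) = fourier (\<lambda>t. cnj (f t) * gaussian (t - x)) \<xi>"
      unfolding fourier_def by (subst Bochner_Integration.integral_cnj[symmetric]) (simp add: cis_cnj del: Bochner_Integration.integral_cnj)
    then show ?thesis by (metis complex_mod_cnj)
  qed
  then have "local_fourier_norm (\<lambda>t. cnj (f t)) x = local_fourier_norm f x" for x
    unfolding local_fourier_norm_def fourier_norm_def
    by (simp only:) (rule nn_integral_reflect[where F="\<lambda>\<xi>. ennreal (norm (fourier (\<lambda>t. f t * gaussian (t - x)) \<xi>))"], measurable)
  moreover have "(\<lambda>t. cnj (f t)) \<in> borel_measurable borel"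
    by (intro borel_measurable_continuous_onI continuous_intros S0D(2) f)
  ultimately show ?thesis
    using S0D[OF f] by (auto simp: S0_iff square_integrable_def intro!: continuous_intros)
qed

section \<open>Summability of correlations over integer lattices\<close>

text \<open>
  The constant is the integral of a wider Gaussian, which dominates the given one on each unit
  cell.
\<close>
lemma gaussian_sum_bound:
  obtains C :: ennreal where "C < \<infinity>" "\<And>s. (\<integral>\<^sup>+k. ennreal (norm (gaussian (of_int k - s))) \<partial>counting) \<le> C"
proof
  let ?A = "\<lambda>x. ennreal (exp pi * norm (gaussian (x / sqrt 2)))"
  show "(\<integral>\<^sup>+x. ?A x \<partial>lborel) < \<infinity>"
    using gaussian_scaled_transform(1)[of "1 / sqrt 2"]
    by (simp add: integrable_iff_bounded ennreal_mult nn_integral_cmult ennreal_mult_less_top)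
  fix s :: real
  have le: "norm (gaussian (of_int k - s)) \<le> exp pi * norm (gaussian ((x + of_int k) / sqrt 2))" if "x \<in> {-s..<-s+1}" for k x
  proof -
    define a where "a = of_int k - s"
    define b where "b = x + of_int k"
    have "\<bar>b - a\<bar> \<le> 1" using that by (auto simp: a_def b_def)
    then have "(b - a)\<^sup>2 \<le> 1" by (simp add: abs_square_le_1)
    \<comment> \<open>b^2 <= 2 a^2 + 2 (b - a)^2, written as a square\<close>
    moreover have "0 \<le> (2 * a - b)\<^sup>2" by simp
    ultimately have "b\<^sup>2 / 2 \<le> a\<^sup>2 + 1" by (simp add: power2_eq_square algebra_simps)
    then have "pi * (b\<^sup>2 / 2) \<le> pi * (a\<^sup>2 + 1)" by (intro mult_left_mono) auto
    then have "exp (- pi * a\<^sup>2) \<le> exp (pi + - pi * (b\<^sup>2 / 2))" by (simp add: algebra_simps)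
    then show ?thesis unfolding a_def[symmetric] b_def[symmetric]
      by (simp add: norm_gaussian power_divide exp_add[symmetric])
  qed
  have "(\<integral>\<^sup>+k. ennreal (norm (gaussian (of_int k - s))) \<partial>counting)
     \<le> (\<integral>\<^sup>+k. \<integral>\<^sup>+x. ?A (x + of_int k) * indicator {-s..<-s+1} x \<partial>lborel \<partial>counting)"
  proof (rule nn_integral_mono)
    fix k :: int
    have "ennreal (norm (gaussian (of_int k - s))) = (\<integral>\<^sup>+x. ennreal (norm (gaussian (of_int k - s))) * indicator {-s..<-s+1} x \<partial>lborel)"
      by (simp add: nn_integral_cmult)
    also have "\<dots> \<le> (\<integral>\<^sup>+x. ?A (x + of_int k) * indicator {-s..<-s+1} x \<partial>lborel)"
      by (intro nn_integral_mono) (auto simp: indicator_def intro!: ennreal_leI le)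
    finally show "ennreal (norm (gaussian (of_int k - s))) \<le> (\<integral>\<^sup>+x. ?A (x + of_int k) * indicator {-s..<-s+1} x \<partial>lborel)" .
  qed
  also have "\<dots> = (\<integral>\<^sup>+x. ?A x \<partial>lborel)" by (rule nn_integral_tiling[symmetric]) measurable
  finally show "(\<integral>\<^sup>+k. ennreal (norm (gaussian (of_int k - s))) \<partial>counting) \<le> (\<integral>\<^sup>+x. ?A x \<partial>lborel)" .
qed

text \<open>
  The local Fourier norm is only integrable in the window position. Passing to the squared
  window replaces it by an average over a unit cell, whose sum over integer translates is bounded
  everywhere. The reason is that the squared Gaussian at \<open>x\<close> is a multiple of the product of the
  Gaussians at \<open>x - d\<close> and \<open>x + d\<close>, for every \<open>d\<close>: one factor is the window at \<open>x + d\<close>, and the other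
  one has Fourier norm 1.
\<close>
lemma narrow_window_bound:
  assumes f: "f \<in> S0"
  shows "fourier_norm (\<lambda>t. f t * (gaussian (t - x))\<^sup>2)
     \<le> ennreal (exp (2 * pi)) * (\<integral>\<^sup>+s. local_fourier_norm f (x + s) * indicator {0..<1} s \<partial>lborel)"
proof -
  have [measurable]: "f \<in> borel_measurable borel" using S0D(4) f by auto
  have le: "fourier_norm (\<lambda>t. f t * (gaussian (t - x))\<^sup>2) \<le> ennreal (exp (2 * pi * d\<^sup>2)) * local_fourier_norm f (x + d)" for d
  proof -
    have "(gaussian (t - x))\<^sup>2 = complex_of_real (exp (2 * pi * d\<^sup>2)) * (gaussian (t - (x - d)) * gaussian (t - (x + d)))" for t
    proof -
      have "- 2 * pi * (t - x)\<^sup>2 = 2 * pi * d\<^sup>2 + (- pi * (t - (x - d))\<^sup>2 + - pi * (t - (x + d))\<^sup>2)"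
        by (simp add: power2_eq_square algebra_simps)
      then have "exp (- 2 * pi * (t - x)\<^sup>2) = exp (2 * pi * d\<^sup>2) * (exp (- pi * (t - (x - d))\<^sup>2) * exp (- pi * (t - (x + d))\<^sup>2))"
        by (simp only: exp_add)
      moreover have "(gaussian (t - x))\<^sup>2 = complex_of_real (exp (- 2 * pi * (t - x)\<^sup>2))"
        by (simp add: gaussian_def power2_eq_square flip: exp_add of_real_mult)
      ultimately show ?thesis by (simp add: gaussian_def)
    qed
    then have eq: "(\<lambda>t. f t * (gaussian (t - x))\<^sup>2) = (\<lambda>t. (complex_of_real (exp (2 * pi * d\<^sup>2))) * (gaussian (t - (x - d)) * (f t * gaussian (t - (x + d)))))"
      by (simp add: mult_ac)
    have "fourier (\<lambda>t. f t * (gaussian (t - x))\<^sup>2) \<xi> = (complex_of_real (exp (2 * pi * d\<^sup>2))) * fourier (\<lambda>t. gaussian (t - (x - d)) * (f t * gaussian (t - (x + d)))) \<xi>" for \<xi>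
      unfolding eq fourier_def mult.assoc by (rule integral_mult_right_zero)
    then have "fourier_norm (\<lambda>t. f t * (gaussian (t - x))\<^sup>2) = ennreal (exp (2 * pi * d\<^sup>2)) * fourier_norm (\<lambda>t. gaussian (t - (x - d)) * (f t * gaussian (t - (x + d))))"
      unfolding fourier_norm_def by (simp add: norm_mult ennreal_mult nn_integral_cmult)
    also have "fourier_norm (\<lambda>t. gaussian (t - (x - d)) * (f t * gaussian (t - (x + d)))) \<le> fourier_norm (\<lambda>t. gaussian (t - (x - d))) * fourier_norm (\<lambda>t. f t * gaussian (t - (x + d)))"
      by (intro fourier_norm_mult integrable_gaussian_shift isCont_gaussian S0_windowed f) (simp add: fourier_norm_gaussian_shift)
    also have "\<dots> = local_fourier_norm f (x + d)" by (simp add: fourier_norm_gaussian_shift local_fourier_norm_def)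
    finally show ?thesis by (simp add: mult_left_mono)
  qed
  have "fourier_norm (\<lambda>t. f t * (gaussian (t - x))\<^sup>2) = (\<integral>\<^sup>+s. fourier_norm (\<lambda>t. f t * (gaussian (t - x))\<^sup>2) * indicator {0..<1::real} s \<partial>lborel)"
    by (simp add: nn_integral_cmult)
  also have "\<dots> \<le> (\<integral>\<^sup>+s. ennreal (exp (2 * pi)) * (local_fourier_norm f (x + s) * indicator {0..<1} s) \<partial>lborel)"
  proof (rule nn_integral_mono)
    fix s :: real
    show "fourier_norm (\<lambda>t. f t * (gaussian (t - x))\<^sup>2) * indicator {0..<1} s \<le> ennreal (exp (2 * pi)) * (local_fourier_norm f (x + s) * indicator {0..<1} s)"
    proof (cases "s \<in> {0..<1}")
      case True
      then have "s\<^sup>2 \<le> 1" by (simp add: abs_square_le_1)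
      then have "ennreal (exp (2 * pi * s\<^sup>2)) \<le> ennreal (exp (2 * pi))" by (intro ennreal_leI) simp
      from order_trans[OF le mult_right_mono[OF this]] show ?thesis using True by simp
    qed simp
  qed
  also have "\<dots> = ennreal (exp (2 * pi)) * (\<integral>\<^sup>+s. local_fourier_norm f (x + s) * indicator {0..<1} s \<partial>lborel)"
    by (rule nn_integral_cmult) measurable
  finally show ?thesis .
qed

lemma square_integrable_translate:
  fixes f :: "real \<Rightarrow> complex"
  assumes "f \<in> square_integrable lborel"
  shows "(\<lambda>t. f (t - x)) \<in> square_integrable lborel"
proof -
  have [measurable]: "f \<in> borel_measurable borel" using assms by (simp add: square_integrable_def)
  have "integrable lborel (\<lambda>t. (norm (f (- x + 1 * t)))\<^sup>2)"
    using assms by (intro lborel_integrable_real_affine) (auto simp: square_integrable_def)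
  then show ?thesis by (auto simp: square_integrable_def)
qed

text \<open>
  A continuous partition of unity: the translates of \<open>gaussian ^ 4\<close> integrate to \<open>1 / 2\<close>.
\<close>
lemma fourier_gaussian_average:
  assumes u: "integrable lborel u"
  shows "ennreal (norm (fourier u \<xi>)) \<le> 2 * (\<integral>\<^sup>+x. norm (fourier (\<lambda>t. u t * (gaussian (t - x)) ^ 4) \<xi>) \<partial>lborel)"
proof -
  have [measurable]: "u \<in> borel_measurable borel" using u by auto
  have g4: "(gaussian s) ^ 4 = gaussian (2 * s)" for s
  proof -
    have "real 4 * (- pi * s\<^sup>2) = - pi * (2 * s)\<^sup>2" by (simp add: power2_eq_square)
    then have "exp (- pi * s\<^sup>2) ^ 4 = exp (- pi * (2 * s)\<^sup>2)" by (simp only: exp_of_nat_mult[symmetric])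
    then show ?thesis by (simp add: gaussian_def flip: of_real_power)
  qed
  have gint: "integrable lborel (\<lambda>x. gaussian (2 * (t - x)))" for t
    using lborel_integrable_real_affine[OF gaussian_scaled_transform(1)[of 2], of "-1" t] by simp
  have gval: "(LINT x|lborel. gaussian (2 * (t - x))) = 1/2" for t
  proof -
    have "(LINT x|lborel. gaussian (2 * (t - x))) = (LINT x|lborel. gaussian (2 * x) * cis (2 * pi * 0 * x))"
      by (subst lborel_integral_real_affine[where c="-1" and t=t]) auto
    also have "\<dots> = 1/2" by (subst gaussian_scaled_transform(2)) (auto simp: gaussian_def)
    finally show ?thesis .
  qed
  have gn: "(LINT x|lborel. norm (gaussian (2 * (t - x)))) = 1/2" for t
  proof -
    have "complex_of_real (LINT x|lborel. norm (gaussian (2 * (t - x)))) = (LINT x|lborel. gaussian (2 * (t - x)))"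
      by (subst integral_complex_of_real[symmetric]) (simp add: gaussian_def)
    then have "complex_of_real (LINT x|lborel. norm (gaussian (2 * (t - x)))) = complex_of_real (1/2)" unfolding gval by simp
    then show ?thesis by (simp only: of_real_eq_iff)
  qed
  have int: "integrable (lborel \<Otimes>\<^sub>M lborel) (\<lambda>(t, x). u t * gaussian (2 * (t - x)) * cis (- 2 * pi * \<xi> * t))"
  proof -
    have "integrable (lborel \<Otimes>\<^sub>M lborel) (\<lambda>z. u (fst z) * gaussian (2 * (fst z - snd z)))"
    proof (rule lborel_pair.Fubini_integrable)
      show "integrable lborel (\<lambda>t. LINT x|lborel. norm (u (fst (t, x)) * gaussian (2 * (fst (t, x) - snd (t, x)))))"
        unfolding fst_conv snd_conv norm_mult integral_mult_right_zero gn using u by simp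
      show "AE t in lborel. integrable lborel (\<lambda>x. u (fst (t, x)) * gaussian (2 * (fst (t, x) - snd (t, x))))"
        using gint by simp
    qed measurable
    then show ?thesis unfolding case_prod_beta by (rule integrable_cis_mult) measurable
  qed
  have F: "fourier (\<lambda>t. u t * (gaussian (t - x)) ^ 4) \<xi> = (LINT t|lborel. u t * gaussian (2 * (t - x)) * cis (- 2 * pi * \<xi> * t))" for x
    by (simp add: fourier_def g4)
  have "fourier u \<xi> = (LINT t|lborel. 2 * (LINT x|lborel. u t * gaussian (2 * (t - x)) * cis (- 2 * pi * \<xi> * t)))"
    unfolding fourier_def
  proof (rule Bochner_Integration.integral_cong)
    fix t :: real
    have inner: "(LINT x|lborel. u t * gaussian (2 * (t - x)) * cis (- 2 * pi * \<xi> * t)) = u t * (LINT x|lborel. gaussian (2 * (t - x))) * cis (- 2 * pi * \<xi> * t)"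
      by (simp only: integral_mult_left_zero integral_mult_right_zero)
    show "u t * cis (- 2 * pi * \<xi> * t) = 2 * (LINT x|lborel. u t * gaussian (2 * (t - x)) * cis (- 2 * pi * \<xi> * t))"
      unfolding inner gval by simp
  qed simp
  also have "\<dots> = 2 * (LINT t|lborel. LINT x|lborel. u t * gaussian (2 * (t - x)) * cis (- 2 * pi * \<xi> * t))"
    by (rule integral_mult_right_zero)
  also have "\<dots> = 2 * (LINT x|lborel. fourier (\<lambda>t. u t * (gaussian (t - x)) ^ 4) \<xi>)"
    unfolding F
    using lborel_pair.Fubini_integral[of "\<lambda>t x. u t * gaussian (2 * (t - x)) * cis (- 2 * pi * \<xi> * t)"] int by simp
  finally have eq: "norm (fourier u \<xi>) = 2 * norm (LINT x|lborel. fourier (\<lambda>t. u t * (gaussian (t - x)) ^ 4) \<xi>)"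
    by (simp add: norm_mult)
  have "integrable lborel (\<lambda>x. fourier (\<lambda>t. u t * (gaussian (t - x)) ^ 4) \<xi>)"
    unfolding F using lborel_pair.integrable_snd[of "\<lambda>t x. u t * gaussian (2 * (t - x)) * cis (- 2 * pi * \<xi> * t)"] int by simp
  then have "ennreal (norm (LINT x|lborel. fourier (\<lambda>t. u t * (gaussian (t - x)) ^ 4) \<xi>)) \<le> (\<integral>\<^sup>+x. norm (fourier (\<lambda>t. u t * (gaussian (t - x)) ^ 4) \<xi>) \<partial>lborel)"
    by (rule integral_norm_bound_ennreal)
  then show ?thesis unfolding eq by (simp add: ennreal_mult mult_left_mono)
qed

text \<open>
  The heart of the analysis: the correlations of \<open>f\<close> and \<open>h\<close>, that is the values of an STFT of two
  functions in \<open>S0\<close>, are absolutely summable over the integer lattice.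
  
  The fourth power of the Gaussian is split between the factors: two powers localize \<open>f\<close>, so that
  its Fourier norm becomes summable over all translates, one localizes \<open>h\<close>, and the last one,
  after convolution, turns the integer samples in frequency into an integral, because integer
  translates of a Gaussian have bounded sums. What remains is the integral of the local Fourier
  norm of \<open>h\<close> times a periodization belonging to \<open>f\<close>, which is a finite constant.
\<close>
lemma S0_product_transform_summable:
  assumes f: "f \<in> S0" and h: "h \<in> S0"
  shows "(\<integral>\<^sup>+k. \<integral>\<^sup>+l. norm (fourier (\<lambda>t. f (t - of_int k) * h t) (of_int l)) \<partial>counting \<partial>counting) < \<infinity>"
proof -
  have [measurable]: "f \<in> borel_measurable borel" "h \<in> borel_measurable borel" using S0D(4) f h by auto
  obtain C :: ennreal where C: "C < \<infinity>" "\<And>s. (\<integral>\<^sup>+k. ennreal (norm (gaussian (of_int k - s))) \<partial>counting) \<le> C"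
    using gaussian_sum_bound by blast
  define B where "B x = (\<integral>\<^sup>+s. local_fourier_norm f (x + s) * indicator {0..<1} s \<partial>lborel)" for x
  have [measurable]: "B \<in> borel_measurable borel" unfolding B_def[abs_def] by measurable
  define If where "If = (\<integral>\<^sup>+x. local_fourier_norm f x \<partial>lborel)"
  define Ih where "Ih = (\<integral>\<^sup>+x. local_fourier_norm h x \<partial>lborel)"
  define E where "E = ennreal (exp (2 * pi))"
  have fin: "If < \<infinity>" "Ih < \<infinity>" using S0D(3) f h by (auto simp: If_def Ih_def)
  have Bsum: "(\<integral>\<^sup>+k. B (x - of_int k) \<partial>counting) = If" for x
  proof -
    have "(\<integral>\<^sup>+k. B (x - of_int k) \<partial>counting) = (\<integral>\<^sup>+k. B (x - of_int (- k)) \<partial>counting)"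
      by (rule nn_integral_bij_count_space[symmetric]) (auto intro!: bij_betwI[where g=uminus])
    also have "\<dots> = (\<integral>\<^sup>+k. \<integral>\<^sup>+s. local_fourier_norm f (x + (s + of_int k)) * indicator {0..<0+1} s \<partial>lborel \<partial>counting)"
      by (simp add: B_def algebra_simps)
    also have "\<dots> = (\<integral>\<^sup>+s. local_fourier_norm f (x + s) \<partial>lborel)"
      by (rule nn_integral_tiling[symmetric]) measurable
    also have "\<dots> = If"
      unfolding If_def using nn_integral_real_affine[of "local_fourier_norm f" 1 x] by simp
    finally show ?thesis .
  qed
  have Bfin: "B x < \<infinity>" for x
  proof -
    have "B (x - of_int 0) \<le> (\<integral>\<^sup>+k. B (x - of_int k) \<partial>counting)"
      by (rule nn_integral_ge_point) simp
    then show ?thesis using fin(1) unfolding Bsum by (auto intro: le_less_trans)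
  qed
  \<comment> \<open>frequency samples of one localized product\<close>
  have loc: "(\<integral>\<^sup>+l. norm (fourier (\<lambda>t. (f (t - of_int k) * h t) * (gaussian (t - x)) ^ 4) (of_int l)) \<partial>counting)
      \<le> C * E * (B (x - of_int k) * local_fourier_norm h x)" for k :: int and x
  proof -
    define p where "p = (\<lambda>t. f (t - of_int k) * (gaussian (t - x))\<^sup>2)"
    define q where "q = (\<lambda>t. h t * gaussian (t - x))"
    define v where "v = (\<lambda>t. gaussian (t - x) * q t)"
    have q: "integrable lborel q" unfolding q_def by (rule S0_windowed[OF h])
    have [measurable]: "q \<in> borel_measurable borel" "p \<in> borel_measurable borel" unfolding q_def p_def by measurable
    have v: "integrable lborel v"
      unfolding v_def
      by (rule Bochner_Integration.integrable_bound[OF q]) (auto simp: norm_mult norm_gaussian_le_1 intro!: mult_left_le_one_le)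
    have pint: "integrable lborel p"
    proof -
      have "integrable lborel (\<lambda>t. f (t - of_int k) * gaussian (t - x))"
        by (intro integrable_mult_square_integrable square_integrable_translate S0D(1)[OF f] square_integrable_gaussian_shift)
      then show ?thesis unfolding p_def
        by (rule Bochner_Integration.integrable_bound)
          (auto simp: norm_mult norm_power power2_eq_square norm_gaussian_le_1 intro!: mult_left_mono mult_left_le_one_le)
    qed
    have pcont: "isCont p t" for t
      unfolding p_def by (intro continuous_intros isCont_gaussian isCont_o2[of t "\<lambda>t. t - of_int k" f] S0D(5)[OF f])
    have pnorm: "fourier_norm p \<le> E * B (x - of_int k)"
    proof -
      have "fourier_norm p = fourier_norm (\<lambda>t. f t * (gaussian (t - (x - of_int k)))\<^sup>2)"
        using fourier_norm_tf_shift[of "\<lambda>t. f t * (gaussian (t - (x - of_int k)))\<^sup>2" 0 "of_int k"] by (simp add: p_def)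
      also have "\<dots> \<le> E * B (x - of_int k)" unfolding E_def B_def by (rule narrow_window_bound[OF f])
      finally show ?thesis .
    qed
    have pfin: "fourier_norm p < \<infinity>"
      using pnorm Bfin[of "x - of_int k"] by (auto simp: E_def ennreal_mult_less_top intro: le_less_trans)
    have vb: "(\<integral>\<^sup>+l. norm (fourier v (of_int l - s)) \<partial>counting) \<le> C * fourier_norm q" for s
    proof -
      have "(\<integral>\<^sup>+l. norm (fourier v (of_int l - s)) \<partial>counting)
        \<le> (\<integral>\<^sup>+l. \<integral>\<^sup>+\<zeta>. ennreal (norm (gaussian (of_int l - (s + \<zeta>)))) * ennreal (norm (fourier q \<zeta>)) \<partial>lborel \<partial>counting)"
      proof (rule nn_integral_mono)
        fix l :: int
        have "ennreal (norm (fourier v (of_int l - s))) \<le> (\<integral>\<^sup>+\<eta>. ennreal (norm (gaussian \<eta>)) * ennreal (norm (fourier q (of_int l - s - \<eta>))) \<partial>lborel)"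
          using fourier_mult_bound[OF integrable_gaussian_shift isCont_gaussian _ q, of x "of_int l - s"]
          by (simp add: fourier_norm_gaussian_shift norm_fourier_gaussian_shift v_def)
        also have "\<dots> = (\<integral>\<^sup>+\<zeta>. ennreal (norm (gaussian (of_int l - s - \<zeta>))) * ennreal (norm (fourier q \<zeta>)) \<partial>lborel)"
          by (subst nn_integral_reflect[where a="of_int l - s", symmetric]) auto
        finally show "ennreal (norm (fourier v (of_int l - s))) \<le> (\<integral>\<^sup>+\<zeta>. ennreal (norm (gaussian (of_int l - (s + \<zeta>)))) * ennreal (norm (fourier q \<zeta>)) \<partial>lborel)"
          by (simp add: algebra_simps)
      qed
      also have "\<dots> = (\<integral>\<^sup>+\<zeta>. \<integral>\<^sup>+l. ennreal (norm (gaussian (of_int l - (s + \<zeta>)))) * ennreal (norm (fourier q \<zeta>)) \<partial>counting \<partial>lborel)"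
        by (rule nn_integral_count_space_nn_integral[symmetric]) auto
      also have "\<dots> \<le> (\<integral>\<^sup>+\<zeta>. C * ennreal (norm (fourier q \<zeta>)) \<partial>lborel)"
        by (intro nn_integral_mono) (simp add: nn_integral_multc mult_right_mono C(2))
      also have "\<dots> = C * fourier_norm q" by (simp add: nn_integral_cmult fourier_norm_def)
      finally show ?thesis .
    qed
    have "(\<lambda>t. (f (t - of_int k) * h t) * (gaussian (t - x)) ^ 4) = (\<lambda>t. p t * v t)"
      by (auto simp: p_def v_def q_def power2_eq_square power4_eq_xxxx)
    then have "(\<integral>\<^sup>+l. norm (fourier (\<lambda>t. (f (t - of_int k) * h t) * (gaussian (t - x)) ^ 4) (of_int l)) \<partial>counting)
       \<le> (\<integral>\<^sup>+l. \<integral>\<^sup>+\<eta>. ennreal (norm (fourier p \<eta>)) * ennreal (norm (fourier v (of_int l - \<eta>))) \<partial>lborel \<partial>counting)"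
      by (simp only:) (intro nn_integral_mono fourier_mult_bound pint pcont pfin v)
    also have "\<dots> = (\<integral>\<^sup>+\<eta>. \<integral>\<^sup>+l. ennreal (norm (fourier p \<eta>)) * ennreal (norm (fourier v (of_int l - \<eta>))) \<partial>counting \<partial>lborel)"
      by (rule nn_integral_count_space_nn_integral[symmetric]) (auto simp: v_def)
    also have "\<dots> \<le> (\<integral>\<^sup>+\<eta>. ennreal (norm (fourier p \<eta>)) * (C * fourier_norm q) \<partial>lborel)"
      by (intro nn_integral_mono) (simp add: nn_integral_cmult mult_left_mono vb)
    also have "\<dots> = fourier_norm p * (C * fourier_norm q)" by (simp add: nn_integral_multc fourier_norm_def)
    also have "\<dots> \<le> (E * B (x - of_int k)) * (C * fourier_norm q)" by (intro mult_right_mono pnorm) simp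
    also have "\<dots> = C * E * (B (x - of_int k) * local_fourier_norm h x)"
      by (simp add: q_def local_fourier_norm_def mult_ac)
    finally show ?thesis .
  qed
  have "(\<integral>\<^sup>+k. \<integral>\<^sup>+l. norm (fourier (\<lambda>t. f (t - of_int k) * h t) (of_int l)) \<partial>counting \<partial>counting)
    \<le> (\<integral>\<^sup>+k. \<integral>\<^sup>+l. 2 * (\<integral>\<^sup>+x. norm (fourier (\<lambda>t. (f (t - of_int k) * h t) * (gaussian (t - x)) ^ 4) (of_int l)) \<partial>lborel) \<partial>counting \<partial>counting)"
    by (intro nn_integral_mono fourier_gaussian_average integrable_mult_square_integrable square_integrable_translate S0D(1) f h)
  also have "\<dots> = (\<integral>\<^sup>+k. 2 * (\<integral>\<^sup>+x. \<integral>\<^sup>+l. norm (fourier (\<lambda>t. (f (t - of_int k) * h t) * (gaussian (t - x)) ^ 4) (of_int l)) \<partial>counting \<partial>lborel) \<partial>counting)"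
  proof (rule nn_integral_cong)
    fix k :: int
    have "(\<integral>\<^sup>+x. \<integral>\<^sup>+l. norm (fourier (\<lambda>t. (f (t - of_int k) * h t) * (gaussian (t - x)) ^ 4) (of_int l)) \<partial>counting \<partial>lborel)
      = (\<integral>\<^sup>+l. \<integral>\<^sup>+x. norm (fourier (\<lambda>t. (f (t - of_int k) * h t) * (gaussian (t - x)) ^ 4) (of_int l)) \<partial>lborel \<partial>counting)"
      by (rule nn_integral_count_space_nn_integral) (auto simp: fourier_def)
    then show "(\<integral>\<^sup>+l. 2 * (\<integral>\<^sup>+x. norm (fourier (\<lambda>t. (f (t - of_int k) * h t) * (gaussian (t - x)) ^ 4) (of_int l)) \<partial>lborel) \<partial>counting)
      = 2 * (\<integral>\<^sup>+x. \<integral>\<^sup>+l. norm (fourier (\<lambda>t. (f (t - of_int k) * h t) * (gaussian (t - x)) ^ 4) (of_int l)) \<partial>counting \<partial>lborel)"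
      by (simp add: nn_integral_cmult)
  qed
  also have "\<dots> \<le> (\<integral>\<^sup>+k. 2 * (\<integral>\<^sup>+x. C * E * (B (x - of_int k) * local_fourier_norm h x) \<partial>lborel) \<partial>counting)"
    by (intro nn_integral_mono mult_left_mono loc) auto
  also have "\<dots> = 2 * (C * E * (\<integral>\<^sup>+k. \<integral>\<^sup>+x. B (x - of_int k) * local_fourier_norm h x \<partial>lborel \<partial>counting))"
    by (simp add: nn_integral_cmult)
  also have "(\<integral>\<^sup>+k. \<integral>\<^sup>+x. B (x - of_int k) * local_fourier_norm h x \<partial>lborel \<partial>counting)
     = (\<integral>\<^sup>+x. \<integral>\<^sup>+k. B (x - of_int k) * local_fourier_norm h x \<partial>counting \<partial>lborel)"
    by (rule nn_integral_count_space_nn_integral[symmetric]) auto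
  also have "\<dots> = If * Ih" by (simp add: nn_integral_multc nn_integral_cmult Bsum Ih_def)
  also have "2 * (C * E * (If * Ih)) < \<infinity>"
    using fin C(1) by (simp add: E_def ennreal_mult_less_top)
  finally show ?thesis .
qed

section \<open>Poisson summation\<close>

lemma integral_half_open_closed:
  fixes F :: "real \<Rightarrow> complex"
  assumes [measurable]: "F \<in> borel_measurable borel"
  shows "(LINT t|lborel. F t * indicator {a..<b} t) = (LINT t|lborel. F t * indicator {a..b} t)"
proof (rule integral_cong_AE)
  show "AE t in lborel. F t * indicator {a..<b} t = F t * indicator {a..b} t"
    using AE_lborel_singleton[of b] by eventually_elim (auto simp: indicator_def)
qed measurable

lemma integral_cis_period:
  assumes T: "T > 0"
  shows "(LINT t|lborel. cis (2 * pi * of_int k * t / T) * indicator {a..a+T} t) = (if k = 0 then of_real T else 0)"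
proof (cases "k = 0")
  case True
  have "(LINT t|lborel. indicator {a..a+T} t :: complex) = (LINT t|lborel. complex_of_real (indicator {a..a+T} t))"
    by (intro Bochner_Integration.integral_cong) (auto simp: indicator_def)
  also have "\<dots> = complex_of_real (LINT t|lborel. indicator {a..a+T} t)" by (rule integral_complex_of_real)
  finally show ?thesis using True T by simp
next
  case False
  define \<omega> where "\<omega> = 2 * pi * of_int k / T"
  have \<omega>: "\<omega> \<noteq> 0" using False T by (simp add: \<omega>_def)
  have e: "2 * pi * of_int k * t / T = \<omega> * t" for t by (simp add: \<omega>_def)
  have "(LINT t|lborel. indicator {a..a+T} t *\<^sub>R cis (\<omega> * t)) = cis (\<omega> * (a+T)) / (\<i> * \<omega>) - cis (\<omega> * a) / (\<i> * \<omega>)"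
  proof (rule integral_FTC_Icc)
    show "a \<le> a + T" using T by simp
    show "continuous_on {a..a+T} (\<lambda>t. cis (\<omega> * t))" by (intro continuous_intros)
    fix t
    have "((\<lambda>t. cis (\<omega> * t)) has_vector_derivative (\<omega> *\<^sub>R (\<i> * cis (\<omega> * t)))) (at t within {a..a+T})"
      using exp_scaleR_has_vector_derivative_right[of "\<i> * complex_of_real \<omega>" t "{a..a+T}"]
      by (simp add: cis_conv_exp scaleR_conv_of_real mult_ac)
    then have "((\<lambda>t. cis (\<omega> * t) / (\<i> * \<omega>)) has_vector_derivative (\<omega> *\<^sub>R (\<i> * cis (\<omega> * t)) / (\<i> * \<omega>))) (at t within {a..a+T})"
      by (rule has_vector_derivative_divide)
    then show "((\<lambda>t. cis (\<omega> * t) / (\<i> * \<omega>)) has_vector_derivative cis (\<omega> * t)) (at t within {a..a+T})"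
      using \<omega> by (simp add: scaleR_conv_of_real)
  qed
  moreover have "cis (\<omega> * (a + T)) = cis (\<omega> * a) * cis (2 * pi * of_int k)"
    using T by (simp add: \<omega>_def cis_mult field_simps)
  ultimately have "(LINT t|lborel. indicator {a..a+T} t *\<^sub>R cis (\<omega> * t)) = 0" by simp
  moreover have "(LINT t|lborel. indicator {a..a+T} t *\<^sub>R cis (\<omega> * t)) = (LINT t|lborel. cis (\<omega> * t) * indicator {a..a+T} t)"
    by (intro Bochner_Integration.integral_cong) (auto simp: indicator_def)
  ultimately show ?thesis using False unfolding e by simp
qed

text \<open>
  The Poisson kernel of the unit disc as a function on the circle. Abel summation of Fourier
  series is integration against it.
\<close>
definition poisson_kernel :: "real \<Rightarrow> real \<Rightarrow> real" where
  "poisson_kernel r t = (1 - r\<^sup>2) / (norm (1 - r * cis (2 * pi * t)))\<^sup>2"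

lemma poisson_kernel_measurable [measurable]: "poisson_kernel r \<in> borel_measurable borel"
  unfolding poisson_kernel_def[abs_def] by measurable

text \<open>
  Two geometric series, one for the nonnegative and one for the negative indices.
\<close>
lemma has_sum_poisson_kernel:
  assumes r: "0 \<le> r" "r < 1"
  shows "((\<lambda>k::int. of_real (r ^ nat \<bar>k\<bar>) * cis (2 * pi * of_int k * t)) has_sum of_real (poisson_kernel r t)) UNIV"
proof -
  define z where "z = r * cis (2 * pi * t)"
  have nz: "norm z < 1" using r by (simp add: z_def norm_mult)
  have zpow: "z ^ n = of_real (r ^ n) * cis (2 * pi * real n * t)" for n
    by (simp add: z_def power_mult_distrib Complex.DeMoivre mult_ac)
  have cpow: "cnj z ^ n = of_real (r ^ n) * cis (- (2 * pi * real n * t))" for n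
    by (simp add: z_def cis_cnj power_mult_distrib Complex.DeMoivre mult_ac)
  have geo: "((\<lambda>n. w ^ n) has_sum (1 / (1 - w))) UNIV" if "norm w < 1" for w :: complex
    by (rule norm_summable_imp_has_sum) (use that geometric_sums[of w] in \<open>auto simp: norm_power summable_geometric\<close>)
  have pos: "((\<lambda>k::int. of_real (r ^ nat \<bar>k\<bar>) * cis (2 * pi * of_int k * t)) has_sum (1 / (1 - z))) (range int)"
    by (subst has_sum_reindex) (use geo[OF nz] in \<open>auto simp: o_def zpow inj_on_def\<close>)
  have neg: "((\<lambda>k::int. of_real (r ^ nat \<bar>k\<bar>) * cis (2 * pi * of_int k * t)) has_sum (cnj z * (1 / (1 - cnj z)))) (range (\<lambda>n. - int (Suc n)))"
  proof (subst has_sum_reindex)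
    show "inj (\<lambda>n. - int (Suc n))" by (auto simp: inj_on_def)
    have "((\<lambda>n. cnj z * cnj z ^ n) has_sum (cnj z * (1 / (1 - cnj z)))) UNIV"
      by (rule has_sum_cmult_right[OF geo]) (use nz in simp)
    also have "(\<lambda>n. cnj z * cnj z ^ n) = (\<lambda>k::int. of_real (r ^ nat \<bar>k\<bar>) * cis (2 * pi * of_int k * t)) \<circ> (\<lambda>n. - int (Suc n))"
    proof
      fix n
      have "cnj z * cnj z ^ n = cnj z ^ Suc n" by simp
      also have "\<dots> = of_real (r ^ Suc n) * cis (- (2 * pi * real (Suc n) * t))" by (rule cpow)
      also have "\<dots> = ((\<lambda>k::int. of_real (r ^ nat \<bar>k\<bar>) * cis (2 * pi * of_int k * t)) \<circ> (\<lambda>n. - int (Suc n))) n"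
      proof -
        have a: "nat \<bar>- int (Suc n)\<bar> = Suc n" by simp
        have b: "2 * pi * of_int (- int (Suc n)) * t = - (2 * pi * real (Suc n) * t)"
          by (simp only: of_int_minus of_int_of_nat_eq mult_minus_left mult_minus_right)
        show ?thesis unfolding o_def a b ..
      qed
      finally show "cnj z * cnj z ^ n = \<dots>" .
    qed
    finally show "(((\<lambda>k::int. of_real (r ^ nat \<bar>k\<bar>) * cis (2 * pi * of_int k * t)) \<circ> (\<lambda>n. - int (Suc n))) has_sum (cnj z * (1 / (1 - cnj z)))) UNIV" .
  qed
  have "k \<in> range int \<union> range (\<lambda>n. - int (Suc n))" for k :: int
    by (cases k rule: int_cases) auto
  then have "range int \<union> range (\<lambda>n. - int (Suc n)) = UNIV" by blast
  moreover have "range int \<inter> range (\<lambda>n. - int (Suc n)) = {}" by auto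
  ultimately have "((\<lambda>k::int. of_real (r ^ nat \<bar>k\<bar>) * cis (2 * pi * of_int k * t)) has_sum (1 / (1 - z) + cnj z * (1 / (1 - cnj z)))) UNIV"
    using has_sum_Un_disjoint[OF pos neg] by simp
  also have "1 / (1 - z) + cnj z * (1 / (1 - cnj z)) = of_real (poisson_kernel r t)"
  proof -
    have "z \<noteq> 1" using nz by auto
    moreover from this have "cnj z \<noteq> 1" by (metis complex_cnj_cnj complex_cnj_one)
    ultimately have ne: "1 - z \<noteq> 0" "1 - cnj z \<noteq> 0" by simp_all
    have "of_real (poisson_kernel r t) = (1 - z * cnj z) / ((1 - z) * cnj (1 - z))"
      unfolding poisson_kernel_def z_def[symmetric] of_real_divide complex_norm_square
      by (simp add: z_def cis_cnj mult_ac cis_mult power2_eq_square)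
    also have "\<dots> = 1 / (1 - z) + cnj z * (1 / (1 - cnj z))"
      using ne by (simp add: divide_simps) (simp add: algebra_simps)
    finally show ?thesis by simp
  qed
  finally show ?thesis .
qed

lemma summable_power_abs_int:
  assumes r: "0 \<le> (r::real)" "r < 1"
  shows "(\<lambda>k::int. r ^ nat \<bar>k\<bar>) summable_on UNIV"
proof -
  have "(\<lambda>k::int. of_real (r ^ nat \<bar>k\<bar>) * cis (2 * pi * of_int k * 0)) summable_on UNIV"
    using has_sum_poisson_kernel[OF r] by (rule has_sum_imp_summable)
  then show ?thesis unfolding summable_on_iff_abs_summable_on_complex using r by (simp add: norm_mult norm_power)
qed

lemma poisson_kernel_nonneg:
  assumes "0 \<le> r" "r < 1" shows "0 \<le> poisson_kernel r t"
proof -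
  have "r\<^sup>2 \<le> 1" using assms by (simp add: power_le_one)
  then show ?thesis by (simp add: poisson_kernel_def)
qed

lemma poisson_kernel_periodic: "poisson_kernel r (t + of_int m) = poisson_kernel r t"
proof -
  have "cis (2 * pi * (t + of_int m)) = cis (2 * pi * t) * cis (2 * pi * of_int m)"
    by (simp add: cis_mult algebra_simps)
  then show ?thesis by (simp add: poisson_kernel_def)
qed

lemma norm_poisson_denominator:
  "(norm (1 - of_real r * cis (2 * pi * t)))\<^sup>2 = (1 - r)\<^sup>2 + 2 * r * (1 - cos (2 * pi * t))"
proof -
  have "(norm (1 - of_real r * cis (2 * pi * t)))\<^sup>2 = (1 - r * cos (2 * pi * t))\<^sup>2 + (r * sin (2 * pi * t))\<^sup>2"
    by (simp add: cmod_power2)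
  also have "\<dots> = (1 - r)\<^sup>2 + 2 * r * (1 - cos (2 * pi * t))"
    unfolding power_mult_distrib sin_squared_eq by (simp add: power2_eq_square algebra_simps)
  finally show ?thesis .
qed

lemma poisson_kernel_bound:
  assumes r: "0 \<le> r" "r < 1" shows "poisson_kernel r t \<le> (1 - r\<^sup>2) / (1 - r)\<^sup>2"
proof -
  have "(1 - r)\<^sup>2 \<le> (norm (1 - of_real r * cis (2 * pi * t)))\<^sup>2"
    unfolding norm_poisson_denominator using r by simp
  moreover have "r\<^sup>2 \<le> 1" using r by (simp add: power_le_one)
  moreover have "0 < (1 - r)\<^sup>2" using r by simp
  ultimately show ?thesis unfolding poisson_kernel_def
    by (intro divide_left_mono mult_pos_pos) (auto intro: less_le_trans)
qed

lemma poisson_kernel_far_bound: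
  assumes r: "1/2 \<le> r" "r < 1" and d: "0 < d" "d \<le> \<bar>t\<bar>" "\<bar>t\<bar> \<le> 1/2"
  shows "poisson_kernel r t \<le> (1 - r\<^sup>2) / (1 - cos (2 * pi * d))"
proof -
  have "cos (2 * pi * \<bar>t\<bar>) \<le> cos (2 * pi * d)"
    using d by (intro cos_monotone_0_pi_le) auto
  then have c: "cos (2 * pi * t) \<le> cos (2 * pi * d)" by (cases "t \<ge> 0") auto
  have "cos (2 * pi * d) < cos 0" using d by (intro cos_monotone_0_pi) auto
  then have c1: "cos (2 * pi * d) < 1" by simp
  have "1 * (1 - cos (2 * pi * d)) \<le> (2 * r) * (1 - cos (2 * pi * t))"
    using r c c1 by (intro mult_mono) auto
  then have "1 - cos (2 * pi * d) \<le> (norm (1 - of_real r * cis (2 * pi * t)))\<^sup>2"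
    unfolding norm_poisson_denominator by (smt (verit) zero_le_power2)
  moreover have "r\<^sup>2 \<le> 1" using r by (simp add: power_le_one)
  ultimately show ?thesis unfolding poisson_kernel_def using c1
    by (intro divide_left_mono mult_pos_pos) (auto intro: less_le_trans)
qed

text \<open>
  Only the constant term of the expansion survives integration over a period.
\<close>
lemma integral_poisson_kernel:
  assumes r: "0 \<le> r" "r < 1"
  shows "integrable lborel (\<lambda>t. poisson_kernel r t * indicator {-1/2..<1/2} t)"
    and "(LINT t|lborel. poisson_kernel r t * indicator {-1/2..<1/2} t) = 1"
proof -
  define S where "S = (\<Sum>\<^sub>\<infinity>k::int. r ^ nat \<bar>k\<bar>)"
  define f where "f = (\<lambda>(k::int) t. of_real (r ^ nat \<bar>k\<bar>) * cis (2 * pi * of_int k * t) * (indicator {-1/2..<1/2} t :: complex))"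
  have sf: "((\<lambda>k. f k t) has_sum of_real (poisson_kernel r t * indicator {-1/2..<1/2} t)) UNIV" for t
  proof -
    have "(indicator {-1/2..<1/2} t :: complex) = of_real (indicator {-1/2..<1/2} t)" by (simp add: indicator_def)
    then show ?thesis
      using has_sum_cmult_left[OF has_sum_poisson_kernel[OF r, of t], of "indicator {-1/2..<1/2} t"] by (simp add: f_def)
  qed
  have nf: "norm (f k t) = r ^ nat \<bar>k\<bar> * indicator {-1/2..<1/2} t" for k t
    using r by (auto simp: f_def norm_mult norm_power indicator_def)
  have pt: "(\<lambda>k. norm (f k t)) summable_on UNIV" for t
    unfolding nf by (intro summable_on_cmult_left summable_power_abs_int r)
  have fin: "(\<integral>\<^sup>+k. ennreal (r ^ nat \<bar>k\<bar>) \<partial>counting) < \<infinity>"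
    using summable_norm_iff_nn_integral[of "\<lambda>k::int. r ^ nat \<bar>k\<bar>" UNIV] summable_power_abs_int[OF r] r by simp
  have fin2: "(\<integral>\<^sup>+t. \<integral>\<^sup>+k. norm (f k t) \<partial>count_space UNIV \<partial>lborel) < \<infinity>"
  proof -
    have "(\<integral>\<^sup>+k. ennreal (norm (f k t)) \<partial>count_space UNIV) = (\<integral>\<^sup>+k. ennreal (r ^ nat \<bar>k\<bar>) \<partial>counting) * indicator {-1/2..<1/2} t" for t
      unfolding nf by (auto simp: indicator_def)
    then show ?thesis using fin by (simp add: nn_integral_cmult)
  qed
  have meas: "f k \<in> borel_measurable lborel" for k unfolding f_def by measurable
  note hs = has_sum_integral[OF sigma_finite_lborel meas pt fin2]
  have inf: "(\<Sum>\<^sub>\<infinity>k. f k t) = of_real (poisson_kernel r t * indicator {-1/2..<1/2} t)" for t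
    using sf by (rule infsumI)
  show "integrable lborel (\<lambda>t. poisson_kernel r t * indicator {-1/2..<1/2} t)"
    using hs(1) unfolding inf by (simp only: complex_of_real_integrable_eq)
  have fi: "(LINT t|lborel. f k t) = (if k = 0 then 1 else 0)" for k
  proof -
    have "(LINT t|lborel. f k t) = of_real (r ^ nat \<bar>k\<bar>) * (LINT t|lborel. cis (2 * pi * of_int k * t / 1) * indicator {-1/2..<1/2} t)"
      unfolding f_def mult.assoc by (simp add: mult.assoc)
    also have "(LINT t|lborel. cis (2 * pi * of_int k * t / 1) * indicator {-1/2..<1/2} t) = (LINT t|lborel. cis (2 * pi * of_int k * t / 1) * indicator {-1/2..-1/2+1} t)"
      by (subst integral_half_open_closed) auto
    also have "\<dots> = (if k = 0 then of_real 1 else 0)" by (rule integral_cis_period) simp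
    finally show ?thesis by simp
  qed
  have "((\<lambda>k. LINT t|lborel. f k t) has_sum 1) UNIV"
    unfolding fi using has_sum_finite[of "{0::int}" "\<lambda>_. 1::complex"]
    by (subst has_sum_cong_neutral[where T="{0}" and g="\<lambda>_. 1"]) auto
  then have "(LINT t|lborel. complex_of_real (poisson_kernel r t * indicator {-1/2..<1/2} t)) = 1"
    using hs(2) unfolding inf by (metis has_sum_unique)
  then show "(LINT t|lborel. poisson_kernel r t * indicator {-1/2..<1/2} t) = 1"
    unfolding integral_complex_of_real by (simp only: of_real_eq_1_iff)
qed

lemma abel_summation_int:
  fixes a :: "int \<Rightarrow> complex" and r :: "nat \<Rightarrow> real"
  assumes a: "(\<lambda>k. norm (a k)) summable_on UNIV"
    and r: "\<And>n. 0 \<le> r n" "\<And>n. r n < 1" "r \<longlonglongrightarrow> 1"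
  shows "(\<lambda>n. \<Sum>\<^sub>\<infinity>k. of_real (r n ^ nat \<bar>k\<bar>) * a k) \<longlonglongrightarrow> (\<Sum>\<^sub>\<infinity>k. a k)"
proof -
  have le: "norm (of_real (r n ^ nat \<bar>k\<bar>) * a k) \<le> norm (a k)" for n k
  proof -
    have "r n ^ nat \<bar>k\<bar> \<le> 1" using r(1)[of n] less_imp_le[OF r(2)[of n]] by (rule power_le_one)
    then show ?thesis using r(1)[of n] by (auto simp: norm_mult norm_power intro!: mult_left_le_one_le)
  qed
  have s: "(\<lambda>k. norm (of_real (r n ^ nat \<bar>k\<bar>) * a k)) summable_on UNIV" for n
    by (rule Infinite_Sum.abs_summable_on_comparison_test'[OF a]) (rule le)
  have ai: "integrable (count_space UNIV) (\<lambda>k. norm (a k))"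
    using abs_summable_equivalent[THEN iffD1, OF a] unfolding abs_summable_on_def by simp
  show ?thesis
    unfolding infsum_eq_integral_count_space[OF s] infsum_eq_integral_count_space[OF a]
  proof (rule integral_dominated_convergence[OF _ _ ai])
    show "AE k in count_space UNIV. (\<lambda>n. of_real (r n ^ nat \<bar>k\<bar>) * a k) \<longlonglongrightarrow> a k"
    proof (rule AE_I2)
      fix k
      have "(\<lambda>n. of_real (r n ^ nat \<bar>k\<bar>) * a k) \<longlonglongrightarrow> of_real (1 ^ nat \<bar>k\<bar>) * a k"
        by (intro tendsto_intros r)
      then show "(\<lambda>n. of_real (r n ^ nat \<bar>k\<bar>) * a k) \<longlonglongrightarrow> a k" by simp
    qed
  qed (use le in auto)
qed

text \<open>
  Integrating the expansion of the Poisson kernel term by term against a function on the whole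
  line yields Abel means of the Fourier transform at the integers.
\<close>
lemma integral_poisson_kernel_fourier:
  assumes u: "integrable lborel u" and r: "0 \<le> r" "r < 1"
  shows "(LINT t|lborel. u (y + t) * of_real (poisson_kernel r t))
     = (\<Sum>\<^sub>\<infinity>k::int. of_real (r ^ nat \<bar>k\<bar>) * (fourier u (of_int k) * cis (2 * pi * of_int k * y)))"
proof -
  have [measurable]: "u \<in> borel_measurable borel" using u by auto
  have uy: "integrable lborel (\<lambda>t. u (y + t))"
    using lborel_integrable_real_affine[OF u, of 1 y] by simp
  define f where "f = (\<lambda>(k::int) t. u (y + t) * (of_real (r ^ nat \<bar>k\<bar>) * cis (2 * pi * of_int k * t)))"
  have nf: "norm (f k t) = norm (u (y + t)) * r ^ nat \<bar>k\<bar>" for k t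
    using r by (simp add: f_def norm_mult norm_power)
  have pt: "(\<lambda>k. norm (f k t)) summable_on UNIV" for t
    unfolding nf by (intro summable_on_cmult_right summable_power_abs_int r)
  have fin: "(\<integral>\<^sup>+k. ennreal (r ^ nat \<bar>k\<bar>) \<partial>counting) < \<infinity>"
    using summable_norm_iff_nn_integral[of "\<lambda>k::int. r ^ nat \<bar>k\<bar>" UNIV] summable_power_abs_int[OF r] r by simp
  have fin2: "(\<integral>\<^sup>+t. \<integral>\<^sup>+k. norm (f k t) \<partial>count_space UNIV \<partial>lborel) < \<infinity>"
  proof -
    have "(\<integral>\<^sup>+t. \<integral>\<^sup>+k. norm (f k t) \<partial>count_space UNIV \<partial>lborel) = (\<integral>\<^sup>+t. norm (u (y + t)) \<partial>lborel) * (\<integral>\<^sup>+k. ennreal (r ^ nat \<bar>k\<bar>) \<partial>counting)"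
      unfolding nf using r by (simp add: ennreal_mult nn_integral_cmult nn_integral_multc)
    then show ?thesis using fin uy by (simp add: integrable_iff_bounded ennreal_mult_less_top)
  qed
  have meas: "f k \<in> borel_measurable lborel" for k unfolding f_def by measurable
  note hs = has_sum_integral[OF sigma_finite_lborel meas pt fin2]
  have inf: "(\<Sum>\<^sub>\<infinity>k. f k t) = u (y + t) * of_real (poisson_kernel r t)" for t
    unfolding f_def by (intro infsumI has_sum_cmult_right has_sum_poisson_kernel r)
  have fi: "(LINT t|lborel. f k t) = of_real (r ^ nat \<bar>k\<bar>) * (fourier u (of_int (- k)) * cis (2 * pi * of_int (- k) * y))" for k
  proof -
    have "(LINT t|lborel. f k t) = (LINT t|lborel. u t * (of_real (r ^ nat \<bar>k\<bar>) * cis (2 * pi * of_int k * (t - y))))"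
      by (subst lborel_integral_real_affine[where c=1 and t="-y"]) (auto simp: f_def)
    also have "\<dots> = (LINT t|lborel. (of_real (r ^ nat \<bar>k\<bar>) * cis (2 * pi * of_int (- k) * y)) * (u t * cis (- 2 * pi * of_int (- k) * t)))"
    proof (rule Bochner_Integration.integral_cong)
      fix t :: real
      have "cis (2 * pi * of_int k * (t - y)) = cis (2 * pi * of_int (- k) * y) * cis (- 2 * pi * of_int (- k) * t)"
        by (simp add: cis_mult algebra_simps)
      then show "u t * (of_real (r ^ nat \<bar>k\<bar>) * cis (2 * pi * of_int k * (t - y))) = (of_real (r ^ nat \<bar>k\<bar>) * cis (2 * pi * of_int (- k) * y)) * (u t * cis (- 2 * pi * of_int (- k) * t))"
        by (simp only: mult_ac)
    qed simp
    also have "\<dots> = (of_real (r ^ nat \<bar>k\<bar>) * cis (2 * pi * of_int (- k) * y)) * fourier u (of_int (- k))"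
      unfolding fourier_def by (rule integral_mult_right_zero)
    finally show ?thesis by (simp only: mult_ac)
  qed
  have "(LINT t|lborel. u (y + t) * of_real (poisson_kernel r t)) = (\<Sum>\<^sub>\<infinity>k. LINT t|lborel. f k t)"
    using hs(2) unfolding inf by (simp add: infsumI)
  also have "\<dots> = (\<Sum>\<^sub>\<infinity>k. (\<lambda>k. of_real (r ^ nat \<bar>k\<bar>) * (fourier u (of_int k) * cis (2 * pi * of_int k * y))) (- k))"
    unfolding fi by simp
  also have "\<dots> = (\<Sum>\<^sub>\<infinity>k. of_real (r ^ nat \<bar>k\<bar>) * (fourier u (of_int k) * cis (2 * pi * of_int k * y)))"
    by (rule infsum_reindex_bij_betw) (auto intro!: bij_betwI[where g=uminus])
  finally show ?thesis .
qed

lemma isCont_infsum: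
  fixes f :: "int \<Rightarrow> real \<Rightarrow> complex"
  assumes M: "M summable_on UNIV" "\<And>m t. \<bar>t - a\<bar> \<le> 1 \<Longrightarrow> norm (f m t) \<le> M m"
    and c: "\<And>m t. isCont (f m) t"
  shows "isCont (\<lambda>t. \<Sum>\<^sub>\<infinity>m. f m t) a"
proof -
  have "uniform_limit {a-1<..<a+1} (\<lambda>X t. \<Sum>m\<in>X. f m t) (\<lambda>t. \<Sum>\<^sub>\<infinity>m. f m t) (finite_subsets_at_top UNIV)"
    by (rule Weierstrass_m_test_general[OF _ M(1)]) (auto intro!: M(2))
  moreover have "continuous_on {a-1<..<a+1} (\<lambda>t. \<Sum>m\<in>X. f m t)" for X
    by (rule continuous_on_sum) (rule continuous_at_imp_continuous_on, rule ballI, rule c)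
  ultimately have "continuous_on {a-1<..<a+1} (\<lambda>t. \<Sum>\<^sub>\<infinity>m. f m t)"
    using uniform_limit_theorem[where F="finite_subsets_at_top (UNIV :: int set)"] by fastforce
  then show ?thesis by (rule continuous_on_interior) (simp add: interior_open)
qed

text \<open>
  The Abel means of the left-hand series are integrals of the periodization of \<open>u\<close> against
  Poisson kernels. The latter form an approximate identity, and the periodization is continuous
  by the Weierstrass test, so the means converge to the periodization at \<open>y\<close>. As the series
  converges absolutely, they also converge to its sum.
\<close>
theorem poisson_summation:
  assumes u: "integrable lborel u" and cont: "\<And>t. isCont u t"
    and M: "\<And>m::int. 0 \<le> M m" "M summable_on UNIV" "\<And>m t. \<bar>t - y\<bar> \<le> 1 \<Longrightarrow> norm (u (t + of_int m)) \<le> M m"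
    and F: "(\<lambda>k::int. norm (fourier u (of_int k))) summable_on UNIV"
  shows "((\<lambda>k::int. fourier u (of_int k) * cis (2 * pi * of_int k * y)) has_sum (\<Sum>\<^sub>\<infinity>m::int. u (y + of_int m))) UNIV"
proof -
  have [measurable]: "u \<in> borel_measurable borel" using u by auto
  define r where "r n = 1 - 1 / (real n + 2)" for n
  have r: "1/2 \<le> r n" "0 \<le> r n" "r n < 1" for n by (auto simp: r_def field_simps)
  have rlim: "r \<longlonglongrightarrow> 1" unfolding r_def by real_asymp
  define i where "i t = (indicator {-1/2..<1/2} t :: real)" for t :: real
  define P where "P s = (\<Sum>\<^sub>\<infinity>m::int. u (y + s + of_int m))" for s
  define k where "k n s = poisson_kernel (r n) s * i s" for n s
  have kint: "integrable lborel (k n)" "(LINT s|lborel. k n s) = 1" for n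
    using integral_poisson_kernel[OF r(2,3)] unfolding k_def i_def by auto
  have [measurable]: "i \<in> borel_measurable borel" "k n \<in> borel_measurable borel" for n
    unfolding i_def[abs_def] k_def[abs_def] by measurable
  have k0: "0 \<le> k n s" for n s unfolding k_def i_def using poisson_kernel_nonneg[OF r(2,3)] by simp
  \<comment> \<open>for periodic weights, integrating the periodization over a period is integrating u over the line\<close>
  have unfold: "integrable lborel (\<lambda>s. P s * of_real (i s * w s))"
     "(LINT s|lborel. P s * of_real (i s * w s)) = (LINT t|lborel. u (y + t) * of_real (w t))"
    if w[measurable]: "w \<in> borel_measurable borel" and wper: "\<And>t m. w (t + of_int m) = w t" and wb: "\<And>t. 0 \<le> w t" "\<And>t. w t \<le> B" for w :: "real \<Rightarrow> real" and B
  proof -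
    define f where "f = (\<lambda>(m::int) s. u (y + s + of_int m) * of_real (i s * w s))"
    have nf: "norm (f m s) \<le> M m * (i s * B)" for m s
    proof (cases "s \<in> {-1/2..<1/2}")
      case True
      then have "norm (u ((y + s) + of_int m)) \<le> M m" by (intro M(3)) auto
      then show ?thesis using True wb[of s] M(1)[of m] by (auto simp: f_def i_def norm_mult intro!: mult_mono)
    qed (auto simp: f_def i_def)
    have B0: "0 \<le> B" using wb[of 0] by linarith
    have pt: "(\<lambda>m. norm (f m s)) summable_on UNIV" for s
      by (rule Infinite_Sum.abs_summable_on_comparison_test'[OF summable_on_cmult_left[OF M(2)]]) (rule nf)
    have fin: "(\<integral>\<^sup>+m. ennreal (M m) \<partial>count_space UNIV) < \<infinity>"
      using summable_norm_iff_nn_integral[of M UNIV] M(1,2) by simp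
    have fin2: "(\<integral>\<^sup>+s. \<integral>\<^sup>+m. norm (f m s) \<partial>count_space UNIV \<partial>lborel) < \<infinity>"
    proof -
      have "(\<integral>\<^sup>+s. \<integral>\<^sup>+m. norm (f m s) \<partial>count_space UNIV \<partial>lborel) \<le> (\<integral>\<^sup>+s. \<integral>\<^sup>+m. ennreal (M m * (i s * B)) \<partial>count_space UNIV \<partial>lborel)"
        by (intro nn_integral_mono ennreal_leI nf)
      also have "\<dots> = (\<integral>\<^sup>+m. ennreal (M m) \<partial>count_space UNIV) * ((\<integral>\<^sup>+s. ennreal (i s) \<partial>lborel) * ennreal B)"
        using M(1) B0 by (simp add: ennreal_mult i_def nn_integral_cmult nn_integral_multc)
      also have "\<dots> < \<infinity>" using fin by (simp add: i_def ennreal_mult_less_top ennreal_indicator)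
      finally show ?thesis .
    qed
    have meas: "f m \<in> borel_measurable lborel" for m unfolding f_def by measurable
    note hs = has_sum_integral[OF sigma_finite_lborel meas pt fin2]
    have inf: "(\<Sum>\<^sub>\<infinity>m. f m s) = P s * of_real (i s * w s)" for s
      unfolding f_def P_def by (rule infsum_cmult_left') 
    show "integrable lborel (\<lambda>s. P s * of_real (i s * w s))" using hs(1) unfolding inf .
    have uw: "integrable lborel (\<lambda>t. u (y + t) * of_real (w t))"
    proof (rule Bochner_Integration.integrable_bound)
      show "integrable lborel (\<lambda>t. u (y + t) * of_real B)"
        using lborel_integrable_real_affine[OF u, of 1 y] by simp
      show "AE t in lborel. norm (u (y + t) * of_real (w t)) \<le> norm (u (y + t) * of_real B)"
        using wb B0 by (auto simp: norm_mult intro!: mult_left_mono)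
    qed measurable
    have "(LINT t|lborel. u (y + (t + of_int m)) * of_real (w (t + of_int m)) * indicator {-1/2..<-1/2+1} t) = (LINT t|lborel. f m t)" for m
      by (intro Bochner_Integration.integral_cong) (auto simp: f_def i_def wper indicator_def add.assoc)
    then have "((\<lambda>m. LINT t|lborel. f m t) has_sum (LINT t|lborel. u (y + t) * of_real (w t))) UNIV"
      using has_sum_integral_tiling[OF uw, of "-1/2"] by simp
    then show "(LINT s|lborel. P s * of_real (i s * w s)) = (LINT t|lborel. u (y + t) * of_real (w t))"
      using hs(2) unfolding inf by (metis has_sum_unique)
  qed
  have Pk: "integrable lborel (\<lambda>s. (P s * of_real (i s)) * of_real (k n s))"
    "(LINT s|lborel. (P s * of_real (i s)) * of_real (k n s)) = (LINT t|lborel. u (y + t) * of_real (poisson_kernel (r n) t))" for n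
  proof -
    have e: "(P s * of_real (i s)) * of_real (k n s) = P s * of_real (i s * poisson_kernel (r n) s)" for s
      by (simp add: k_def i_def indicator_def)
    show "integrable lborel (\<lambda>s. (P s * of_real (i s)) * of_real (k n s))"
    "(LINT s|lborel. (P s * of_real (i s)) * of_real (k n s)) = (LINT t|lborel. u (y + t) * of_real (poisson_kernel (r n) t))"
      unfolding e using poisson_kernel_nonneg[OF r(2,3)] poisson_kernel_bound[OF r(2,3)]
      by (intro unfold poisson_kernel_periodic; measurable)+
  qed
  have "(\<lambda>n. LINT s|lborel. (P s * of_real (i s)) * of_real (k n s)) \<longlonglongrightarrow> P 0 * of_real (i 0)"
  proof (rule approximate_identity)
    show "integrable lborel (\<lambda>s. P s * of_real (i s))" using unfold(1)[of "\<lambda>_. 1" 1] by simp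
    show "isCont (\<lambda>s. P s * of_real (i s)) 0"
    proof -
      have "isCont (\<lambda>s. P s) 0"
        unfolding P_def
        by (rule isCont_infsum[OF M(2)]) (auto intro!: M(3) isCont_o2[OF _ cont] continuous_intros)
      moreover have "isCont (\<lambda>s. P s * of_real (i s)) 0 \<longleftrightarrow> isCont P 0"
        by (rule isCont_cong, unfold eventually_nhds, rule exI[of _ "{-1/2<..<1/2}"]) (auto simp: i_def)
      ultimately show ?thesis by simp
    qed
    show "integrable lborel (k n)" "0 \<le> k n s" for n s by (fact kint k0)+
    show "integrable lborel (\<lambda>s. (P s * of_real (i s)) * of_real (k n s))" for n by (rule Pk)
    have far: "\<exists>c. c \<longlonglongrightarrow> 0 \<and> (\<forall>n. 0 \<le> c n) \<and> (\<forall>n s. \<delta> \<le> \<bar>s\<bar> \<longrightarrow> k n s \<le> c n)" if \<delta>: "\<delta> > 0" for \<delta>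
    proof -
      \<comment> \<open>the far bound for the Poisson kernel needs a distance of at most half a period\<close>
      define d where "d = min \<delta> (1/2)"
      have d: "0 < d" "d \<le> \<delta>" "d \<le> 1/2" using \<delta> by (auto simp: d_def)
      define c where "c n = (1 - (r n)\<^sup>2) / (1 - cos (2 * pi * d))" for n
      have c0: "0 \<le> c n" for n
        unfolding c_def using r[of n] by (intro divide_nonneg_nonneg) (auto simp: power_le_one)
      have "c \<longlonglongrightarrow> (1 - 1\<^sup>2) * inverse (1 - cos (2 * pi * d))"
        unfolding c_def divide_inverse by (intro tendsto_intros rlim)
      moreover have "k n s \<le> c n" if "\<delta> \<le> \<bar>s\<bar>" for n s
      proof (cases "s \<in> {-1/2..<1/2}")
        case True
        then have "poisson_kernel (r n) s \<le> c n"
          unfolding c_def using that d by (intro poisson_kernel_far_bound r) auto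
        then show ?thesis using True by (simp add: k_def i_def)
      qed (use c0 in \<open>auto simp: k_def i_def\<close>)
      ultimately show ?thesis using c0 by (intro exI[of _ c]) auto
    qed
    fix \<delta> :: real assume \<delta>: "\<delta> > 0"
    then obtain c where c: "c \<longlonglongrightarrow> 0" "\<And>n. 0 \<le> c n" "\<And>n s. \<delta> \<le> \<bar>s\<bar> \<Longrightarrow> k n s \<le> c n" using far by blast
    then show "\<exists>c. c \<longlonglongrightarrow> 0 \<and> (\<forall>n s. \<delta> \<le> \<bar>s\<bar> \<longrightarrow> k n s \<le> c n)" by blast
    show "(\<lambda>n. LINT s|lborel. k n s * indicator {-\<delta><..<\<delta>} s) \<longlonglongrightarrow> 1"
    proof (rule tendsto_sandwich[where f="\<lambda>n. 1 - c n" and h="\<lambda>_. 1"])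
      have ki: "integrable lborel (\<lambda>s. k n s * indicator {-\<delta><..<\<delta>} s)" for n
        by (rule Bochner_Integration.integrable_bound[OF kint(1)[of n]]) (auto simp: indicator_def)
      show "eventually (\<lambda>n. (LINT s|lborel. k n s * indicator {-\<delta><..<\<delta>} s) \<le> 1) sequentially"
      proof (rule always_eventually, rule allI)
        fix n
        have "(LINT s|lborel. k n s * indicator {-\<delta><..<\<delta>} s) \<le> (LINT s|lborel. k n s)"
          by (intro integral_mono ki kint) (use k0 in \<open>auto simp: indicator_def\<close>)
        then show "(LINT s|lborel. k n s * indicator {-\<delta><..<\<delta>} s) \<le> 1" by (simp add: kint)
      qed
      show "eventually (\<lambda>n. 1 - c n \<le> (LINT s|lborel. k n s * indicator {-\<delta><..<\<delta>} s)) sequentially"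
      proof (rule always_eventually, rule allI)
        fix n
        have ii: "integrable lborel i" unfolding i_def by simp
        have "1 = (LINT s|lborel. k n s)" by (simp add: kint)
        also have "\<dots> \<le> (LINT s|lborel. k n s * indicator {-\<delta><..<\<delta>} s + c n * i s)"
        proof (rule integral_mono)
          show "integrable lborel (\<lambda>s. k n s * indicator {-\<delta><..<\<delta>} s + c n * i s)" using ki ii by simp
          fix s :: real
          show "k n s \<le> k n s * indicator {-\<delta><..<\<delta>} s + c n * i s"
          proof (cases "\<bar>s\<bar> < \<delta>")
            case True
            then show ?thesis using c(2)[of n] by (auto simp: indicator_def i_def)
          next
            case False
            then show ?thesis using c(3)[of s n] c(2)[of n] by (auto simp: indicator_def i_def k_def)
          qed
        qed (rule kint)
        also have "\<dots> = (LINT s|lborel. k n s * indicator {-\<delta><..<\<delta>} s) + c n * (LINT s|lborel. i s)"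
          using ki ii by simp
        also have "(LINT s|lborel. i s) = 1" by (simp add: i_def)
        finally show "1 - c n \<le> (LINT s|lborel. k n s * indicator {-\<delta><..<\<delta>} s)" by simp
      qed
      show "(\<lambda>n. 1 - c n) \<longlonglongrightarrow> 1" using tendsto_diff[OF tendsto_const[of 1] c(1)] by simp
    qed simp
  qed
  then have lim: "(\<lambda>n. \<Sum>\<^sub>\<infinity>k::int. of_real (r n ^ nat \<bar>k\<bar>) * (fourier u (of_int k) * cis (2 * pi * of_int k * y))) \<longlonglongrightarrow> P 0"
    unfolding Pk(2) integral_poisson_kernel_fourier[OF u r(2,3)] by (simp add: i_def)
  have s: "(\<lambda>k::int. norm (fourier u (of_int k) * cis (2 * pi * of_int k * y))) summable_on UNIV"
    using F by (simp add: norm_mult)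
  have "(\<Sum>\<^sub>\<infinity>k::int. fourier u (of_int k) * cis (2 * pi * of_int k * y)) = P 0"
    using LIMSEQ_unique[OF abel_summation_int[OF s r(2,3) rlim] lim] .
  then show ?thesis
    using has_sum_infsum[OF abs_summable_summable[OF s]] by (simp add: P_def)
qed

lemma has_sum_sum:
  fixes f :: "'i \<Rightarrow> 'a \<Rightarrow> complex"
  assumes "finite I" "\<And>i. i \<in> I \<Longrightarrow> (f i has_sum s i) A"
  shows "((\<lambda>x. \<Sum>i\<in>I. f i x) has_sum (\<Sum>i\<in>I. s i)) A"
  using assms by (induction I rule: finite_induct) (auto intro: has_sum_add)

lemma sum_roots_of_unity:
  assumes N: "N \<ge> 1"
  shows "(\<Sum>n<N. cis (2 * pi * of_int k * (real n / real N))) = (if int N dvd k then of_nat N else 0)"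
proof -
  define z where "z = cis (2 * pi * of_int k / real N)"
  have t: "cis (2 * pi * of_int k * (real n / real N)) = z ^ n" for n
    by (simp add: z_def Complex.DeMoivre mult_ac)
  have zN: "z ^ N = 1"
    using N by (simp add: z_def Complex.DeMoivre)
  show ?thesis
  proof (cases "int N dvd k")
    case True
    then obtain j where "k = int N * j" by auto
    then have "2 * pi * of_int k / real N = 2 * pi * of_int j" using N by simp
    moreover have "cis (2 * pi * of_int j) = 1" by simp
    ultimately have "z = 1" unfolding z_def by (simp only:)
    then show ?thesis using True unfolding t by simp
  next
    case False
    have "z \<noteq> 1"
    proof
      assume "z = 1"
      then have "cos (2 * pi * of_int k / real N) = 1" by (simp add: z_def complex_eq_iff)
      then obtain j :: int where "2 * pi * of_int k / real N = of_int j * 2 * pi" unfolding cos_one_2pi_int by auto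
      then have "of_int k = (of_int (j * int N) :: real)" using N by (simp add: field_simps)
      then have "k = j * int N" by (simp only: of_int_eq_iff)
      then show False using False by simp
    qed
    then show ?thesis using False zN unfolding t by (simp add: geometric_sum)
  qed
qed

text \<open>
  Averaging Poisson summation over the shifts \<open>n / N\<close> annihilates all frequencies that are not
  multiples of \<open>N\<close>.
\<close>
lemma poisson_summation_multiples:
  assumes N: "N \<ge> 1" and u: "integrable lborel u" and cont: "\<And>t. isCont u t"
    and M: "\<And>y. \<exists>M::int \<Rightarrow> real. (\<forall>m. 0 \<le> M m) \<and> M summable_on UNIV \<and> (\<forall>m t. \<bar>t - y\<bar> \<le> 1 \<longrightarrow> norm (u (t + of_int m)) \<le> M m)"
    and F: "(\<lambda>k::int. norm (fourier u (of_int k))) summable_on UNIV"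
  shows "((\<lambda>k::int. fourier u (real N * of_int k)) has_sum (1 / of_nat N * (\<Sum>n<N. \<Sum>\<^sub>\<infinity>m::int. u (real n / real N + of_int m)))) UNIV"
proof -
  have P: "((\<lambda>k::int. fourier u (of_int k) * cis (2 * pi * of_int k * y)) has_sum (\<Sum>\<^sub>\<infinity>m::int. u (y + of_int m))) UNIV" for y
    using M[of y] poisson_summation[OF u cont _ _ _ F, of _ y] by blast
  have "((\<lambda>k::int. \<Sum>n<N. fourier u (of_int k) * cis (2 * pi * of_int k * (real n / real N))) has_sum (\<Sum>n<N. \<Sum>\<^sub>\<infinity>m::int. u (real n / real N + of_int m))) UNIV"
    by (intro has_sum_sum P) auto
  then have "((\<lambda>k::int. 1 / of_nat N * (\<Sum>n<N. fourier u (of_int k) * cis (2 * pi * of_int k * (real n / real N)))) has_sum (1 / of_nat N * (\<Sum>n<N. \<Sum>\<^sub>\<infinity>m::int. u (real n / real N + of_int m)))) UNIV"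
    by (rule has_sum_cmult_right)
  also have "(\<lambda>k::int. 1 / of_nat N * (\<Sum>n<N. fourier u (of_int k) * cis (2 * pi * of_int k * (real n / real N)))) = (\<lambda>k. if int N dvd k then fourier u (of_int k) else 0)"
    unfolding sum_distrib_left[symmetric] sum_roots_of_unity[OF N] using N by auto
  finally have "((\<lambda>k. fourier u (of_int k)) has_sum (1 / of_nat N * (\<Sum>n<N. \<Sum>\<^sub>\<infinity>m::int. u (real n / real N + of_int m)))) (range (\<lambda>k. int N * k))"
    by (subst has_sum_cong_neutral[where T=UNIV]) (auto elim!: dvdE)
  then show ?thesis
    by (subst (asm) has_sum_reindex) (use N in \<open>auto simp: inj_on_def o_def\<close>)
qed

lemma summable_norm_prod_iff:
  fixes a :: "int \<times> int \<Rightarrow> complex"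
  shows "(\<lambda>z. norm (a z)) summable_on UNIV \<longleftrightarrow> (\<integral>\<^sup>+k. \<integral>\<^sup>+l. norm (a (k, l)) \<partial>count_space UNIV \<partial>count_space UNIV) < \<infinity>"
  unfolding summable_norm_iff_nn_integral by (simp add: nn_integral_fst_count_space[symmetric])

text \<open>
  Sum the array \<open>F (m - k) * H m\<close> along its rows and along its columns.
\<close>
lemma has_sum_convolution:
  fixes F H :: "int \<Rightarrow> complex"
  assumes F: "(\<lambda>k. norm (F k)) summable_on UNIV" and H: "(\<lambda>k. norm (H k)) summable_on UNIV"
  shows "((\<lambda>k. \<Sum>\<^sub>\<infinity>m. F (m - k) * H m) has_sum (infsum F UNIV * infsum H UNIV)) UNIV"
    "(\<lambda>m. F (m - k) * H m) summable_on UNIV"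
proof -
  define g where "g = (\<lambda>(m, k). F (m - k) * H m)"
  have bij: "bij (\<lambda>k. m - k :: int)" for m by (rule bijI') (auto intro: exI[of _ "m - _"])
  have gs: "(\<lambda>z. norm (g z)) summable_on UNIV"
    unfolding summable_norm_prod_iff
  proof -
    have "(\<integral>\<^sup>+m. \<integral>\<^sup>+k. norm (g (m, k)) \<partial>count_space UNIV \<partial>count_space UNIV) = (\<integral>\<^sup>+m. (\<integral>\<^sup>+k. norm (F (m - k)) \<partial>count_space UNIV) * norm (H m) \<partial>count_space UNIV)"
      by (simp add: g_def norm_mult ennreal_mult nn_integral_multc)
    also have "\<dots> = (\<integral>\<^sup>+m. (\<integral>\<^sup>+k. norm (F k) \<partial>count_space UNIV) * norm (H m) \<partial>count_space UNIV)"
      by (simp add: nn_integral_bij_count_space[OF bij, where f="\<lambda>k. ennreal (norm (F k))"])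
    also have "\<dots> = (\<integral>\<^sup>+k. norm (F k) \<partial>count_space UNIV) * (\<integral>\<^sup>+m. norm (H m) \<partial>count_space UNIV)"
      by (simp add: nn_integral_cmult)
    also have "\<dots> < \<infinity>"
      using F H unfolding summable_norm_iff_nn_integral by (simp add: ennreal_mult_less_top)
    finally show "(\<integral>\<^sup>+m. \<integral>\<^sup>+k. norm (g (m, k)) \<partial>count_space UNIV \<partial>count_space UNIV) < \<infinity>" .
  qed
  have Fs: "(F has_sum infsum F UNIV) UNIV" "(H has_sum infsum H UNIV) UNIV"
    using F H by (auto intro: has_sum_infsum abs_summable_summable)
  have "(g has_sum (infsum F UNIV * infsum H UNIV)) (UNIV \<times> UNIV)"
  proof (rule has_sum_SigmaI)
    fix m :: int
    have "((\<lambda>k. F (m - k)) has_sum infsum F UNIV) UNIV"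
      using has_sum_reindex_bij_betw[OF bij, of F] Fs(1) by simp
    then show "((\<lambda>k. g (m, k)) has_sum (infsum F UNIV * H m)) UNIV"
      unfolding g_def by (auto intro: has_sum_cmult_left)
  next
    show "((\<lambda>m. infsum F UNIV * H m) has_sum (infsum F UNIV * infsum H UNIV)) UNIV"
      by (intro has_sum_cmult_right Fs)
    show "g summable_on UNIV \<times> UNIV" using abs_summable_summable[OF gs] by simp
  qed
  then have "((\<lambda>z. g (prod.swap z)) has_sum (infsum F UNIV * infsum H UNIV)) UNIV"
    by (subst has_sum_reindex_bij_betw) auto
  then have sw: "((\<lambda>z. g (prod.swap z)) has_sum (infsum F UNIV * infsum H UNIV)) (UNIV \<times> UNIV)" by simp
  have gk: "(\<lambda>m. F (m - k) * H m) summable_on UNIV" for k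
  proof -
    have "g summable_on ((\<lambda>m. (m, k)) ` UNIV)"
      by (rule summable_on_subset_banach[OF abs_summable_summable[OF gs]]) auto
    then show ?thesis by (subst (asm) summable_on_reindex) (auto simp: inj_on_def o_def g_def)
  qed
  then show "(\<lambda>m. F (m - k) * H m) summable_on UNIV" .
  show "((\<lambda>k. \<Sum>\<^sub>\<infinity>m. F (m - k) * H m) has_sum (infsum F UNIV * infsum H UNIV)) UNIV"
    by (rule has_sum_SigmaD[OF sw]) (use gk in \<open>auto simp: g_def intro!: has_sum_infsum\<close>)
qed

section \<open>Lattice sums of pairings in the Feichtinger algebra\<close>

lemma S0_samples_summable:
  assumes "f \<in> S0"
  shows "(\<lambda>k::int. norm (f (y + of_int k))) summable_on UNIV"
proof -
  obtain M where M: "\<And>m::int. 0 \<le> M m" "M summable_on UNIV" "\<And>m t. \<bar>t - y\<bar> \<le> 1 \<Longrightarrow> norm (f (t + of_int m)) \<le> M m"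
    using S0_local_bound[OF assms, of y] by metis
  show ?thesis
    by (rule Infinite_Sum.abs_summable_on_comparison_test'[OF M(2)]) (use M(3)[of y] in simp)
qed

lemma S0_samples_sum_bound:
  assumes "f \<in> S0"
  shows "(\<Sum>\<^sub>\<infinity>k::int. norm (f (y + of_int k))) \<le> exp (4 * pi) * S0_norm f"
proof -
  obtain M where M: "\<And>m::int. 0 \<le> M m" "M summable_on UNIV" "infsum M UNIV \<le> exp (4 * pi) * S0_norm f" "\<And>m t. \<bar>t - y\<bar> \<le> 1 \<Longrightarrow> norm (f (t + of_int m)) \<le> M m"
    using S0_local_bound[OF assms, of y] by metis
  have "(\<Sum>\<^sub>\<infinity>k::int. norm (f (y + of_int k))) \<le> infsum M UNIV"
    by (rule infsum_mono[OF S0_samples_summable[OF assms] M(2)]) (use M(4)[of y] in simp)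
  then show ?thesis using M(3) by simp
qed

lemma S0_bounded:
  assumes "f \<in> S0"
  shows "norm (f t) \<le> exp (4 * pi) * S0_norm f"
proof -
  have "(\<Sum>k\<in>{0::int}. norm (f (t + of_int k))) \<le> (\<Sum>\<^sub>\<infinity>k::int. norm (f (t + of_int k)))"
    by (rule finite_sum_le_infsum[OF S0_samples_summable[OF assms]]) auto
  then show ?thesis using S0_samples_sum_bound[OF assms, of t] by simp
qed

text \<open>
  The scalar form of the double periodization. Poisson summation in \<open>k2\<close> replaces the sum over
  modulations by samples at the points of \<open>1 / N\<close> times the integers, and the remaining sum over the
  translations \<open>k1\<close> separates, on every residue class, into a product. Absolute summability of
  the whole family makes the iterated summation legitimate.
\<close>
theorem S0_lattice_pairing_has_sum:
  assumes N: "N \<ge> 1" and f: "f \<in> S0" and h: "h \<in> S0"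
  shows "((\<lambda>(k1::int, k2::int). fourier (\<lambda>t. f (t - of_int k1) * h t) (real N * of_int k2)) has_sum
     (1 / of_nat N * (\<Sum>n<N. (\<Sum>\<^sub>\<infinity>k::int. f (real n / real N + of_int k)) * (\<Sum>\<^sub>\<infinity>k::int. h (real n / real N + of_int k))))) UNIV"
proof -
  define u where "u = (\<lambda>(k::int) t. f (t - of_int k) * h t)"
  define a where "a = (\<lambda>(k, l::int). fourier (u k) (of_int l))"
  define b where "b = (\<lambda>(k1::int, k2::int). fourier (u k1) (real N * of_int k2))"
  have as: "(\<lambda>z. norm (a z)) summable_on UNIV"
    unfolding summable_norm_prod_iff using S0_product_transform_summable[OF f h] by (simp add: a_def u_def)
  have ak: "(\<lambda>l. norm (fourier (u k) (of_int l))) summable_on UNIV" for k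
  proof -
    have "(\<lambda>z. norm (a z)) summable_on ((\<lambda>l. (k, l)) ` UNIV)"
      by (rule summable_on_subset_banach[OF as]) auto
    then show ?thesis by (subst (asm) summable_on_reindex) (auto simp: inj_on_def o_def a_def)
  qed
  have bs: "b summable_on UNIV"
  proof -
    have "(\<lambda>z. norm (a z)) summable_on (range (\<lambda>(k1, k2). (k1, int N * k2)))"
      by (rule summable_on_subset_banach[OF as]) auto
    then have "(\<lambda>z. norm (b z)) summable_on UNIV"
      by (subst (asm) summable_on_reindex) (use N in \<open>auto simp: inj_on_def o_def a_def b_def split_beta'\<close>)
    then show ?thesis by (rule abs_summable_summable)
  qed
  have bk: "((\<lambda>l. b (k, l)) has_sum (1 / of_nat N * (\<Sum>n<N. \<Sum>\<^sub>\<infinity>m::int. u k (real n / real N + of_int m)))) UNIV" for k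
    unfolding b_def prod.case
  proof (rule poisson_summation_multiples[OF N])
    show "integrable lborel (u k)"
      unfolding u_def by (intro integrable_mult_square_integrable square_integrable_translate S0D(1) f h)
    show "isCont (u k) t" for t
      unfolding u_def by (intro continuous_intros isCont_o2[of t "\<lambda>t. t - of_int k" f] S0D(5) f h)
    show "(\<lambda>l. norm (fourier (u k) (of_int l))) summable_on UNIV" by (rule ak)
    fix y
    obtain M where M: "\<And>m::int. 0 \<le> M m" "M summable_on UNIV" "\<And>m t. \<bar>t - y\<bar> \<le> 1 \<Longrightarrow> norm (h (t + of_int m)) \<le> M m"
      using S0_local_bound[OF h, of y] by metis
    define B where "B = exp (4 * pi) * S0_norm f"
    have B: "0 \<le> B" by (simp add: B_def S0_norm_nonneg)
    have "norm (u k (t + of_int m)) \<le> B * M m" if "\<bar>t - y\<bar> \<le> 1" for m t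
      unfolding u_def norm_mult by (intro mult_mono M(3) that S0_bounded[OF f, folded B_def] B) auto
    then show "\<exists>M::int \<Rightarrow> real. (\<forall>m. 0 \<le> M m) \<and> M summable_on UNIV \<and> (\<forall>m t. \<bar>t - y\<bar> \<le> 1 \<longrightarrow> norm (u k (t + of_int m)) \<le> M m)"
      using M(1,2) B by (intro exI[of _ "\<lambda>m. B * M m"]) (auto intro: summable_on_cmult_right)
  qed
  have cv: "((\<lambda>k. \<Sum>\<^sub>\<infinity>m::int. u k (y + of_int m)) has_sum ((\<Sum>\<^sub>\<infinity>k::int. f (y + of_int k)) * (\<Sum>\<^sub>\<infinity>k::int. h (y + of_int k)))) UNIV" for y
    using has_sum_convolution(1)[OF S0_samples_summable[OF f, of y] S0_samples_summable[OF h, of y]]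
    by (simp add: u_def algebra_simps)
  have "(b has_sum (1 / of_nat N * (\<Sum>n<N. (\<Sum>\<^sub>\<infinity>k::int. f (real n / real N + of_int k)) * (\<Sum>\<^sub>\<infinity>k::int. h (real n / real N + of_int k))))) (UNIV \<times> UNIV)"
  proof (rule has_sum_SigmaI[OF bk])
    show "((\<lambda>k. 1 / of_nat N * (\<Sum>n<N. \<Sum>\<^sub>\<infinity>m::int. u k (real n / real N + of_int m))) has_sum
      (1 / of_nat N * (\<Sum>n<N. (\<Sum>\<^sub>\<infinity>k::int. f (real n / real N + of_int k)) * (\<Sum>\<^sub>\<infinity>k::int. h (real n / real N + of_int k))))) UNIV"
      by (intro has_sum_cmult_right has_sum_sum cv) simp
  qed (use bs in simp)
  then show ?thesis by (simp add: b_def u_def)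
qed

section \<open>Delta trains and double periodization\<close>

text \<open>
  The explicit value of the weak-* sum that defines a delta train, for an arbitrary base point.
\<close>
definition sampling :: "real \<Rightarrow> functional" where
  "sampling y = (\<lambda>h. if h \<in> S0 then \<Sum>\<^sub>\<infinity>k::int. cnj (h (y + of_int k)) else 0)"

lemma S0_cnj_samples_has_sum:
  assumes "h \<in> S0"
  shows "((\<lambda>k::int. cnj (h (y + of_int k))) has_sum sampling y h) UNIV"
  unfolding sampling_def using assms S0_samples_summable[OF S0_cnj[OF assms], of y]
  by (simp add: has_sum_infsum abs_summable_summable)

lemma sampling_in_S0_dual: "sampling y \<in> S0_dual"
  unfolding S0_dual_def
proof (intro CollectI conjI ballI allI impI)
  fix f h assume f: "f \<in> S0" and h: "h \<in> S0"
  have "((\<lambda>k::int. cnj (f (y + of_int k) + h (y + of_int k))) has_sum (sampling y f + sampling y h)) UNIV"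
    using has_sum_add[OF S0_cnj_samples_has_sum[OF f, of y] S0_cnj_samples_has_sum[OF h, of y]] by simp
  then show "sampling y (\<lambda>t. f t + h t) = sampling y f + sampling y h"
    by (rule has_sum_unique[OF S0_cnj_samples_has_sum[OF S0_add[OF f h]]])
next
  fix c f assume f: "f \<in> S0"
  have "((\<lambda>k::int. cnj (c * f (y + of_int k))) has_sum (cnj c * sampling y f)) UNIV"
    using has_sum_cmult_right[OF S0_cnj_samples_has_sum[OF f, of y], of "cnj c"] by simp
  then show "sampling y (\<lambda>t. c * f t) = cnj c * sampling y f"
    by (rule has_sum_unique[OF S0_cnj_samples_has_sum[OF S0_cmult[OF f]]])
next
  show "\<exists>C. \<forall>f\<in>S0. norm (sampling y f) \<le> C * S0_norm f"
  proof (intro exI ballI)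
    fix f assume f: "f \<in> S0"
    have "norm (sampling y f) \<le> (\<Sum>\<^sub>\<infinity>k::int. norm (cnj (f (y + of_int k))))"
      using norm_infsum_bound[of "\<lambda>k::int. cnj (f (y + of_int k))" UNIV] S0_samples_summable[OF f, of y] f
      by (simp add: sampling_def del: infsum_cnj)
    also have "\<dots> \<le> exp (4 * pi) * S0_norm f" using S0_samples_sum_bound[OF f, of y] by simp
    finally show "norm (sampling y f) \<le> exp (4 * pi) * S0_norm f" .
  qed
qed (simp add: sampling_def)

text \<open>
  Weak-* limits are unique, because elements of the dual vanish off \<open>S0\<close> by convention.
\<close>
lemma weak_star_sum_eqI:
  assumes p: "\<phi> \<in> S0_dual" "\<And>h. h \<in> S0 \<Longrightarrow> ((\<lambda>i. u i h) has_sum \<phi> h) UNIV"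
  shows "weak_star_sum u = \<phi>"
  unfolding weak_star_sum_def
proof (rule the_equality)
  fix \<psi> assume q: "\<psi> \<in> S0_dual \<and> (\<forall>h\<in>S0. ((\<lambda>i. u i h) has_sum \<psi> h) UNIV)"
  show "\<psi> = \<phi>"
  proof
    fix h show "\<psi> h = \<phi> h"
    proof (cases "h \<in> S0")
      case True then show ?thesis using p(2)[OF True] q by (metis has_sum_unique)
    next
      case False then show ?thesis using p(1) q by (simp add: S0_dual_def)
    qed
  qed
qed (use p in auto)

lemma delta_train_eq: "delta_train N n = sampling (real n / real N)"
  unfolding delta_train_def
proof (rule weak_star_sum_eqI[OF sampling_in_S0_dual])
  fix h assume "h \<in> S0"
  then show "((\<lambda>k::int. delta (real n / real N + of_int k) h) has_sum sampling (real n / real N) h) UNIV"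
    using S0_cnj_samples_has_sum[of h] by (simp add: delta_def)
qed

lemma S0_dual_lincomb:
  assumes "\<And>n. n \<in> I \<Longrightarrow> \<phi> n \<in> S0_dual" "finite I"
  shows "(\<lambda>h. \<Sum>n\<in>I. a n * \<phi> n h) \<in> S0_dual"
proof -
  have d: "n \<in> I \<Longrightarrow> f \<in> S0 \<Longrightarrow> h \<in> S0 \<Longrightarrow> \<phi> n (\<lambda>t. f t + h t) = \<phi> n f + \<phi> n h"
    "n \<in> I \<Longrightarrow> f \<in> S0 \<Longrightarrow> \<phi> n (\<lambda>t. c * f t) = cnj c * \<phi> n f"
    "n \<in> I \<Longrightarrow> f \<notin> S0 \<Longrightarrow> \<phi> n f = 0" for n f h c
    using assms(1)[of n] by (auto simp: S0_dual_def)
  have "\<forall>n\<in>I. \<exists>C. \<forall>f\<in>S0. norm (\<phi> n f) \<le> C * S0_norm f" using assms(1) by (auto simp: S0_dual_def)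
  then obtain C where C: "\<And>n f. n \<in> I \<Longrightarrow> f \<in> S0 \<Longrightarrow> norm (\<phi> n f) \<le> C n * S0_norm f" by metis
  have "norm (\<Sum>n\<in>I. a n * \<phi> n f) \<le> (\<Sum>n\<in>I. norm (a n) * C n) * S0_norm f" if f: "f \<in> S0" for f
  proof -
    have "norm (\<Sum>n\<in>I. a n * \<phi> n f) \<le> (\<Sum>n\<in>I. norm (a n) * (C n * S0_norm f))"
      by (rule order_trans[OF norm_sum]) (auto simp: norm_mult intro!: sum_mono mult_left_mono C f)
    then show ?thesis by (simp add: sum_distrib_right mult.assoc)
  qed
  then show ?thesis
    unfolding S0_dual_def using d
    by (auto simp: distrib_left sum.distrib sum_distrib_left mult_ac intro!: sum.cong sum.neutral exI[of _ "\<Sum>n\<in>I. norm (a n) * C n"])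
qed

lemma delta_comb_in_S0_dual: "delta_comb N a \<in> S0_dual"
  unfolding delta_comb_def by (rule S0_dual_lincomb) (auto simp: delta_train_eq sampling_in_S0_dual)

lemma double_periodization_term:
  assumes h: "h \<in> S0"
  shows "dual_of (modulation (real N * of_int k2) (translation (of_int k1) f)) h
     = fourier (\<lambda>t. f (t - of_int k1) * cnj (h t)) (real N * of_int (- k2))"
  unfolding dual_of_def inner_L2_def fourier_def modulation_def translation_def using h
  by (simp add: mult_ac)

theorem double_periodization_has_sum:
  assumes N: "N \<ge> 1" and f: "f \<in> S0" and h: "h \<in> S0"
  shows "((\<lambda>(k1::int, k2::int). dual_of (modulation (real N * of_int k2) (translation (of_int k1) f)) h) has_sum
     delta_comb N (\<lambda>n. 1 / of_nat N * (\<Sum>\<^sub>\<infinity>k::int. f (real n / real N + of_int k))) h) UNIV"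
proof -
  \<comment> \<open>modulation by k2 produces the Fourier transform at the opposite frequency\<close>
  have bij: "bij (\<lambda>(k1::int, k2::int). (k1, - k2))"
    by (rule bij_betwI[where g="\<lambda>(k1, k2). (k1, - k2)"]) auto
  have "((\<lambda>(k1::int, k2::int). fourier (\<lambda>t. f (t - of_int k1) * cnj (h t)) (real N * of_int k2)) has_sum
     (1 / of_nat N * (\<Sum>n<N. (\<Sum>\<^sub>\<infinity>k::int. f (real n / real N + of_int k)) * (\<Sum>\<^sub>\<infinity>k::int. cnj (h (real n / real N + of_int k)))))) UNIV"
    by (rule S0_lattice_pairing_has_sum[OF N f S0_cnj[OF h]])
  also have "1 / of_nat N * (\<Sum>n<N. (\<Sum>\<^sub>\<infinity>k::int. f (real n / real N + of_int k)) * (\<Sum>\<^sub>\<infinity>k::int. cnj (h (real n / real N + of_int k))))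
     = delta_comb N (\<lambda>n. 1 / of_nat N * (\<Sum>\<^sub>\<infinity>k::int. f (real n / real N + of_int k))) h"
    using h by (simp add: delta_comb_def delta_train_eq sampling_def sum_distrib_left mult.assoc)
  finally show ?thesis
    unfolding double_periodization_term[OF h]
    by (subst (asm) has_sum_reindex_bij_betw[OF bij, symmetric]) (simp add: split_beta')
qed

text \<open>
  The convergence just shown holds on every element of \<open>S0\<close>, and combinations of delta trains are
  bounded functionals; so the weak-* sum exists and is this combination.
\<close>
lemma double_periodization_eq:
  assumes N: "N \<ge> 1" and f: "f \<in> S0"
  shows "double_periodization N f = delta_comb N (\<lambda>n. 1 / of_nat N * (\<Sum>\<^sub>\<infinity>k::int. f (real n / real N + of_int k)))"
  unfolding double_periodization_def
proof (rule weak_star_sum_eqI[OF delta_comb_in_S0_dual])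
  fix h assume h: "h \<in> S0"
  show "((\<lambda>i. (case i of (k1::int, k2::int) \<Rightarrow> dual_of (modulation (real N * of_int k2) (translation (of_int k1) f))) h) has_sum
     delta_comb N (\<lambda>n. 1 / of_nat N * (\<Sum>\<^sub>\<infinity>k::int. f (real n / real N + of_int k))) h) UNIV"
    using double_periodization_has_sum[OF N f h] by (simp add: split_beta')
qed

lemma stft_delta_train:
  assumes g: "g \<in> S0"
  shows "stft_dual g (delta_train N n) (x, \<xi>) = cis (- 2 * pi * \<xi> * (real n / real N)) * zak (\<lambda>t. cnj (g t)) (real n / real N - x) \<xi>"
proof -
  define q where "q = real n / real N"
  have "stft_dual g (delta_train N n) (x, \<xi>) = (\<Sum>\<^sub>\<infinity>k::int. cnj (tf_shift x \<xi> g (q + of_int k)))"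
    using S0_tf_shift[OF g, of x \<xi>] by (simp add: stft_dual_def delta_train_eq sampling_def q_def)
  also have "\<dots> = (\<Sum>\<^sub>\<infinity>k::int. cis (- 2 * pi * \<xi> * q) * (\<lambda>k::int. cnj (g (q - x - of_int k)) * cis (2 * pi * of_int k * \<xi>)) (- k))"
  proof (rule infsum_cong)
    fix k :: int
    have "cis (- (2 * pi * \<xi> * (q + of_int k))) = cis (- 2 * pi * \<xi> * q) * cis (2 * pi * of_int (- k) * \<xi>)"
      by (simp add: cis_mult algebra_simps)
    then show "cnj (tf_shift x \<xi> g (q + of_int k)) = cis (- 2 * pi * \<xi> * q) * (\<lambda>k::int. cnj (g (q - x - of_int k)) * cis (2 * pi * of_int k * \<xi>)) (- k)"
      by (simp add: tf_shift_eq cis_cnj algebra_simps)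
  qed
  also have "\<dots> = cis (- 2 * pi * \<xi> * q) * (\<Sum>\<^sub>\<infinity>k::int. (\<lambda>k::int. cnj (g (q - x - of_int k)) * cis (2 * pi * of_int k * \<xi>)) (- k))"
    by (rule infsum_cmult_right')
  also have "(\<Sum>\<^sub>\<infinity>k::int. (\<lambda>k::int. cnj (g (q - x - of_int k)) * cis (2 * pi * of_int k * \<xi>)) (- k)) = zak (\<lambda>t. cnj (g t)) (q - x) \<xi>"
    unfolding zak_def by (rule infsum_reindex_bij_betw) (auto intro!: bij_betwI[where g=uminus])
  finally show ?thesis by (simp add: q_def)
qed

text \<open>
  The coefficients of the double periodization of \<open>\<pi>(x, \<xi>)g\<close> are thus the conjugates of the values
  at \<open>(x, \<xi>)\<close> of the STFTs of the delta trains. This links the second and third kernel formula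
  to the first one.
\<close>
lemma samples_tf_shift:
  assumes g: "g \<in> S0"
  shows "(\<Sum>\<^sub>\<infinity>k::int. tf_shift x \<xi> g (real n / real N + of_int k)) = cnj (stft_dual g (delta_train N n) (x, \<xi>))"
  using S0_tf_shift[OF g, of x \<xi>]
  by (simp add: stft_dual_def delta_train_eq sampling_def flip: infsum_cnj)

section \<open>Reproducing kernels of finite orthogonal families\<close>

lemma cnj_measurable [measurable]: "cnj \<in> borel_measurable borel"
  by (intro borel_measurable_continuous_onI continuous_intros)

lemma square_integrable_cnj:
  assumes "f \<in> square_integrable M"
  shows "(\<lambda>t. cnj (f t)) \<in> square_integrable M"
proof -
  have [measurable]: "f \<in> borel_measurable M" using assms by (simp add: square_integrable_def)
  have "(\<lambda>t. cnj (f t)) \<in> borel_measurable M" by measurable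
  then show ?thesis using assms by (simp add: square_integrable_def)
qed

lemma integrable_inner_L2:
  assumes "f \<in> square_integrable M" "h \<in> square_integrable M"
  shows "integrable M (\<lambda>t. f t * cnj (h t))"
  by (intro integrable_mult_square_integrable square_integrable_cnj assms)

text \<open>
  The span of finitely many orthogonal functions of equal norm. The functions are not taken
  modulo null sets: orthogonality bounds the coefficients of a combination by its norm, hence
  a combination of norm 0 vanishes at every point, and point evaluation is continuous.
\<close>
locale finite_orthogonal_family =
  fixes M :: "'a measure" and N :: nat and E :: "nat \<Rightarrow> 'a \<Rightarrow> complex" and c :: real
  assumes square: "\<And>n. n < N \<Longrightarrow> E n \<in> square_integrable M"
    and c: "c > 0"
    and orth: "\<And>n m. n < N \<Longrightarrow> m < N \<Longrightarrow> inner_L2 M (E n) (E m) = (if n = m then of_real c else 0)"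
begin

definition comb :: "(nat \<Rightarrow> complex) \<Rightarrow> 'a \<Rightarrow> complex" where
  "comb a = (\<lambda>z. \<Sum>n<N. a n * E n z)"

abbreviation "H \<equiv> range comb"

lemma comb_square_integrable: "comb a \<in> square_integrable M"
proof -
  have "(\<lambda>z. \<Sum>n\<in>A. a n * E n z) \<in> square_integrable M" if "A \<subseteq> {..<N}" for A
    using finite_subset[OF that finite_lessThan] that
  proof (induction A rule: finite_induct)
    case empty
    then show ?case by (simp add: square_integrable_def)
  next
    case (insert n A)
    then show ?case by (auto intro!: square_integrable_add square_integrable_cmult square)
  qed
  then show ?thesis by (simp add: comb_def)
qed

lemma inner_comb: "inner_L2 M (comb a) (comb b) = c * (\<Sum>n<N. a n * cnj (b n))"
proof -
  have "inner_L2 M (comb a) (comb b) = (LINT z|M. (\<Sum>n<N. \<Sum>m<N. a n * cnj (b m) * (E n z * cnj (E m z))))"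
    unfolding inner_L2_def comb_def
    by (intro Bochner_Integration.integral_cong) (auto simp: sum_product mult_ac)
  also have "\<dots> = (\<Sum>n<N. \<Sum>m<N. (LINT z|M. a n * cnj (b m) * (E n z * cnj (E m z))))"
    by (subst Bochner_Integration.integral_sum; (intro Bochner_Integration.integrable_sum sum.cong refl Bochner_Integration.integral_sum)?)
       (auto intro!: integrable_inner_L2 square)
  also have "\<dots> = (\<Sum>n<N. \<Sum>m<N. a n * cnj (b m) * inner_L2 M (E n) (E m))"
    by (simp add: inner_L2_def)
  also have "\<dots> = (\<Sum>n<N. \<Sum>m<N. if n = m then a n * cnj (b m) * c else 0)"
    by (intro sum.cong refl) (auto simp: orth)
  also have "\<dots> = (\<Sum>n<N. a n * cnj (b n) * c)" by (simp add: sum.delta)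
  finally show ?thesis by (simp add: sum_distrib_left mult_ac)
qed

lemma comb_add: "(\<lambda>z. comb a z + comb b z) = comb (\<lambda>n. a n + b n)"
  by (simp add: comb_def sum.distrib distrib_right)

lemma comb_cmult: "(\<lambda>z. s * comb a z) = comb (\<lambda>n. s * a n)"
  by (simp add: comb_def sum_distrib_left mult.assoc)

lemma comb_diff: "(\<lambda>z. comb a z - comb b z) = comb (\<lambda>n. a n - b n)"
  by (simp add: comb_def sum_subtractf left_diff_distrib)

lemma norm_comb: "ip_norm (inner_L2 M) (comb a) = sqrt (c * (\<Sum>n<N. (norm (a n))\<^sup>2))"
proof -
  have "inner_L2 M (comb a) (comb a) = complex_of_real (c * (\<Sum>n<N. (norm (a n))\<^sup>2))"
    unfolding inner_comb of_real_mult of_real_sum complex_norm_square ..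
  then show ?thesis unfolding ip_norm_def by (simp only: Re_complex_of_real)
qed

text \<open>
  Completeness, definiteness and boundedness of point evaluations all reduce to this estimate.
\<close>
lemma coeff_le_norm:
  assumes "n < N"
  shows "norm (a n) \<le> ip_norm (inner_L2 M) (comb a) / sqrt c"
proof -
  have "(norm (a n))\<^sup>2 \<le> (\<Sum>n<N. (norm (a n))\<^sup>2)"
    using assms by (intro member_le_sum) auto
  then have "norm (a n) \<le> sqrt (\<Sum>n<N. (norm (a n))\<^sup>2)" by (simp add: real_le_rsqrt)
  also have "\<dots> = ip_norm (inner_L2 M) (comb a) / sqrt c" using c by (simp add: norm_comb real_sqrt_mult)
  finally show ?thesis .
qed

lemma comb_eq_iff: "comb a = comb b \<longleftrightarrow> (\<forall>n<N. a n = b n)"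
proof
  assume "comb a = comb b"
  then have "comb (\<lambda>n. a n - b n) = comb (\<lambda>n. 0)" by (simp flip: comb_diff) (simp add: comb_def)
  then have "ip_norm (inner_L2 M) (comb (\<lambda>n. a n - b n)) = 0" by (simp add: norm_comb)
  then show "\<forall>n<N. a n = b n" using coeff_le_norm[of _ "\<lambda>n. a n - b n"] by simp
qed (simp add: comb_def)

lemma rkhs: "rkhs H (inner_L2 M)"
  unfolding rkhs_def
proof (intro conjI)
  show "complex_linear_space H"
    unfolding complex_linear_space_def
  proof (intro conjI ballI allI)
    show "(\<lambda>_. 0) \<in> H" by (rule range_eqI[of _ _ "\<lambda>_. 0"]) (simp add: comb_def)
  qed (auto simp: comb_add comb_cmult)
  show "inner_product_on H (inner_L2 M)"
    unfolding inner_product_on_def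
  proof (intro conjI ballI allI impI)
    fix F assume F: "F \<in> H" "inner_L2 M F F = 0"
    then obtain a where a: "F = comb a" by auto
    have "ip_norm (inner_L2 M) (comb a) = 0" using F(2) by (simp add: a ip_norm_def)
    then have "\<forall>n<N. a n = 0" using coeff_le_norm[of _ a] by simp
    then show "F = (\<lambda>_. 0)" by (simp add: a comb_def)
  next
    fix F assume "F \<in> H"
    then obtain a where a: "F = comb a" by auto
    have "inner_L2 M F F = complex_of_real (c * (\<Sum>n<N. (norm (a n))\<^sup>2))"
      unfolding a inner_comb of_real_mult of_real_sum complex_norm_square ..
    then show "0 \<le> Re (inner_L2 M F F)" using c by (simp add: sum_nonneg del: of_real_mult)
  next
    fix F G assume "F \<in> H" "G \<in> H"
    then show "inner_L2 M G F = cnj (inner_L2 M F G)" by (auto simp: inner_comb mult_ac)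
  qed (auto simp: inner_comb comb_add comb_cmult sum.distrib distrib_left distrib_right sum_distrib_left mult_ac)
  show "\<forall>z. \<exists>C. \<forall>F\<in>H. norm (F z) \<le> C * ip_norm (inner_L2 M) F"
  proof (intro allI exI ballI)
    fix z F assume "F \<in> H"
    then obtain a where a: "F = comb a" by auto
    have "norm (F z) \<le> (\<Sum>n<N. norm (a n) * norm (E n z))"
      unfolding a comb_def by (rule order_trans[OF norm_sum]) (simp add: norm_mult)
    also have "\<dots> \<le> (\<Sum>n<N. ip_norm (inner_L2 M) F / sqrt c * norm (E n z))"
      unfolding a by (intro sum_mono mult_right_mono coeff_le_norm) auto
    also have "\<dots> = ((\<Sum>n<N. norm (E n z)) / sqrt c) * ip_norm (inner_L2 M) F"
      by (simp add: sum_distrib_left sum_distrib_right sum_divide_distrib mult_ac)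
    finally show "norm (F z) \<le> ((\<Sum>n<N. norm (E n z)) / sqrt c) * ip_norm (inner_L2 M) F" .
  qed
  show "complete_on H (inner_L2 M)"
    unfolding complete_on_def
  proof (intro allI impI, elim conjE)
    fix F :: "nat \<Rightarrow> 'a \<Rightarrow> complex"
    assume FH: "\<forall>n. F n \<in> H"
      and cau: "\<forall>e>0. \<exists>n0. \<forall>m\<ge>n0. \<forall>n\<ge>n0. ip_norm (inner_L2 M) (\<lambda>z. F m z - F n z) < e"
    have "\<forall>j. \<exists>a. F j = comb a" using FH by blast
    then obtain a where a: "\<And>j. F j = comb (a j)" by metis
    have "convergent (\<lambda>j. a j n)" if n: "n < N" for n
      unfolding Cauchy_convergent_iff[symmetric] Cauchy_def dist_norm
    proof (intro allI impI)
      fix e :: real assume "e > 0"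
      then have "e * sqrt c > 0" using c by simp
      with cau obtain j0 where j0: "\<And>i j. i \<ge> j0 \<Longrightarrow> j \<ge> j0 \<Longrightarrow> ip_norm (inner_L2 M) (\<lambda>z. F i z - F j z) < e * sqrt c" by blast
      have "norm (a i n - a j n) < e" if "i \<ge> j0" "j \<ge> j0" for i j
      proof -
        have "norm (a i n - a j n) \<le> ip_norm (inner_L2 M) (comb (\<lambda>n. a i n - a j n)) / sqrt c"
          using coeff_le_norm[OF n, of "\<lambda>n. a i n - a j n"] by simp
        also have "\<dots> < e" using j0[OF that] c unfolding a comb_diff by (simp add: divide_less_eq)
        finally show ?thesis .
      qed
      then show "\<exists>j0. \<forall>i\<ge>j0. \<forall>j\<ge>j0. norm (a i n - a j n) < e" by blast
    qed
    then have "\<forall>n. \<exists>l. n < N \<longrightarrow> (\<lambda>j. a j n) \<longlonglongrightarrow> l" by (auto simp: convergent_def)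
    then obtain l where l: "\<And>n. n < N \<Longrightarrow> (\<lambda>j. a j n) \<longlonglongrightarrow> l n" by metis
    have "(\<lambda>j. sqrt (c * (\<Sum>n<N. (norm (a j n - l n))\<^sup>2))) \<longlonglongrightarrow> sqrt (c * (\<Sum>n<N. (norm (l n - l n))\<^sup>2))"
      by (intro tendsto_intros l) auto
    then have "(\<lambda>j. ip_norm (inner_L2 M) (\<lambda>z. F j z - comb l z)) \<longlonglongrightarrow> 0"
      unfolding a comb_diff norm_comb by simp
    then show "\<exists>G\<in>H. (\<lambda>j. ip_norm (inner_L2 M) (\<lambda>z. F j z - G z)) \<longlonglongrightarrow> 0" by blast
  qed
qed

text \<open>
  The conjugate of \<open>kernel z'\<close> is the element of the span with coefficients \<open>cnj (E n z') / c\<close>, which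
  is what the inner product formula requires of a representer of the evaluation at \<open>z'\<close>.
\<close>
definition kernel :: "'a \<Rightarrow> 'a \<Rightarrow> complex" where
  "kernel z' z = 1 / of_real c * (\<Sum>n<N. E n z' * cnj (E n z))"

lemma cnj_kernel: "(\<lambda>z. cnj (kernel z' z)) = comb (\<lambda>n. cnj (E n z') / of_real c)"
  by (simp add: kernel_def comb_def sum_divide_distrib)

lemma kernel_reproducing: "is_reproducing_kernel H (inner_L2 M) kernel"
  unfolding is_reproducing_kernel_def cnj_kernel
proof (intro conjI allI ballI)
  fix F z assume "F \<in> H"
  then obtain a where a: "F = comb a" by auto
  show "F z = inner_L2 M F (comb (\<lambda>n. cnj (E n z) / of_real c))"
    unfolding a inner_comb using c by (simp add: comb_def sum_distrib_left)
qed simp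

lemma reproducing_kernel_unique:
  assumes K: "is_reproducing_kernel H (inner_L2 M) K"
  shows "K = kernel"
proof (intro ext)
  fix z' z
  have KH: "(\<lambda>z. cnj (K z' z)) \<in> H" using K by (simp add: is_reproducing_kernel_def)
  then obtain b where b: "(\<lambda>z. cnj (K z' z)) = comb b" by auto
  have "comb a z' = inner_L2 M (comb a) (comb b)" for a
    using K unfolding is_reproducing_kernel_def b[symmetric] by blast
  then have ev: "(\<Sum>n<N. a n * E n z') = c * (\<Sum>n<N. a n * cnj (b n))" for a
    unfolding inner_comb by (simp add: comb_def)
  have "b n = cnj (E n z') / of_real c" if n: "n < N" for n
  proof -
    \<comment> \<open>test the reproducing property on the basis function with index n\<close>
    have "E n z' = c * cnj (b n)"
      using ev[of "\<lambda>m. if m = n then 1 else 0"] n by (simp add: if_distrib[of "\<lambda>x. x * _"] sum.delta' cong: if_cong)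
    then have "cnj (E n z') = c * b n" by simp
    then show ?thesis using c by (simp add: field_simps)
  qed
  then have "comb b = (\<lambda>z. cnj (kernel z' z))" unfolding cnj_kernel comb_eq_iff by blast
  then show "K z' z = kernel z' z" unfolding b[symmetric] by (metis complex_cnj_cnj)
qed

end

section \<open>Orthogonality of the transforms of delta trains\<close>

lemma emeasure_torus: "emeasure (torus N) (space (torus N)) = real N"
proof -
  have "emeasure lborel ({0..1::real} \<times> {0..real N}) = emeasure (lborel \<Otimes>\<^sub>M lborel) ({0..1::real} \<times> {0..real N})"
    by (simp add: lborel_prod)
  also have "\<dots> = real N" by (subst lborel.emeasure_pair_measure_Times) auto
  finally show ?thesis unfolding torus_def by (simp add: space_restrict_space emeasure_restrict_space borel_prod[symmetric])
qed

lemma finite_measure_torus: "finite_measure (torus N)"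
  by (rule finite_measureI) (simp add: emeasure_torus)

lemma has_sum_product:
  fixes a b :: "int \<Rightarrow> complex"
  assumes a: "(\<lambda>k. norm (a k)) summable_on UNIV" and b: "(\<lambda>k. norm (b k)) summable_on UNIV"
  shows "((\<lambda>(k, l). a k * b l) has_sum (infsum a UNIV * infsum b UNIV)) UNIV"
    and "(\<integral>\<^sup>+z. norm (case z of (k, l) \<Rightarrow> a k * b l) \<partial>count_space UNIV)
       = (\<integral>\<^sup>+k. norm (a k) \<partial>count_space UNIV) * (\<integral>\<^sup>+l. norm (b l) \<partial>count_space UNIV)"
proof -
  show n: "(\<integral>\<^sup>+z. norm (case z of (k, l) \<Rightarrow> a k * b l) \<partial>count_space UNIV)
       = (\<integral>\<^sup>+k. norm (a k) \<partial>count_space UNIV) * (\<integral>\<^sup>+l. norm (b l) \<partial>count_space UNIV)"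
    by (simp add: nn_integral_fst_count_space[symmetric] norm_mult ennreal_mult nn_integral_cmult nn_integral_multc)
  have "(\<lambda>z. norm (case z of (k, l) \<Rightarrow> a k * b l)) summable_on UNIV"
    using a b unfolding summable_norm_iff_nn_integral n by (simp add: ennreal_mult_less_top)
  then have "(\<lambda>(k, l). a k * b l) summable_on UNIV" by (rule abs_summable_summable)
  then have "((\<lambda>(k, l). a k * b l) has_sum (infsum a UNIV * infsum b UNIV)) (UNIV \<times> UNIV)"
    using a b by (intro has_sum_SigmaI[where g="\<lambda>k. a k * infsum b UNIV"])
      (auto intro!: has_sum_cmult_left has_sum_cmult_right has_sum_infsum abs_summable_summable)
  then show "((\<lambda>(k, l). a k * b l) has_sum (infsum a UNIV * infsum b UNIV)) UNIV" by simp
qed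

lemma nn_integral_samples_bound:
  assumes "f \<in> S0"
  shows "(\<integral>\<^sup>+k. norm (f (y + of_int k)) \<partial>counting) \<le> ennreal (exp (4 * pi) * S0_norm f)"
proof -
  have abs: "(\<lambda>k::int. norm (norm (f (y + of_int k)))) summable_on UNIV" using S0_samples_summable[OF assms, of y] by simp
  have "(\<integral>\<^sup>+k. norm (f (y + of_int k)) \<partial>counting) = ennreal (\<Sum>\<^sub>\<infinity>k::int. norm (f (y + of_int k)))"
    using nn_integral_conv_infsetsum[OF abs_summable_equivalent[THEN iffD1, OF abs]]
      infsetsum_infsum[OF abs_summable_equivalent[THEN iffD1, OF abs]] by simp
  also have "\<dots> \<le> ennreal (exp (4 * pi) * S0_norm f)"
    by (intro ennreal_leI S0_samples_sum_bound assms)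
  finally show ?thesis .
qed

text \<open>
  The summands of the STFT of the delta train through \<open>q\<close>, with window \<open>g\<close>.
\<close>
definition train_term :: "(real \<Rightarrow> complex) \<Rightarrow> real \<Rightarrow> int \<Rightarrow> real \<times> real \<Rightarrow> complex" where
  "train_term g q k z = cnj (g (q + of_int k - fst z)) * cis (- 2 * pi * snd z * (q + of_int k))"

lemma norm_train_term: "norm (train_term g q k z) = norm (g ((q - fst z) + of_int k))"
  by (simp add: train_term_def norm_mult algebra_simps)

lemma train_term_summable:
  assumes "g \<in> S0"
  shows "(\<lambda>k. norm (train_term g q k z)) summable_on UNIV"
  unfolding norm_train_term by (rule S0_samples_summable[OF assms])

lemma stft_delta_train_infsum:
  assumes g: "g \<in> S0"
  shows "stft_dual g (delta_train N n) z = (\<Sum>\<^sub>\<infinity>k. train_term g (real n / real N) k z)"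
proof -
  obtain x \<xi> where z: "z = (x, \<xi>)" by (cases z)
  have "stft_dual g (delta_train N n) z = (\<Sum>\<^sub>\<infinity>k::int. cnj (tf_shift x \<xi> g (real n / real N + of_int k)))"
    using S0_tf_shift[OF g, of x \<xi>] by (simp add: z stft_dual_def delta_train_eq sampling_def)
  then show ?thesis by (simp add: z train_term_def tf_shift_eq cis_cnj mult_ac)
qed

lemma train_term_measurable [measurable]:
  assumes [measurable]: "g \<in> borel_measurable borel"
  shows "train_term g q k \<in> borel_measurable (torus N)"
proof -
  have "train_term g q k \<in> borel_measurable (borel \<Otimes>\<^sub>M borel)"
    unfolding train_term_def[abs_def] by measurable
  then have "train_term g q k \<in> borel_measurable (lborel :: (real \<times> real) measure)" by (simp add: borel_prod)
  then show ?thesis unfolding torus_def by (rule measurable_restrict_space1)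
qed

lemma stft_delta_train_square_integrable:
  assumes g: "g \<in> S0"
  shows "stft_dual g (delta_train N n) \<in> square_integrable (torus N)"
proof -
  interpret finite_measure "torus N" by (rule finite_measure_torus)
  have [measurable]: "g \<in> borel_measurable borel" using S0D(4)[OF g] .
  define C where "C = exp (4 * pi) * S0_norm g"
  have eq: "stft_dual g (delta_train N n) = (\<lambda>z. \<Sum>\<^sub>\<infinity>k. train_term g (real n / real N) k z)"
    using stft_delta_train_infsum[OF g] by blast
  have fin: "(\<integral>\<^sup>+z. \<integral>\<^sup>+k. norm (train_term g (real n / real N) k z) \<partial>count_space UNIV \<partial>torus N) < \<infinity>"
  proof -
    have "(\<integral>\<^sup>+z. \<integral>\<^sup>+k. norm (train_term g (real n / real N) k z) \<partial>count_space UNIV \<partial>torus N) \<le> (\<integral>\<^sup>+z. ennreal C \<partial>torus N)"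
      unfolding norm_train_term C_def by (intro nn_integral_mono nn_integral_samples_bound g)
    also have "\<dots> < \<infinity>" by (simp add: emeasure_torus ennreal_mult_less_top)
    finally show ?thesis .
  qed
  have int: "integrable (torus N) (stft_dual g (delta_train N n))"
    unfolding eq by (rule has_sum_integral(1)[OF sigma_finite_measure_axioms _ _ fin]) (auto intro: train_term_summable g)
  have bnd: "norm (stft_dual g (delta_train N n) z) \<le> C" for z
  proof -
    have "norm (stft_dual g (delta_train N n) z) \<le> (\<Sum>\<^sub>\<infinity>k. norm (train_term g (real n / real N) k z))"
      unfolding eq by (rule norm_infsum_bound[OF train_term_summable[OF g]])
    also have "\<dots> \<le> C" unfolding norm_train_term C_def by (rule S0_samples_sum_bound[OF g])
    finally show ?thesis .
  qed
  have [measurable]: "stft_dual g (delta_train N n) \<in> borel_measurable (torus N)" using int by auto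
  have "integrable (torus N) (\<lambda>z. (norm (stft_dual g (delta_train N n) z))\<^sup>2)"
  proof (rule integrable_const_bound[where B="C\<^sup>2"])
    show "AE z in torus N. norm ((norm (stft_dual g (delta_train N n) z))\<^sup>2) \<le> C\<^sup>2"
      using bnd by (auto intro!: power_mono)
  qed measurable
  then show ?thesis by (simp add: square_integrable_def)
qed

lemma norm_L2_power2: "(norm_L2 lborel g)\<^sup>2 = (LINT t|lborel. (norm (g t))\<^sup>2)"
  by (simp add: norm_L2_def)

lemma norm_L2_pos:
  assumes g: "g \<in> S0" "g \<noteq> (\<lambda>_. 0)"
  shows "0 < (norm_L2 lborel g)\<^sup>2"
proof -
  obtain t0 where t0: "g t0 \<noteq> 0" using g(2) by auto
  have "isCont g t0" by (rule S0D(5)[OF g(1)])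
  then obtain d where d: "d > 0" "\<And>t. \<bar>t - t0\<bar> < d \<Longrightarrow> norm (g t - g t0) < norm (g t0) / 2"
    unfolding isCont_def LIM_def dist_norm using t0
    by (metis diff_self half_gt_zero norm_zero real_norm_def zero_less_norm_iff)
  have "0 < (norm (g t0) / 2)\<^sup>2 * (2 * d)" using t0 d by simp
  also have "\<dots> = (LINT t|lborel. (norm (g t0) / 2)\<^sup>2 * indicator {t0-d<..<t0+d} t)" using d by simp
  also have "\<dots> \<le> (LINT t|lborel. (norm (g t))\<^sup>2)"
  proof (rule integral_mono)
    show "integrable lborel (\<lambda>t. (norm (g t))\<^sup>2)" using S0D(1)[OF g(1)] by (simp add: square_integrable_def)
    fix t
    show "(norm (g t0) / 2)\<^sup>2 * indicator {t0-d<..<t0+d} t \<le> (norm (g t))\<^sup>2"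
    proof (cases "t \<in> {t0-d<..<t0+d}")
      case True
      then have "norm (g t - g t0) < norm (g t0) / 2" by (intro d(2)) auto
      then have "norm (g t0) / 2 \<le> norm (g t)" using norm_triangle_ineq2[of "g t0" "g t"] by (simp add: norm_minus_commute)
      then show ?thesis using True by (simp add: power_mono)
    qed simp
  qed (use d in \<open>auto intro!: integrable_real_indicator\<close>)
  finally show ?thesis by (simp add: norm_L2_power2)
qed

text \<open>
  The unit cells \<open>q + k - [0, 1]\<close> tile the line.
\<close>
lemma lattice_cells_has_sum:
  fixes g :: "real \<Rightarrow> complex"
  assumes g: "g \<in> square_integrable lborel"
  shows "((\<lambda>k::int. LINT x|lborel. complex_of_real ((norm (g (q + of_int k - x)))\<^sup>2) * indicator {0..1} x) has_sum complex_of_real ((norm_L2 lborel g)\<^sup>2)) UNIV"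
proof -
  have [measurable]: "g \<in> borel_measurable borel" using g by (simp add: square_integrable_def)
  define F where "F = (\<lambda>t. complex_of_real ((norm (g (q - t)))\<^sup>2))"
  have gi: "integrable lborel (\<lambda>t. (norm (g t))\<^sup>2)" using g by (simp add: square_integrable_def)
  have Fi: "integrable lborel F"
    unfolding F_def using lborel_integrable_real_affine[OF gi, of "-1" q] by (intro integrable_of_real) simp
  have FI: "(LINT t|lborel. F t) = complex_of_real ((norm_L2 lborel g)\<^sup>2)"
    unfolding F_def integral_complex_of_real norm_L2_power2
    by (subst lborel_integral_real_affine[where c="-1" and t=q]) auto
  have cell: "(LINT t|lborel. F (t + of_int m) * indicator {0..<0+1} t) = (LINT x|lborel. complex_of_real ((norm (g (q + of_int (- m) - x)))\<^sup>2) * indicator {0..1} x)" for m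
    by (subst integral_half_open_closed) (auto simp: F_def algebra_simps)
  have bij: "bij (uminus :: int \<Rightarrow> int)" by (auto intro!: bij_betwI[where g=uminus])
  show ?thesis
    using has_sum_integral_tiling[OF Fi, of 0] unfolding cell FI
    using has_sum_reindex_bij_betw[OF bij, of "\<lambda>k. LINT x|lborel. complex_of_real ((norm (g (q + of_int k - x)))\<^sup>2) * indicator {0..1} x"] by simp
qed

text \<open>
  Both transforms are absolutely convergent series in the frequency variable with frequencies
  in \<open>1 / N\<close> times the integers. Integration over a frequency interval of length \<open>N\<close> keeps only the
  products of equal frequencies, and there are none if the trains differ. On the diagonal the
  time integrals over the unit interval add up to the squared norm of \<open>g\<close>.
\<close>
theorem stft_delta_train_orthogonal:
  assumes N: "N \<ge> 1" and g: "g \<in> S0" and nm: "n < N" "m < N"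
  shows "inner_L2 (torus N) (stft_dual g (delta_train N n)) (stft_dual g (delta_train N m))
     = (if n = m then of_real (real N * (norm_L2 lborel g)\<^sup>2) else 0)"
proof -
  interpret finite_measure "torus N" by (rule finite_measure_torus)
  have [measurable]: "g \<in> borel_measurable borel" using S0D(4)[OF g] .
  define C where "C = exp (4 * pi) * S0_norm g"
  define p where "p = real n / real N"
  define q where "q = real m / real N"
  define f where "f = (\<lambda>(k, l) z. train_term g p k z * cnj (train_term g q l z))"
  have tq: "(\<lambda>l. norm (cnj (train_term g q l z))) summable_on UNIV" for z
    using train_term_summable[OF g, of q z] by simp
  have nf: "(\<integral>\<^sup>+i. norm (f i z) \<partial>count_space UNIV) = (\<integral>\<^sup>+k. norm (train_term g p k z) \<partial>count_space UNIV) * (\<integral>\<^sup>+l. norm (train_term g q l z) \<partial>count_space UNIV)" for z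
    using has_sum_product(2)[OF train_term_summable[OF g, of p z] tq[of z]] by (simp add: f_def split_beta')
  have fle: "(\<integral>\<^sup>+i. norm (f i z) \<partial>count_space UNIV) \<le> ennreal C * ennreal C" for z
    unfolding nf norm_train_term C_def by (intro mult_mono nn_integral_samples_bound g) auto
  have fs: "(\<lambda>i. norm (f i z)) summable_on UNIV" for z
    unfolding summable_norm_iff_nn_integral by (rule le_less_trans[OF fle]) (simp add: ennreal_mult_less_top)
  have finf: "(\<Sum>\<^sub>\<infinity>i. f i z) = stft_dual g (delta_train N n) z * cnj (stft_dual g (delta_train N m) z)" for z
    using has_sum_product(1)[OF train_term_summable[OF g, of p z] tq[of z]]
    by (simp add: f_def split_beta' stft_delta_train_infsum[OF g] p_def q_def infsumI)
  have fm: "f i \<in> borel_measurable (torus N)" for i unfolding f_def split_beta' by measurable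
  have fin: "(\<integral>\<^sup>+z. \<integral>\<^sup>+i. norm (f i z) \<partial>count_space UNIV \<partial>torus N) < \<infinity>"
  proof -
    have "(\<integral>\<^sup>+z. \<integral>\<^sup>+i. norm (f i z) \<partial>count_space UNIV \<partial>torus N) \<le> (\<integral>\<^sup>+z. ennreal C * ennreal C \<partial>torus N)"
      by (intro nn_integral_mono fle)
    also have "\<dots> < \<infinity>" by (simp add: emeasure_torus ennreal_mult_less_top)
    finally show ?thesis .
  qed
  note hs = has_sum_integral[OF sigma_finite_measure_axioms fm fs fin]
  have cell: "(LINT z|torus N. f (k, l) z)
     = (if n = m \<and> k = l then of_nat N * (LINT x|lborel. of_real ((norm (g (p + of_int k - x)))\<^sup>2) * indicator {0..1} x) else 0)" for k l
  proof -
    \<comment> \<open>the frequency of the product is j / N\<close>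
    define j where "j = int m - int n + int N * (l - k)"
    define A where "A x = cnj (g (p + of_int k - x)) * g (q + of_int l - x) * indicator {0..1} x" for x
    define B where "B \<xi> = cis (2 * pi * of_int j * \<xi> / real N) * (indicator {0..0 + real N} \<xi> :: complex)" for \<xi>
    have box: "{0..1::real} \<times> {0..real N} \<in> sets lborel"
      unfolding lborel_prod[symmetric] by (intro pair_measureI) auto
    have AB: "indicator ({0..1} \<times> {0..real N}) (x, \<xi>) *\<^sub>R f (k, l) (x, \<xi>) = A x * B \<xi>" for x \<xi>
    proof -
      have "real_of_int j / real N = (q + of_int l) - (p + of_int k)"
        using N by (simp add: j_def p_def q_def field_simps)
      then have phase: "2 * pi * of_int j * \<xi> / real N = 2 * pi * \<xi> * ((q + of_int l) - (p + of_int k))"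
        by (metis (no_types, opaque_lifting) mult.assoc mult.commute times_divide_eq_right)
      have "cis (2 * pi * of_int j * \<xi> / real N) = cis (- 2 * pi * \<xi> * (p + of_int k)) * cnj (cis (- 2 * pi * \<xi> * (q + of_int l)))"
        unfolding phase by (simp add: cis_cnj cis_mult algebra_simps)
      then show ?thesis
        by (auto simp: f_def A_def B_def train_term_def indicator_def mult_ac)
    qed
    have int: "integrable lborel (\<lambda>z. indicator ({0..1} \<times> {0..real N}) z *\<^sub>R f (k, l) z)"
      using hs(3)[of "(k, l)"] box unfolding torus_def by (subst (asm) integrable_restrict_space) (auto simp: set_integrable_def)
    have "(LINT z|torus N. f (k, l) z) = (LINT z|lborel. indicator ({0..1} \<times> {0..real N}) z *\<^sub>R f (k, l) z)"
      unfolding torus_def using box by (subst integral_restrict_space) auto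
    also have "\<dots> = (LINT x|lborel. LINT \<xi>|lborel. A x * B \<xi>)"
      using lborel_pair.integral_fst'[of "\<lambda>z. indicator ({0..1} \<times> {0..real N}) z *\<^sub>R f (k, l) z"] int
      by (simp add: lborel_prod AB)
    also have "\<dots> = (LINT x|lborel. A x) * (LINT \<xi>|lborel. B \<xi>)"
      by (simp only: integral_mult_right_zero integral_mult_left_zero)
    also have "(LINT \<xi>|lborel. B \<xi>) = (if j = 0 then of_nat N else 0)"
      unfolding B_def using N by (subst integral_cis_period) auto
    also have "j = 0 \<longleftrightarrow> n = m \<and> k = l"
    proof
      assume "j = 0"
      then have e: "int n - int m = int N * (l - k)" by (simp add: j_def)
      have "l - k = 0"
      proof (rule ccontr)
        assume "l - k \<noteq> 0"
        then have "int N * 1 \<le> int N * \<bar>l - k\<bar>" by (intro mult_left_mono) auto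
        also have "\<dots> = \<bar>int n - int m\<bar>" unfolding e by (simp add: abs_mult)
        finally show False using nm by linarith
      qed
      then show "n = m \<and> k = l" using e by simp
    qed (simp add: j_def)
    finally have I: "(LINT z|torus N. f (k, l) z) = (LINT x|lborel. A x) * (if n = m \<and> k = l then of_nat N else 0)" .
    show ?thesis
    proof (cases "n = m \<and> k = l")
      case True
      then have "p = q" by (simp add: p_def q_def)
      then have "A = (\<lambda>x. of_real ((norm (g (p + of_int k - x)))\<^sup>2) * indicator {0..1} x)"
        unfolding A_def complex_norm_square using True by (simp add: mult_ac)
      then show ?thesis unfolding I using True by (simp only: if_True simp_thms mult.commute)
    qed (use I in auto)
  qed
  have tot: "((\<lambda>i. LINT z|torus N. f i z) has_sum inner_L2 (torus N) (stft_dual g (delta_train N n)) (stft_dual g (delta_train N m))) UNIV"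
    using hs(2) unfolding finf inner_L2_def .
  show ?thesis
  proof (cases "n = m")
    case False
    then have "(\<lambda>i. LINT z|torus N. f i z) = (\<lambda>i. 0)" using cell by auto
    then show ?thesis using tot False by (simp add: has_sum_0 has_sum_unique[OF _ has_sum_0])
  next
    case True
    define w where "w k = (LINT x|lborel. complex_of_real ((norm (g (p + of_int k - x)))\<^sup>2) * indicator {0..1} x)" for k :: int
    have "((\<lambda>k. of_nat N * w k) has_sum (of_nat N * complex_of_real ((norm_L2 lborel g)\<^sup>2))) UNIV"
      unfolding w_def by (intro has_sum_cmult_right lattice_cells_has_sum S0D(1) g)
    then have "(((\<lambda>i. LINT z|torus N. f i z) \<circ> (\<lambda>k. (k, k))) has_sum (of_nat N * complex_of_real ((norm_L2 lborel g)\<^sup>2))) UNIV"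
      using True by (simp add: o_def cell w_def)
    then have "((\<lambda>i. LINT z|torus N. f i z) has_sum (of_nat N * complex_of_real ((norm_L2 lborel g)\<^sup>2))) (range (\<lambda>k. (k, k)))"
      by (subst has_sum_reindex) (auto simp: inj_on_def)
    then have "((\<lambda>i. LINT z|torus N. f i z) has_sum (of_nat N * complex_of_real ((norm_L2 lborel g)\<^sup>2))) UNIV"
      by (subst has_sum_cong_neutral[where T="range (\<lambda>k. (k, k))"]) (auto simp: cell)
    then show ?thesis using has_sum_unique[OF tot] True by simp
  qed
qed

section \<open>The reproducing kernel\<close>

lemma stft_delta_comb:
  "stft_dual g (delta_comb N a) = (\<lambda>z. \<Sum>n<N. a n * stft_dual g (delta_train N n) z)"
  by (auto simp: stft_dual_def delta_comb_def split: prod.splits)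

text \<open>
  The commutation relation of time-frequency shifts: moving \<open>M\<^sub>\<xi>\<close> to the left of the translation by \<open>k1\<close>
  costs the phase in front of the inner product.
\<close>
lemma lattice_term_eq:
  "cis (- 2 * pi * of_int k1 * \<xi>) * inner_L2 lborel (tf_shift (x + of_int k1) (\<xi> + real N * of_int k2) g) h
     = inner_L2 lborel (modulation (real N * of_int k2) (translation (of_int k1) (tf_shift x \<xi> g))) h"
proof -
  have "cis (- 2 * pi * of_int k1 * \<xi>) * tf_shift (x + of_int k1) (\<xi> + real N * of_int k2) g t
     = modulation (real N * of_int k2) (translation (of_int k1) (tf_shift x \<xi> g)) t" for t
  proof -
    have "cis (- 2 * pi * of_int k1 * \<xi>) * cis (2 * pi * (\<xi> + real N * of_int k2) * t)
       = cis (2 * pi * (real N * of_int k2) * t) * cis (2 * pi * \<xi> * (t - of_int k1))"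
      by (simp add: cis_mult algebra_simps)
    then show ?thesis
      by (simp add: tf_shift_eq modulation_def translation_def mult.assoc[symmetric] diff_diff_eq add.commute)
  qed
  then show ?thesis
    unfolding inner_L2_def by (simp flip: integral_mult_right_zero mult.assoc)
qed

theorem proposition13:
  fixes N :: nat and g :: "real \<Rightarrow> complex"
  assumes "N \<ge> 1" and "g \<in> S0 - {\<lambda>_. 0}"
  shows "stft_space N g \<subseteq> square_integrable (torus N) \<and>
    rkhs (stft_space N g) (inner_L2 (torus N)) \<and>
    (\<exists>!K. is_reproducing_kernel (stft_space N g) (inner_L2 (torus N)) K) \<and>
    (\<forall>K. is_reproducing_kernel (stft_space N g) (inner_L2 (torus N)) K \<longrightarrow>
      (\<forall>x' \<xi>' x \<xi> :: real.
        K (x', \<xi>') (x, \<xi>) =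
          1 / complex_of_real (real N * (norm_L2 lborel g)\<^sup>2) *
          (\<Sum>n<N. cis (2 * pi * (\<xi> - \<xi>') * (real n / real N)) *
             cnj (zak (\<lambda>t. cnj (g t)) (real n / real N - x) \<xi>) *
             zak (\<lambda>t. cnj (g t)) (real n / real N - x') \<xi>') \<and>
        K (x', \<xi>') (x, \<xi>) =
          complex_of_real (real N / (norm_L2 lborel g)\<^sup>2) *
          inner_SN N (double_periodization N (tf_shift x \<xi> g))
                     (double_periodization N (tf_shift x' \<xi>' g)) \<and>
        (\<lambda>(k1::int, k2::int). cis (- 2 * pi * of_int k1 * \<xi>) *
             inner_L2 lborel (tf_shift (x + of_int k1) (\<xi> + real N * of_int k2) g)
                             (tf_shift x' \<xi>' g)) summable_on UNIV \<and>
        K (x', \<xi>') (x, \<xi>) =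
          1 / complex_of_real ((norm_L2 lborel g)\<^sup>2) *
          (\<Sum>\<^sub>\<infinity>(k1::int, k2::int). cis (- 2 * pi * of_int k1 * \<xi>) *
             inner_L2 lborel (tf_shift (x + of_int k1) (\<xi> + real N * of_int k2) g)
                             (tf_shift x' \<xi>' g))))"
proof -
  have N: "N \<ge> 1" and g: "g \<in> S0" and g0: "g \<noteq> (\<lambda>_. 0)" using assms by auto
  define E where "E n = stft_dual g (delta_train N n)" for n
  define G where "G = (norm_L2 lborel g)\<^sup>2"
  have G: "0 < G" unfolding G_def by (rule norm_L2_pos[OF g g0])
  interpret finite_orthogonal_family "torus N" N E "real N * G"
    by unfold_locales
      (use N G in \<open>auto simp: E_def G_def stft_delta_train_square_integrable[OF g] stft_delta_train_orthogonal[OF _ g]\<close>)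
  have comb: "stft_dual g (delta_comb N a) = comb a" for a
    unfolding stft_delta_comb comb_def E_def ..
  have space: "stft_space N g = H"
    by (auto simp: stft_space_def SN_def comb image_image)
  \<comment> \<open>orthogonality also shows that the delta trains are linearly independent\<close>
  have coeffs: "(\<forall>n<N. a n = b n)" if "delta_comb N a = delta_comb N b" for a b
    using that comb comb_eq_iff by metis
  have inner: "inner_SN N (delta_comb N a) (delta_comb N b) = (\<Sum>n<N. a n * cnj (b n))" for a b
    unfolding inner_SN_def
  proof (rule the_equality)
    fix c assume "\<exists>a' b'. delta_comb N a = delta_comb N a' \<and> delta_comb N b = delta_comb N b' \<and> c = (\<Sum>n<N. a' n * cnj (b' n))"
    then obtain a' b' where ab: "delta_comb N a = delta_comb N a'" "delta_comb N b = delta_comb N b'" "c = (\<Sum>n<N. a' n * cnj (b' n))"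
      by blast
    show "c = (\<Sum>n<N. a n * cnj (b n))"
      unfolding ab(3) using coeffs[OF ab(1)] coeffs[OF ab(2)] by (intro sum.cong) auto
  qed blast
  have kernel_zak: "kernel (x', \<xi>') (x, \<xi>) =
      1 / complex_of_real (real N * G) *
          (\<Sum>n<N. cis (2 * pi * (\<xi> - \<xi>') * (real n / real N)) *
             cnj (zak (\<lambda>t. cnj (g t)) (real n / real N - x) \<xi>) *
             zak (\<lambda>t. cnj (g t)) (real n / real N - x') \<xi>')" for x' \<xi>' x \<xi>
  proof -
    have "E n (x', \<xi>') * cnj (E n (x, \<xi>)) = cis (2 * pi * (\<xi> - \<xi>') * (real n / real N)) *
             cnj (zak (\<lambda>t. cnj (g t)) (real n / real N - x) \<xi>) *
             zak (\<lambda>t. cnj (g t)) (real n / real N - x') \<xi>'" for n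
    proof -
      have "cis (2 * pi * (\<xi> - \<xi>') * (real n / real N)) = cis (- 2 * pi * \<xi>' * (real n / real N)) * cnj (cis (- 2 * pi * \<xi> * (real n / real N)))"
        by (simp only: cis_cnj cis_mult) (simp add: algebra_simps)
      then show ?thesis
        unfolding E_def stft_delta_train[OF g] complex_cnj_mult by (simp only: mult_ac)
    qed
    then show ?thesis unfolding kernel_def by simp
  qed
  have dp: "double_periodization N (tf_shift x \<xi> g) = delta_comb N (\<lambda>n. 1 / of_nat N * cnj (E n (x, \<xi>)))" for x \<xi>
    unfolding double_periodization_eq[OF N S0_tf_shift[OF g]] samples_tf_shift[OF g] E_def ..
  have kernel_SN: "kernel (x', \<xi>') (x, \<xi>) =
          complex_of_real (real N / G) *
          inner_SN N (double_periodization N (tf_shift x \<xi> g)) (double_periodization N (tf_shift x' \<xi>' g))" for x' \<xi>' x \<xi>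
    unfolding dp inner kernel_def using N G
    by (simp add: sum_distrib_left field_simps)
  have series: "((\<lambda>(k1::int, k2::int). cis (- 2 * pi * of_int k1 * \<xi>) *
             inner_L2 lborel (tf_shift (x + of_int k1) (\<xi> + real N * of_int k2) g) (tf_shift x' \<xi>' g))
       has_sum (of_real G * kernel (x', \<xi>') (x, \<xi>))) UNIV" for x' \<xi>' x \<xi>
  proof -
    have "((\<lambda>(k1::int, k2::int). dual_of (modulation (real N * of_int k2) (translation (of_int k1) (tf_shift x \<xi> g))) (tf_shift x' \<xi>' g))
       has_sum delta_comb N (\<lambda>n. 1 / of_nat N * cnj (E n (x, \<xi>))) (tf_shift x' \<xi>' g)) UNIV"
      using double_periodization_has_sum[OF N S0_tf_shift[OF g] S0_tf_shift[OF g], of x \<xi> x' \<xi>']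
      unfolding samples_tf_shift[OF g] E_def .
    also have "delta_comb N (\<lambda>n. 1 / of_nat N * cnj (E n (x, \<xi>))) (tf_shift x' \<xi>' g) = of_real G * kernel (x', \<xi>') (x, \<xi>)"
    proof -
      have "delta_train N n (tf_shift x' \<xi>' g) = E n (x', \<xi>')" for n by (simp add: E_def stft_dual_def)
      then show ?thesis unfolding delta_comb_def kernel_def using N G by (simp add: sum_distrib_left field_simps)
    qed
    finally show ?thesis
      unfolding lattice_term_eq using S0_tf_shift[OF g, of x' \<xi>'] by (simp add: dual_of_def)
  qed
  have series_kernel: "kernel (x', \<xi>') (x, \<xi>) =
          1 / complex_of_real G *
          (\<Sum>\<^sub>\<infinity>(k1::int, k2::int). cis (- 2 * pi * of_int k1 * \<xi>) *
             inner_L2 lborel (tf_shift (x + of_int k1) (\<xi> + real N * of_int k2) g)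
                             (tf_shift x' \<xi>' g))" for x' \<xi>' x \<xi>
    unfolding infsumI[OF series] using G by simp
  show ?thesis
  proof (intro conjI allI impI)
    show "stft_space N g \<subseteq> square_integrable (torus N)"
      unfolding space using comb_square_integrable by blast
    show "rkhs (stft_space N g) (inner_L2 (torus N))" unfolding space by (rule rkhs)
    show "\<exists>!K. is_reproducing_kernel (stft_space N g) (inner_L2 (torus N)) K"
      unfolding space using kernel_reproducing reproducing_kernel_unique by blast
  next
    fix K x' \<xi>' x \<xi>
    assume "is_reproducing_kernel (stft_space N g) (inner_L2 (torus N)) K"
    then have K: "K = kernel" unfolding space by (rule reproducing_kernel_unique)
    note eqs = kernel_zak kernel_SN series_kernel
    show "K (x', \<xi>') (x, \<xi>) =
          1 / complex_of_real (real N * (norm_L2 lborel g)\<^sup>2) *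
          (\<Sum>n<N. cis (2 * pi * (\<xi> - \<xi>') * (real n / real N)) *
             cnj (zak (\<lambda>t. cnj (g t)) (real n / real N - x) \<xi>) *
             zak (\<lambda>t. cnj (g t)) (real n / real N - x') \<xi>')"
      unfolding K G_def[symmetric] by (rule eqs)
    show "K (x', \<xi>') (x, \<xi>) =
          complex_of_real (real N / (norm_L2 lborel g)\<^sup>2) *
          inner_SN N (double_periodization N (tf_shift x \<xi> g))
                     (double_periodization N (tf_shift x' \<xi>' g))"
      unfolding K G_def[symmetric] by (rule eqs)
    show "(\<lambda>(k1::int, k2::int). cis (- 2 * pi * of_int k1 * \<xi>) *
             inner_L2 lborel (tf_shift (x + of_int k1) (\<xi> + real N * of_int k2) g)
                             (tf_shift x' \<xi>' g)) summable_on UNIV"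
      using series by (rule has_sum_imp_summable)
    show "K (x', \<xi>') (x, \<xi>) =
          1 / complex_of_real ((norm_L2 lborel g)\<^sup>2) *
          (\<Sum>\<^sub>\<infinity>(k1::int, k2::int). cis (- 2 * pi * of_int k1 * \<xi>) *
             inner_L2 lborel (tf_shift (x + of_int k1) (\<xi> + real N * of_int k2) g)
                             (tf_shift x' \<xi>' g))"
      unfolding K G_def[symmetric] by (rule eqs)
  qed
qed

end
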